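(* Let $\mathcal{P}$ be a connected weight graded operad and let $d>0$ be an integer. Let $q\mathcal{P}^{[d]}$ be the $d$-th quadratic Veronese power of $\mathcal{P}$, let $(q\mathcal{P}^{[d]})^{¡}$ be its (classical) quadratic dual cooperad, and let $\mathcal{P}^{¡}_{[d]}$ be the weight $d$ Koszul dual cooperad of $\mathcal{P}$. Then there is an isomorphism of cooperads $$\left(q\mathcal{P}^{[d]}\right)^{¡}\cong \mathcal{P}^{¡}_{[d]}.$$
   Context: We work over a field $\Bbbk$ of characteristic zero. All operads are reduced ($\mathcal{P}(0)=0$), (nonnegatively) weight graded ($\mathcal{P}(n)=\bigoplus_{k\ge 0}\mathcal{P}(n)_{(k)}$, compositions being additive in weight) and connected ($\mathcal{P}(1)_{(0)}=\Bbbk$, $\mathcal{P}(n)_{(0)}=0$ for $n>1$); $\overline{\mathcal{P}}$ is the augmentation ideal, and $\mathcal{P}_{(k)}$ the subcollection of elements of weight $k$. $\mathcal{T}(\mathcal{X})$ is the free operad on $\mathcal{X}$, and $\mathcal{T}^c(\mathcal{X})$ the cofree conilpotent cooperad; $s$ is an element of degree $1$, and $s\mathcal{X}=\Bbbk s\otimes\mathcal{X}$. Quadratic Veronese power: $q\mathcal{P}^{[d]}$ is the quotient of $\mathcal{T}(\mathcal{P}_{(d)})$ by the ideal generated by $\mathcal{I}\cap\mathcal{T}(\mathcal{P}_{(d)})_{(2)}$, where $\mathcal{I}\subset\mathcal{T}(\mathcal{P}_{(d)})$ is the kernel of the evaluation map $\mathcal{T}(\mathcal{P}_{(d)})\to\mathcal{P}$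 and the subscript $(2)$ refers to the grading in which the generators $\mathcal{P}_{(d)}$ have weight one. Quadratic dual: for a quadratic operad $\mathcal{T}(E)/(R)$, $R\subset\mathcal{T}(E)_{(2)}$, its quadratic dual cooperad $(\mathcal{T}(E)/(R))^{¡}$ is the quadratic cooperad with cogenerators $sE$ and corelations $s^2R$, i.e. the largest subcooperad of $\mathcal{T}^c(sE)$ whose weight two part is contained in $s^2R$. Weight $d$ Koszul dual cooperad: $\mathcal{P}^{¡}_{[d]}$ is the largest dg subcooperad of the bar complex $\mathsf{B}(\mathcal{P})=(\mathcal{T}^c(s\overline{\mathcal{P}}),d_{\mathsf{B}(\mathcal{P})})$ that is cogenerated (as a non-dg cooperad) by $s\overline{\mathcal{P}}_{(d)}$, i.e. that is contained in $\mathcal{T}^c(s\overline{\mathcal{P}}_{(d)})$. *)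

theory Defs
  imports Complex_Main "HOL-Library.Poly_Mapping" "HOL-Combinatorics.Permutations"
begin

section \<open>Linear algebra conventions\<close>

text \<open>
  A graded vector space is a family, indexed by the degree, of subspaces of one ambient vector
  space; this loses no generality, and the subspaces of different degree are only used one degree
  at a time. The spaces constructed below (free operads, cofree cooperads, tensor products) are
  quotients \<open>U / N\<close>, where \<open>N\<close> and \<open>U\<close> are subspaces of a free vector space \<open>'a \<Rightarrow>\<^sub>0 'k\<close>: elements
  of \<open>U\<close> represent elements of the quotient, and \<open>x\<close>, \<open>y\<close> in \<open>U\<close> represent the same
  element iff \<open>x - y \<in> N\<close>. A subspace of \<open>U / N\<close> is given by its full preimage in \<open>U\<close>.
\<close>

definition pscale :: "'k::field \<Rightarrow> ('a \<Rightarrow>\<^sub>0 'k) \<Rightarrow> ('a \<Rightarrow>\<^sub>0 'k)" where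
  "pscale c p = Poly_Mapping.map ((*) c) p"

lemma lookup_pscale: "Poly_Mapping.lookup (pscale c p) a = c * Poly_Mapping.lookup p a"
  unfolding pscale_def by transfer (simp add: when_def)

interpretation pm: vector_space "pscale :: 'k::field \<Rightarrow> ('a \<Rightarrow>\<^sub>0 'k) \<Rightarrow> ('a \<Rightarrow>\<^sub>0 'k)"
  by standard (auto intro!: poly_mapping_eqI simp: lookup_pscale Poly_Mapping.lookup_add algebra_simps)

definition lin_ext :: "('k::field \<Rightarrow> 'v::ab_group_add \<Rightarrow> 'v) \<Rightarrow> ('a \<Rightarrow> 'v) \<Rightarrow> ('a \<Rightarrow>\<^sub>0 'k) \<Rightarrow> 'v" where
  "lin_ext scl f v = (\<Sum>a\<in>Poly_Mapping.keys v. scl (Poly_Mapping.lookup v a) (f a))"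

abbreviation lin :: "('a \<Rightarrow> 'b \<Rightarrow>\<^sub>0 'k) \<Rightarrow> ('a \<Rightarrow>\<^sub>0 'k::field) \<Rightarrow> 'b \<Rightarrow>\<^sub>0 'k" where
  "lin \<equiv> lin_ext pscale"

abbreviation gen :: "'a \<Rightarrow> 'a \<Rightarrow>\<^sub>0 'k::field" where
  "gen a \<equiv> Poly_Mapping.single a 1"

definition tensor :: "('a \<Rightarrow>\<^sub>0 'k::field) \<Rightarrow> ('b \<Rightarrow>\<^sub>0 'k) \<Rightarrow> 'a \<times> 'b \<Rightarrow>\<^sub>0 'k" (infixr \<open>\<otimes>\<^sub>p\<close> 70) where
  "x \<otimes>\<^sub>p y = lin (\<lambda>a. lin (\<lambda>b. gen (a, b)) y) x"

definition ksign :: "int \<Rightarrow> 'k::field" where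
  "ksign a = (if even a then 1 else - 1)"


section \<open>Weight graded operads\<close>

text \<open>
  Inputs of an \<open>n\<close>-ary operation are numbered \<open>0, \<dots>, n - 1\<close>. Symmetric groups act from the right:
  \<open>(x\<sigma>)(a\<^sub>0, \<dots>, a\<^sub>n\<^sub>-\<^sub>1) = x(a\<^bsub>\<sigma>\<^sup>-\<^sup>1(0)\<^esub>, \<dots>, a\<^bsub>\<sigma>\<^sup>-\<^sup>1(n-1)\<^esub>)\<close>, i.e. the input \<open>j\<close> of \<open>x\<sigma>\<close> is plugged into
  the input \<open>\<sigma> j\<close> of \<open>x\<close>.
\<close>

record ('k, 'p) collection =
  cscale :: "'k \<Rightarrow> 'p \<Rightarrow> 'p"
  csp :: "nat \<Rightarrow> int \<Rightarrow> 'p set"  \<comment> \<open>arity, degree\<close>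
  cact :: "nat \<Rightarrow> (nat \<Rightarrow> nat) \<Rightarrow> 'p \<Rightarrow> 'p"

record ('k, 'p) wg_operad =
  scl :: "'k \<Rightarrow> 'p \<Rightarrow> 'p"
  wpart :: "nat \<Rightarrow> nat \<Rightarrow> int \<Rightarrow> 'p set"  \<comment> \<open>arity, weight, degree\<close>
  act :: "nat \<Rightarrow> (nat \<Rightarrow> nat) \<Rightarrow> 'p \<Rightarrow> 'p"
  pcomp :: "nat \<Rightarrow> nat \<Rightarrow> nat \<Rightarrow> 'p \<Rightarrow> 'p \<Rightarrow> 'p"
    \<comment> \<open>\<open>pcomp P n m i x y\<close> is \<open>x \<circ>\<^sub>i y\<close> for \<open>x\<close> of arity \<open>n\<close> and \<open>y\<close> of arity \<open>m\<close>\<close>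
  ounit :: 'p

definition whole :: "('k::field, 'p::ab_group_add) wg_operad \<Rightarrow> nat \<Rightarrow> int \<Rightarrow> 'p set" where
  "whole P n e = module.span (scl P) (\<Union>k. wpart P n k e)"

definition aug :: "('k::field, 'p::ab_group_add) wg_operad \<Rightarrow> nat \<Rightarrow> int \<Rightarrow> 'p set" where
  "aug P n e = module.span (scl P) (\<Union>k\<in>{1..}. wpart P n k e)"

text \<open>The permutation \<open>\<sigma> \<circ>\<^sub>i \<tau>\<close> with \<open>(x\<sigma>) \<circ>\<^sub>i (y\<tau>) = (x \<circ>\<^bsub>\<sigma> i\<^esub> y)(\<sigma> \<circ>\<^sub>i \<tau>)\<close>, for \<open>y\<close> of arity \<open>m\<close>.\<close>

definition perm_comp :: "nat \<Rightarrow> nat \<Rightarrow> (nat \<Rightarrow> nat) \<Rightarrow> (nat \<Rightarrow> nat) \<Rightarrow> nat \<Rightarrow> nat" where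
  "perm_comp m i \<sigma> \<tau> j =
    (if i \<le> j \<and> j < i + m then \<sigma> i + \<tau> (j - i)
     else let q = \<sigma> (if j < i then j else j + 1 - m) in if q < \<sigma> i then q else q + m - 1)"

locale connected_wg_operad =
  fixes P :: "('k::field_char_0, 'p::ab_group_add) wg_operad"
  assumes vs: "vector_space (scl P)"
    and wpart_subspace: "module.subspace (scl P) (wpart P n k e)"
    and wpart_direct: "\<lbrakk>finite K; \<And>k. k \<in> K \<Longrightarrow> u k \<in> wpart P n k e; (\<Sum>k\<in>K. u k) = 0; k \<in> K\<rbrakk>
          \<Longrightarrow> u k = 0"
    and act_wpart: "\<lbrakk>\<sigma> permutes {..<n}; x \<in> wpart P n k e\<rbrakk> \<Longrightarrow> act P n \<sigma> x \<in> wpart P n k e"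
    and act_add: "\<lbrakk>\<sigma> permutes {..<n}; x \<in> whole P n e; y \<in> whole P n e\<rbrakk>
          \<Longrightarrow> act P n \<sigma> (x + y) = act P n \<sigma> x + act P n \<sigma> y"
    and act_scale: "\<lbrakk>\<sigma> permutes {..<n}; x \<in> whole P n e\<rbrakk>
          \<Longrightarrow> act P n \<sigma> (scl P c x) = scl P c (act P n \<sigma> x)"
    and act_id: "x \<in> whole P n e \<Longrightarrow> act P n id x = x"
    and act_comp: "\<lbrakk>\<sigma> permutes {..<n}; \<tau> permutes {..<n}; x \<in> whole P n e\<rbrakk>
          \<Longrightarrow> act P n (\<sigma> \<circ> \<tau>) x = act P n \<tau> (act P n \<sigma> x)"
    and pcomp_wpart: "\<lbrakk>i < n; x \<in> wpart P n k e; y \<in> wpart P m l f\<rbrakk>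
          \<Longrightarrow> pcomp P n m i x y \<in> wpart P (n + m - 1) (k + l) (e + f)"
    and pcomp_add_left: "\<lbrakk>i < n; x \<in> whole P n e; x' \<in> whole P n e; y \<in> whole P m f\<rbrakk>
          \<Longrightarrow> pcomp P n m i (x + x') y = pcomp P n m i x y + pcomp P n m i x' y"
    and pcomp_add_right: "\<lbrakk>i < n; x \<in> whole P n e; y \<in> whole P m f; y' \<in> whole P m f\<rbrakk>
          \<Longrightarrow> pcomp P n m i x (y + y') = pcomp P n m i x y + pcomp P n m i x y'"
    and pcomp_scale_left: "\<lbrakk>i < n; x \<in> whole P n e; y \<in> whole P m f\<rbrakk>
          \<Longrightarrow> pcomp P n m i (scl P c x) y = scl P c (pcomp P n m i x y)"
    and pcomp_scale_right: "\<lbrakk>i < n; x \<in> whole P n e; y \<in> whole P m f\<rbrakk>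
          \<Longrightarrow> pcomp P n m i x (scl P c y) = scl P c (pcomp P n m i x y)"
    and pcomp_equivariant: "\<lbrakk>i < n; \<sigma> permutes {..<n}; \<tau> permutes {..<m};
            x \<in> whole P n e; y \<in> whole P m f\<rbrakk>
          \<Longrightarrow> pcomp P n m i (act P n \<sigma> x) (act P m \<tau> y) =
              act P (n + m - 1) (perm_comp m i \<sigma> \<tau>) (pcomp P n m (\<sigma> i) x y)"
    and pcomp_sequential: "\<lbrakk>i < n; j < m; x \<in> whole P n e; y \<in> whole P m f; z \<in> whole P l g\<rbrakk>
          \<Longrightarrow> pcomp P (n + m - 1) l (i + j) (pcomp P n m i x y) z =
              pcomp P n (m + l - 1) i x (pcomp P m l j y z)"
    and pcomp_parallel: "\<lbrakk>i < k; k < n; x \<in> whole P n e; y \<in> whole P m f; z \<in> whole P l g\<rbrakk>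
          \<Longrightarrow> pcomp P (n + m - 1) l (k + m - 1) (pcomp P n m i x y) z =
              scl P (ksign (f * g)) (pcomp P (n + l - 1) m i (pcomp P n l k x z) y)"
    and pcomp_unit_left: "x \<in> whole P n e \<Longrightarrow> pcomp P 1 n 0 (ounit P) x = x"
    and pcomp_unit_right: "\<lbrakk>i < n; x \<in> whole P n e\<rbrakk> \<Longrightarrow> pcomp P n 1 i x (ounit P) = x"
    and reduced: "wpart P 0 k e = {0}"
    and connected_unit: "ounit P \<noteq> 0" "wpart P 1 0 0 = module.span (scl P) {ounit P}"
    and connected_arity_one: "e \<noteq> 0 \<Longrightarrow> wpart P 1 0 e = {0}"
    and connected_higher: "n > 1 \<Longrightarrow> wpart P n 0 e = {0}"

definition aug_coll :: "('k::field, 'p::ab_group_add) wg_operad \<Rightarrow> ('k, 'p) collection" where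
  "aug_coll P = \<lparr>cscale = scl P, csp = aug P, cact = act P\<rparr>"

definition wt_coll :: "('k, 'p) wg_operad \<Rightarrow> nat \<Rightarrow> ('k, 'p) collection" where
  "wt_coll P d = \<lparr>cscale = scl P, csp = (\<lambda>n e. wpart P n d e), cact = act P\<rparr>"

text \<open>The element \<open>s \<otimes> x\<close> of \<open>sX\<close> is represented by \<open>x\<close>, with the degree raised by one.\<close>

definition susp :: "('k, 'p) collection \<Rightarrow> ('k, 'p) collection" where
  "susp X = X\<lparr>csp := \<lambda>n e. csp X n (e - 1)\<rparr>"


section \<open>Decorated trees\<close>

text \<open>
  In \<open>Node e x ts\<close> the vertex is decorated by the homogeneous element \<open>x\<close> of degree \<open>e\<close> and arity
  \<open>length ts\<close>. A tree with leaves \<open>0, \<dots>, n - 1\<close> stands for the tensor product of its decorations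
  taken in depth-first preorder, and as an \<open>n\<close>-ary operation it plugs the \<open>j\<close>-th argument into the
  leaf labelled \<open>j\<close>. All signs come from the Koszul rule for this ordering.
\<close>

datatype 'p tree = Leaf nat | Node int 'p "'p tree list"

primrec leaves :: "'p tree \<Rightarrow> nat list" where
  "leaves (Leaf l) = [l]"
| "leaves (Node e x ts) = concat (map leaves ts)"

primrec tdeg :: "'p tree \<Rightarrow> int" where
  "tdeg (Leaf l) = 0"
| "tdeg (Node e x ts) = e + sum_list (map tdeg ts)"

primrec twt :: "'p tree \<Rightarrow> nat" where
  "twt (Leaf l) = 0"
| "twt (Node e x ts) = 1 + sum_list (map twt ts)"

primrec relabel :: "(nat \<Rightarrow> nat) \<Rightarrow> 'p tree \<Rightarrow> 'p tree" where
  "relabel f (Leaf l) = Leaf (f l)"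
| "relabel f (Node e x ts) = Node e x (map (relabel f) ts)"

primrec decorated :: "('k, 'p) collection \<Rightarrow> 'p tree \<Rightarrow> bool" where
  "decorated X (Leaf l) \<longleftrightarrow> True"
| "decorated X (Node e x ts) \<longleftrightarrow> x \<in> csp X (length ts) e \<and> list_all (\<lambda>b. b) (map (decorated X) ts)"

definition trees :: "('k, 'p) collection \<Rightarrow> nat \<Rightarrow> int \<Rightarrow> 'p tree set" where
  "trees X n e = {t. decorated X t \<and> distinct (leaves t) \<and> set (leaves t) = {..<n} \<and> tdeg t = e}"

definition tree_space :: "('k::field, 'p) collection \<Rightarrow> nat \<Rightarrow> int \<Rightarrow> ('p tree \<Rightarrow>\<^sub>0 'k) set" where
  "tree_space X n e = pm.span (gen ` trees X n e)"

text \<open>The Koszul sign of moving the \<open>i\<close>-th of \<open>n\<close> factors of degrees \<open>g i\<close> to the place \<open>\<sigma> i\<close>.\<close>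

definition perm_sign :: "nat \<Rightarrow> (nat \<Rightarrow> nat) \<Rightarrow> (nat \<Rightarrow> int) \<Rightarrow> 'k::field" where
  "perm_sign n \<sigma> g = (\<Prod>(i, j) \<in> {(i, j). i < j \<and> j < n \<and> \<sigma> i > \<sigma> j}. ksign (g i * g j))"

inductive_set relators :: "('k::field, 'p::ab_group_add) collection \<Rightarrow> ('p tree \<Rightarrow>\<^sub>0 'k) set"
  for X :: "('k, 'p) collection" where
  additive: "\<lbrakk>x \<in> csp X (length ts) e; y \<in> csp X (length ts) e\<rbrakk> \<Longrightarrow>
    gen (Node e (x + y) ts) - gen (Node e x ts) - gen (Node e y ts) \<in> relators X"
| scaling: "x \<in> csp X (length ts) e \<Longrightarrow>
    gen (Node e (cscale X c x) ts) - pscale c (gen (Node e x ts)) \<in> relators X"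
| equivariance: "\<lbrakk>x \<in> csp X (length ts) e; \<sigma> permutes {..<length ts}\<rbrakk> \<Longrightarrow>
    gen (Node e (cact X (length ts) \<sigma> x) ts)
      - pscale (perm_sign (length ts) \<sigma> (\<lambda>i. tdeg (ts ! i)))
          (gen (Node e x (map (\<lambda>j. ts ! (inv \<sigma> j)) [0..<length ts]))) \<in> relators X"
| in_context: "r \<in> relators X \<Longrightarrow> lin (\<lambda>t. gen (Node e x (us @ t # vs))) r \<in> relators X"

definition tree_null :: "('k::field, 'p::ab_group_add) collection \<Rightarrow> nat \<Rightarrow> int \<Rightarrow> ('p tree \<Rightarrow>\<^sub>0 'k) set" where
  "tree_null X n e = pm.span {r \<in> relators X. Poly_Mapping.keys r \<subseteq> trees X n e}"

text \<open>
  The collection underlying both the free operad and the cofree conilpotent cooperad on \<open>X\<close> is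
  \<open>tree_space X / tree_null X\<close>. Trees of weight \<open>w\<close> have \<open>w\<close> vertices; the relations are
  homogeneous for this weight.
\<close>

definition wt_proj :: "nat \<Rightarrow> ('p tree \<Rightarrow>\<^sub>0 'k::field) \<Rightarrow> ('p tree \<Rightarrow>\<^sub>0 'k)" where
  "wt_proj w = lin (\<lambda>t. if twt t = w then gen t else 0)"

definition tree_space_wt :: "('k::field, 'p) collection \<Rightarrow> nat \<Rightarrow> nat \<Rightarrow> int \<Rightarrow> ('p tree \<Rightarrow>\<^sub>0 'k) set" where
  "tree_space_wt X w n e = pm.span (gen ` {t \<in> trees X n e. twt t = w})"

definition tree_act :: "nat \<Rightarrow> (nat \<Rightarrow> nat) \<Rightarrow> ('p tree \<Rightarrow>\<^sub>0 'k::field) \<Rightarrow> ('p tree \<Rightarrow>\<^sub>0 'k)" where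
  "tree_act n \<sigma> = lin (\<lambda>t. gen (relabel (inv \<sigma>) t))"


section \<open>Free operads, ideals and quotients\<close>

record (overloaded) ('a, 'k) operad =
  osp :: "nat \<Rightarrow> int \<Rightarrow> ('a \<Rightarrow>\<^sub>0 'k) set"
  onull :: "nat \<Rightarrow> int \<Rightarrow> ('a \<Rightarrow>\<^sub>0 'k) set"
  oact :: "nat \<Rightarrow> (nat \<Rightarrow> nat) \<Rightarrow> ('a \<Rightarrow>\<^sub>0 'k) \<Rightarrow> ('a \<Rightarrow>\<^sub>0 'k)"
  opcomp :: "nat \<Rightarrow> nat \<Rightarrow> nat \<Rightarrow> ('a \<Rightarrow>\<^sub>0 'k) \<Rightarrow> ('a \<Rightarrow>\<^sub>0 'k) \<Rightarrow> ('a \<Rightarrow>\<^sub>0 'k)"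
  oone :: "'a \<Rightarrow>\<^sub>0 'k"

primrec graft :: "nat \<Rightarrow> nat \<Rightarrow> 'p tree \<Rightarrow> 'p tree \<Rightarrow> 'p tree" where
  "graft m i u (Leaf l) =
    (if l < i then Leaf l else if l = i then relabel (\<lambda>j. j + i) u else Leaf (l + m - 1))"
| "graft m i u (Node e x ts) = Node e x (map (graft m i u) ts)"

text \<open>The total degree of the vertices after the leaf \<open>i\<close> in preorder.\<close>

primrec deg_after :: "nat \<Rightarrow> 'p tree \<Rightarrow> int" where
  "deg_after i (Leaf l) = 0"
| "deg_after i (Node e x ts) =
    (\<Sum>k<length ts. if i \<in> set (leaves (ts ! k))
       then map (deg_after i) ts ! k + sum_list (map tdeg (drop (k + 1) ts)) else 0)"

definition free_operad :: "('k::field, 'p::ab_group_add) collection \<Rightarrow> ('p tree, 'k) operad" where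
  "free_operad X =
    \<lparr>osp = tree_space X, onull = tree_null X, oact = tree_act,
     opcomp = (\<lambda>n m i v w. lin (\<lambda>t. lin (\<lambda>u.
        pscale (ksign (tdeg u * deg_after i t)) (gen (graft m i u t))) w) v),
     oone = gen (Leaf 0)\<rparr>"

definition operad_ideal :: "('a, 'k::field) operad \<Rightarrow> (nat \<Rightarrow> int \<Rightarrow> ('a \<Rightarrow>\<^sub>0 'k) set) \<Rightarrow> bool" where
  "operad_ideal Q J \<longleftrightarrow>
    (\<forall>n e. pm.subspace (J n e) \<and> onull Q n e \<subseteq> J n e \<and> J n e \<subseteq> osp Q n e) \<and>
    (\<forall>n e \<sigma>. \<sigma> permutes {..<n} \<longrightarrow> oact Q n \<sigma> ` J n e \<subseteq> J n e) \<and>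
    (\<forall>n m i e f x y. i < n \<and> x \<in> J n e \<and> y \<in> osp Q m f
       \<longrightarrow> opcomp Q n m i x y \<in> J (n + m - 1) (e + f)) \<and>
    (\<forall>n m i e f x y. i < n \<and> x \<in> osp Q n e \<and> y \<in> J m f
       \<longrightarrow> opcomp Q n m i x y \<in> J (n + m - 1) (e + f))"

definition ideal_generated ::
  "('a, 'k::field) operad \<Rightarrow> (nat \<Rightarrow> int \<Rightarrow> ('a \<Rightarrow>\<^sub>0 'k) set) \<Rightarrow> nat \<Rightarrow> int \<Rightarrow> ('a \<Rightarrow>\<^sub>0 'k) set" where
  "ideal_generated Q R = Inf {J. operad_ideal Q J \<and> R \<le> J}"

text \<open>
  A quadratic operad is an operad of the form \<open>\<T>(E)/(R)\<close>, together with \<open>E\<close> and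
  \<open>R \<subseteq> \<T>(E)\<^bsub>(2)\<^esub>\<close>.
\<close>

record (overloaded) ('k, 'p) quadratic_operad =
  qgens :: "('k, 'p) collection"
  qrels :: "nat \<Rightarrow> int \<Rightarrow> ('p tree \<Rightarrow>\<^sub>0 'k) set"
  qoperad :: "('p tree, 'k) operad"

definition quadratic_operad ::
  "('k::field, 'p::ab_group_add) collection \<Rightarrow> (nat \<Rightarrow> int \<Rightarrow> ('p tree \<Rightarrow>\<^sub>0 'k) set)
    \<Rightarrow> ('k, 'p) quadratic_operad" where
  "quadratic_operad E R = \<lparr>qgens = E, qrels = R,
     qoperad = (free_operad E)\<lparr>onull := ideal_generated (free_operad E) R\<rparr>\<rparr>"


section \<open>The quadratic Veronese power\<close>

text \<open>
  \<open>fill P n i x [(m\<^sub>0, y\<^sub>0), (m\<^sub>1, y\<^sub>1), \<dots>]\<close> plugs \<open>y\<^sub>0, y\<^sub>1, \<dots>\<close> (of arities \<open>m\<^sub>0, m\<^sub>1, \<dots>\<close>) into the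
  inputs \<open>i, i + 1, \<dots>\<close> of the \<open>n\<close>-ary operation \<open>x\<close>.
\<close>

fun fill :: "('k, 'p) wg_operad \<Rightarrow> nat \<Rightarrow> nat \<Rightarrow> 'p \<Rightarrow> (nat \<times> 'p) list \<Rightarrow> 'p" where
  "fill P n i x [] = x"
| "fill P n i x ((m, y) # ys) = fill P (n + m - 1) (i + m) (pcomp P n m i x y) ys"

primrec planar_eval :: "('k, 'p) wg_operad \<Rightarrow> 'p tree \<Rightarrow> 'p" where
  "planar_eval P (Leaf l) = ounit P"
| "planar_eval P (Node e x ts) =
    fill P (length ts) 0 x (zip (map (\<lambda>t. length (leaves t)) ts) (map (planar_eval P) ts))"

definition leaf_perm :: "'p tree \<Rightarrow> nat \<Rightarrow> nat" where
  "leaf_perm t k = (if k < length (leaves t) then leaves t ! k else k)"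

definition evaluation :: "('k::field, 'p::ab_group_add) wg_operad \<Rightarrow> ('p tree \<Rightarrow>\<^sub>0 'k) \<Rightarrow> 'p" where
  "evaluation P =
    lin_ext (scl P) (\<lambda>t. act P (length (leaves t)) (inv (leaf_perm t)) (planar_eval P t))"

definition eval_kernel ::
  "('k::field, 'p::ab_group_add) wg_operad \<Rightarrow> ('k, 'p) collection \<Rightarrow> nat \<Rightarrow> int \<Rightarrow> ('p tree \<Rightarrow>\<^sub>0 'k) set" where
  "eval_kernel P X n e = {v \<in> tree_space X n e. evaluation P v = 0}"

definition qveronese :: "('k::field, 'p::ab_group_add) wg_operad \<Rightarrow> nat \<Rightarrow> ('k, 'p) quadratic_operad" where
  "qveronese P d = quadratic_operad (wt_coll P d)
     (\<lambda>n e. eval_kernel P (wt_coll P d) n e \<inter> tree_space_wt (wt_coll P d) 2 n e)"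


section \<open>Cooperads\<close>

text \<open>
  The structure of a (graded, counital) cooperad is given by the partial decompositions
  \<open>\<C>(n + m - 1) \<rightarrow> \<C>(n) \<otimes> \<C>(m)\<close>, for \<open>i < n\<close>, dual to \<open>\<circ>\<^sub>i\<close>, with their values represented in the
  tensor product of the ambient spaces. For cooperads concentrated in positive arities this is the
  same as a decomposition map \<open>\<C> \<rightarrow> \<C> \<circ> \<C>\<close> with counit.
\<close>

record (overloaded) ('a, 'k) cooperad =
  ksp :: "nat \<Rightarrow> int \<Rightarrow> ('a \<Rightarrow>\<^sub>0 'k) set"
  knull :: "nat \<Rightarrow> int \<Rightarrow> ('a \<Rightarrow>\<^sub>0 'k) set"
  kact :: "nat \<Rightarrow> (nat \<Rightarrow> nat) \<Rightarrow> ('a \<Rightarrow>\<^sub>0 'k) \<Rightarrow> ('a \<Rightarrow>\<^sub>0 'k)"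
  kdecomp :: "nat \<Rightarrow> nat \<Rightarrow> nat \<Rightarrow> ('a \<Rightarrow>\<^sub>0 'k) \<Rightarrow> ('a \<times> 'a \<Rightarrow>\<^sub>0 'k)"
  kcounit :: "('a \<Rightarrow>\<^sub>0 'k) \<Rightarrow> 'k"

definition tensor_null :: "('a, 'k::field) cooperad \<Rightarrow> nat \<Rightarrow> nat \<Rightarrow> ('a \<times> 'a \<Rightarrow>\<^sub>0 'k) set" where
  "tensor_null C n m =
    pm.span ({x \<otimes>\<^sub>p y | x y e. x \<in> knull C n e} \<union> {x \<otimes>\<^sub>p y | x y e. y \<in> knull C m e})"

definition tensor_space ::
  "('a, 'k::field) cooperad \<Rightarrow> (nat \<Rightarrow> int \<Rightarrow> ('a \<Rightarrow>\<^sub>0 'k) set) \<Rightarrow> nat \<Rightarrow> nat \<Rightarrow> int \<Rightarrow> ('a \<times> 'a \<Rightarrow>\<^sub>0 'k) set" where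
  "tensor_space C S n m e =
    pm.span ({x \<otimes>\<^sub>p y | x y f g. x \<in> S n f \<and> y \<in> S m g \<and> f + g = e} \<union> tensor_null C n m)"

definition subcooperad :: "('a, 'k::field) cooperad \<Rightarrow> (nat \<Rightarrow> int \<Rightarrow> ('a \<Rightarrow>\<^sub>0 'k) set) \<Rightarrow> bool" where
  "subcooperad C S \<longleftrightarrow>
    (\<forall>n e. pm.subspace (S n e) \<and> knull C n e \<subseteq> S n e \<and> S n e \<subseteq> ksp C n e) \<and>
    (\<forall>n e \<sigma>. \<sigma> permutes {..<n} \<longrightarrow> kact C n \<sigma> ` S n e \<subseteq> S n e) \<and>
    (\<forall>n m i e. i < n \<longrightarrow> kdecomp C n m i ` S (n + m - 1) e \<subseteq> tensor_space C S n m e)"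

text \<open>
  An isomorphism is given on representatives; the last clause says that
  \<open>(\<phi> \<otimes> \<phi>) \<circ> \<Delta> = \<Delta> \<circ> \<phi>\<close>, evaluated on an expression of \<open>\<Delta> x\<close> as a sum of tensors.
\<close>

definition cooperad_iso ::
  "('a, 'k::field) cooperad \<Rightarrow> ('b, 'k) cooperad
    \<Rightarrow> (nat \<Rightarrow> int \<Rightarrow> ('a \<Rightarrow>\<^sub>0 'k) \<Rightarrow> ('b \<Rightarrow>\<^sub>0 'k)) \<Rightarrow> bool" where
  "cooperad_iso C D \<phi> \<longleftrightarrow>
    (\<forall>n e. \<forall>x\<in>ksp C n e. \<phi> n e x \<in> ksp D n e \<and> (\<phi> n e x \<in> knull D n e \<longleftrightarrow> x \<in> knull C n e)) \<and>
    (\<forall>n e. \<forall>x\<in>ksp C n e. \<forall>y\<in>ksp C n e. \<phi> n e (x + y) = \<phi> n e x + \<phi> n e y) \<and>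
    (\<forall>n e c. \<forall>x\<in>ksp C n e. \<phi> n e (pscale c x) = pscale c (\<phi> n e x)) \<and>
    (\<forall>n e. \<forall>y\<in>ksp D n e. \<exists>x\<in>ksp C n e. y - \<phi> n e x \<in> knull D n e) \<and>
    (\<forall>n e \<sigma>. \<sigma> permutes {..<n} \<longrightarrow>
       (\<forall>x\<in>ksp C n e. \<phi> n e (kact C n \<sigma> x) - kact D n \<sigma> (\<phi> n e x) \<in> knull D n e)) \<and>
    (\<forall>e. \<forall>x\<in>ksp C 1 e. kcounit D (\<phi> 1 e x) = kcounit C x) \<and>
    (\<forall>n m i e. i < n \<longrightarrow> (\<forall>x\<in>ksp C (n + m - 1) e. \<exists>zs.
       (\<forall>(f, a, b)\<in>set zs. a \<in> ksp C n f \<and> b \<in> ksp C m (e - f)) \<and>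
       kdecomp C n m i x - (\<Sum>(f, a, b)\<leftarrow>zs. a \<otimes>\<^sub>p b) \<in> tensor_null C n m \<and>
       kdecomp D n m i (\<phi> (n + m - 1) e x) - (\<Sum>(f, a, b)\<leftarrow>zs. \<phi> n f a \<otimes>\<^sub>p \<phi> m (e - f) b)
         \<in> tensor_null D n m))"

definition cooperad_isomorphic :: "('a, 'k::field) cooperad \<Rightarrow> ('b, 'k) cooperad \<Rightarrow> bool" where
  "cooperad_isomorphic C D \<longleftrightarrow> (\<exists>\<phi>. cooperad_iso C D \<phi>)"

text \<open>
  \<open>cuts m i t\<close> lists the ways of cutting a tree along one edge (the root edge and the edges of the
  leaves included), as triples \<open>(c, l, u)\<close>: \<open>u\<close> is the part above the cut, \<open>l\<close> the part below it,
  and \<open>c\<close> the total degree of the vertices of \<open>l\<close> that come after those of \<open>u\<close> in preorder. The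
  labels of \<open>l\<close> are meaningful when \<open>u\<close> has exactly the leaves \<open>i, \<dots>, i + m - 1\<close>: they are
  renumbered so that the new leaf becomes \<open>i\<close>. A tree without vertices has a single edge.
\<close>

definition collapse :: "nat \<Rightarrow> nat \<Rightarrow> nat \<Rightarrow> nat" where
  "collapse m i j = (if j < i then j else j + 1 - m)"

primrec cuts :: "nat \<Rightarrow> nat \<Rightarrow> 'p tree \<Rightarrow> (int \<times> 'p tree \<times> 'p tree) list" where
  "cuts m i (Leaf j) = [(0, Leaf i, Leaf j)]"
| "cuts m i (Node e x ts) = (0, Leaf i, Node e x ts) #
    concat (map (\<lambda>k. map (\<lambda>(c, l, u).
        (c + sum_list (map tdeg (drop (k + 1) ts)),
         Node e x (map (relabel (collapse m i)) (take k ts) @ l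
                   # map (relabel (collapse m i)) (drop (k + 1) ts)), u))
      (map (cuts m i) ts ! k)) [0..<length ts])"

definition tree_decomp :: "nat \<Rightarrow> nat \<Rightarrow> 'p tree \<Rightarrow> ('p tree \<times> 'p tree \<Rightarrow>\<^sub>0 'k::field)" where
  "tree_decomp m i t =
    (\<Sum>(c, l, u) \<leftarrow> filter (\<lambda>(c, l, u). set (leaves u) = {i..<i + m}) (cuts m i t).
       pscale (ksign (c * tdeg u)) (gen (l, relabel (\<lambda>j. j - i) u)))"

definition cofree_cooperad :: "('k::field, 'p::ab_group_add) collection \<Rightarrow> ('p tree, 'k) cooperad" where
  "cofree_cooperad X =
    \<lparr>ksp = tree_space X, knull = tree_null X, kact = tree_act,
     kdecomp = (\<lambda>n m i. lin (tree_decomp m i)),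
     kcounit = (\<lambda>v. Poly_Mapping.lookup v (Leaf 0))\<rparr>"


section \<open>The quadratic dual cooperad\<close>

text \<open>
  \<open>s\<^sup>2 : \<T>(E)\<^bsub>(2)\<^esub> \<rightarrow> \<T>\<^sup>c(sE)\<^bsub>(2)\<^esub>\<close> is \<open>x \<otimes> y \<mapsto> (-1)\<^bsup>|x|\<^esup> sx \<otimes> sy\<close>, where \<open>x\<close> decorates the root.
\<close>

primrec susp_tree :: "'p tree \<Rightarrow> 'p tree" where
  "susp_tree (Leaf l) = Leaf l"
| "susp_tree (Node e x ts) = Node (e + 1) x (map susp_tree ts)"

primrec root_deg :: "'p tree \<Rightarrow> int" where
  "root_deg (Leaf l) = 0"
| "root_deg (Node e x ts) = e"

definition susp2 :: "('p tree \<Rightarrow>\<^sub>0 'k::field) \<Rightarrow> ('p tree \<Rightarrow>\<^sub>0 'k)" where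
  "susp2 = lin (\<lambda>t. pscale (ksign (root_deg t)) (gen (susp_tree t)))"

text \<open>
  For a subcooperad that is not homogeneous for the weight, the weight two part is understood as
  the set of weight two components of its elements.
\<close>

definition quadratic_dual :: "('k::field, 'p::ab_group_add) quadratic_operad \<Rightarrow> ('p tree, 'k) cooperad" where
  "quadratic_dual Q =
    (let C = cofree_cooperad (susp (qgens Q)) in
     C\<lparr>ksp := (GREATEST S. subcooperad C S \<and>
        (\<forall>n e. wt_proj 2 ` S n e \<subseteq> pm.span (susp2 ` qrels Q n (e - 2) \<union> knull C n e)))\<rparr>)"


section \<open>The bar complex and the Koszul dual in weight d\<close>

text \<open>
  The bar differential contracts one internal edge at a time: the suspended decoration of the
  child is moved next to that of its parent, and \<open>sx \<otimes> sy\<close> is replaced by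
  \<open>(-1)\<^bsup>|x|\<^esup> s(x \<circ>\<^sub>i y)\<close>. Here \<open>e\<close> and \<open>f\<close> are the degrees of \<open>sx\<close> and \<open>sy\<close>.
\<close>

primrec contract_child ::
  "('k, 'p) wg_operad \<Rightarrow> int \<Rightarrow> 'p \<Rightarrow> 'p tree list \<Rightarrow> nat \<Rightarrow> 'p tree \<Rightarrow> ('p tree \<Rightarrow>\<^sub>0 'k::field)" where
  "contract_child P e x ts i (Leaf l) = 0"
| "contract_child P e x ts i (Node f y us) =
    pscale (ksign (f * sum_list (map tdeg (take i ts)) + (e - 1)))
      (gen (Node (e + f - 1) (pcomp P (length ts) (length us) i x y)
              (take i ts @ us @ drop (i + 1) ts)))"

primrec bar_tree :: "('k, 'p) wg_operad \<Rightarrow> 'p tree \<Rightarrow> ('p tree \<Rightarrow>\<^sub>0 'k::field)" where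
  "bar_tree P (Leaf l) = 0"
| "bar_tree P (Node e x ts) =
    (\<Sum>i<length ts. contract_child P e x ts i (ts ! i)
       + pscale (ksign (e + sum_list (map tdeg (take i ts))))
           (lin (\<lambda>t. gen (Node e x (take i ts @ t # drop (i + 1) ts))) (map (bar_tree P) ts ! i)))"

definition bar_diff :: "('k, 'p) wg_operad \<Rightarrow> ('p tree \<Rightarrow>\<^sub>0 'k::field) \<Rightarrow> ('p tree \<Rightarrow>\<^sub>0 'k)" where
  "bar_diff P = lin (bar_tree P)"

definition bar_cooperad :: "('k::field, 'p::ab_group_add) wg_operad \<Rightarrow> ('p tree, 'k) cooperad" where
  "bar_cooperad P = cofree_cooperad (susp (aug_coll P))"

definition dg_subcooperad ::
  "('k::field, 'p::ab_group_add) wg_operad \<Rightarrow> (nat \<Rightarrow> int \<Rightarrow> ('p tree \<Rightarrow>\<^sub>0 'k) set) \<Rightarrow> bool" where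
  "dg_subcooperad P S \<longleftrightarrow>
    subcooperad (bar_cooperad P) S \<and> (\<forall>n e. bar_diff P ` S n e \<subseteq> S n (e - 1))"

definition koszul_dual_wt :: "('k::field, 'p::ab_group_add) wg_operad \<Rightarrow> nat \<Rightarrow> ('p tree, 'k) cooperad" where
  "koszul_dual_wt P d =
    (bar_cooperad P)\<lparr>ksp := (GREATEST S. dg_subcooperad P S \<and>
       (\<forall>n e. S n e \<subseteq>
          pm.span (tree_space (susp (wt_coll P d)) n e \<union> knull (bar_cooperad P) n e)))\<rparr>"

end

theory Submission
  imports Defs
begin

text \<open>
  The bar differential of an element of \<open>\<T>\<^sup>c(sP\<^bsub>(d)\<^esub>)\<close> is a sum of trees with exactly one vertex of weight
  \<open>2 d\<close>, all other vertices having weight \<open>d\<close>. On a dg subcooperad contained in \<open>\<T>\<^sup>c(sP\<^bsub>(d)\<^esub>)\<close> it therefore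
  vanishes, which in weight two means that the elements come from the kernel of the evaluation,
  that is, from the quadratic corelations. Conversely, let the weight two part of a subcooperad of
  \<open>\<T>\<^sup>c(sP\<^bsub>(d)\<^esub>)\<close> consist of corelations. The differential is a coderivation, and in characteristic zero
  an element of weight at least two is determined by its reduced decompositions; by induction on the
  weight the differential vanishes on the subcooperad. So both cooperads are the same greatest
  subcooperad, and the isomorphism is the identity on representatives. The projection of the
  augmentation ideal to \<open>P\<^bsub>(d)\<^esub>\<close> shows that \<open>\<T>\<^sup>c(sP\<^bsub>(d)\<^esub>)\<close> embeds into the bar construction.
\<close>

text \<open>All spaces are quotients of free vector spaces on trees, so each map must be compatible
  with the relations. These come per arity and degree, with arbitrary permutations and undecorated
  siblings; they are traded for one subspace \<open>null X\<close>, without arity or degree,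
  generated by homogeneous relators with adjacent transpositions only. A subcooperad need not be
  homogeneous in the weight, hence the induction speaks of weight components of its elements.
  Finally the two greatest subcooperads live over different collections, \<open>E\<close> (suspended
  weight \<open>d\<close> part) and \<open>D\<close> (suspended augmentation ideal): one passes up
  by adding \<open>tree_null D\<close> and down by intersecting with \<open>tree_space E\<close>.
  The way down needs the projection, because the tensors expressing a decomposition may have factors
  outside \<open>tree_space E\<close>.\<close>

lemmas lookup_simps = lookup_pscale Poly_Mapping.lookup_add Poly_Mapping.lookup_minus

lemma keys_pscale: "Poly_Mapping.keys (pscale c v) \<subseteq> Poly_Mapping.keys v"
  by (auto simp: in_keys_iff lookup_pscale)

section \<open>Linear extension and supports\<close>

lemma lin_ext_superset:
  assumes "vector_space s" "finite A" "Poly_Mapping.keys v \<subseteq> A"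
  shows "lin_ext s f v = (\<Sum>a\<in>A. s (Poly_Mapping.lookup v a) (f a))"
proof -
  interpret vector_space s by fact
  show ?thesis unfolding lin_ext_def
    by (rule sum.mono_neutral_left) (use assms in \<open>auto simp: in_keys_iff\<close>)
qed

lemma lin_ext_add:
  assumes "vector_space s"
  shows "lin_ext s f (v + w) = lin_ext s f v + lin_ext s f w"
proof -
  interpret vector_space s by fact
  let ?A = "Poly_Mapping.keys v \<union> Poly_Mapping.keys w"
  have "Poly_Mapping.keys (v + w) \<subseteq> ?A" by (rule Poly_Mapping.keys_add)
  then show ?thesis
    by (simp add: lin_ext_superset[OF assms, of ?A] lookup_simps scale_left_distrib sum.distrib)
qed

lemma lin_ext_pscale:
  assumes "vector_space s"
  shows "lin_ext s f (pscale c v) = s c (lin_ext s f v)"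
proof -
  interpret vector_space s by fact
  show ?thesis
    using keys_pscale[of c v]
    by (simp add: lin_ext_superset[OF assms, of "Poly_Mapping.keys v"] lookup_simps scale_sum_right)
qed

lemma lin_ext_gen:
  assumes "vector_space s"
  shows "lin_ext s f (gen a) = f a"
proof -
  interpret vector_space s by fact
  show ?thesis by (simp add: lin_ext_def)
qed

lemma lin_ext_zero [simp]: "lin_ext s f 0 = 0"
  by (simp add: lin_ext_def)

lemma lin_ext_cong:
  "(\<And>a. a \<in> Poly_Mapping.keys v \<Longrightarrow> f a = g a) \<Longrightarrow> lin_ext s f v = lin_ext s g v"
  by (simp add: lin_ext_def)

lemma lin_ext_diff:
  assumes "vector_space s"
  shows "lin_ext s f (v - w) = lin_ext s f v - lin_ext s f w"
  using lin_ext_add[OF assms, of f "v - w" w] by simp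

lemma lin_ext_sum:
  assumes "vector_space s"
  shows "lin_ext s f (\<Sum>i\<in>I. v i) = (\<Sum>i\<in>I. lin_ext s f (v i))"
  by (induct I rule: infinite_finite_induct) (auto simp: lin_ext_add[OF assms])

lemmas lin_add = lin_ext_add[OF pm.vector_space_axioms]
  and lin_diff = lin_ext_diff[OF pm.vector_space_axioms]
  and lin_pscale = lin_ext_pscale[OF pm.vector_space_axioms]
  and lin_gen = lin_ext_gen[OF pm.vector_space_axioms]
  and lin_sum = lin_ext_sum[OF pm.vector_space_axioms]

lemmas lin_simps = lin_add lin_diff lin_pscale lin_gen lin_sum

lemma gen_expansion: "v = (\<Sum>a\<in>Poly_Mapping.keys v. pscale (Poly_Mapping.lookup v a) (gen a))"
proof (rule poly_mapping_eqI)
  fix b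
  show "Poly_Mapping.lookup v b =
      Poly_Mapping.lookup (\<Sum>a\<in>Poly_Mapping.keys v. pscale (Poly_Mapping.lookup v a) (gen a)) b"
    by (auto simp: Poly_Mapping.lookup_sum lookup_pscale lookup_single when_def in_keys_iff
        if_distrib cong: if_cong)
qed

lemma lin_gen_id [simp]: "lin gen v = v"
  using gen_expansion[of v] by (simp add: lin_ext_def)

lemma lin_fun_zero [simp]: "lin (\<lambda>a. 0) v = 0"
  by (simp add: lin_ext_def)

lemma lin_fun_add: "lin (\<lambda>a. f a + g a) v = lin f v + lin g v"
  by (simp add: lin_ext_def pm.scale_right_distrib sum.distrib)

lemma lin_fun_diff: "lin (\<lambda>a. f a - g a) v = lin f v - lin g v"
  by (simp add: lin_ext_def pm.scale_right_diff_distrib sum_subtractf)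

lemma lin_fun_pscale: "lin (\<lambda>a. pscale c (f a)) v = pscale c (lin f v)"
  by (simp add: lin_ext_def pm.scale_sum_right mult.commute)

lemma lin_fun_sum: "lin (\<lambda>a. \<Sum>i\<in>I. f i a) v = (\<Sum>i\<in>I. lin (f i) v)"
  by (induct I rule: infinite_finite_induct) (auto simp: lin_fun_add)

lemma lin_lin: "lin f (lin g v) = lin (\<lambda>a. lin f (g a)) v"
  by (subst (2) lin_ext_def, subst lin_ext_def) (simp add: lin_simps)

lemma lin_swap: "lin (\<lambda>a. lin (\<lambda>b. h a b) y) x = lin (\<lambda>b. lin (\<lambda>a. h a b) x) y"
proof -
  have "lin (\<lambda>a. lin (\<lambda>b. h a b) y) x
      = (\<Sum>a\<in>Poly_Mapping.keys x. \<Sum>b\<in>Poly_Mapping.keys y.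
          pscale (Poly_Mapping.lookup x a * Poly_Mapping.lookup y b) (h a b))"
    by (simp add: lin_ext_def pm.scale_sum_right)
  also have "\<dots> = (\<Sum>b\<in>Poly_Mapping.keys y. \<Sum>a\<in>Poly_Mapping.keys x.
          pscale (Poly_Mapping.lookup x a * Poly_Mapping.lookup y b) (h a b))"
    by (rule sum.swap)
  also have "\<dots> = lin (\<lambda>b. lin (\<lambda>a. h a b) x) y"
    by (simp add: lin_ext_def pm.scale_sum_right mult.commute)
  finally show ?thesis .
qed

lemma lin_in_subspace:
  "pm.subspace W \<Longrightarrow> (\<And>a. a \<in> Poly_Mapping.keys v \<Longrightarrow> f a \<in> W) \<Longrightarrow> lin f v \<in> W"
  unfolding lin_ext_def by (intro pm.subspace_sum pm.subspace_scale)

lemma lin_in_span: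
  "(\<And>a. a \<in> Poly_Mapping.keys v \<Longrightarrow> f a \<in> pm.span S) \<Longrightarrow> lin f v \<in> pm.span S"
  by (rule lin_in_subspace) auto

lemma lin_span:
  assumes "v \<in> pm.span S" "pm.subspace W" "\<And>r. r \<in> S \<Longrightarrow> lin f r \<in> W"
  shows "lin f v \<in> W"
  using assms(1)
proof (induct rule: pm.span_induct_alt)
  case base
  then show ?case using assms(2) by (simp add: pm.subspace_0)
next
  case (step c x y)
  then show ?case using assms by (simp add: lin_simps pm.subspace_add pm.subspace_scale)
qed

lemma keys_lin: "Poly_Mapping.keys (lin f v) \<subseteq> (\<Union>a\<in>Poly_Mapping.keys v. Poly_Mapping.keys (f a))"
proof -
  have "Poly_Mapping.keys (lin f v) \<subseteq>
      (\<Union>a\<in>Poly_Mapping.keys v. Poly_Mapping.keys (pscale (Poly_Mapping.lookup v a) (f a)))"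
    unfolding lin_ext_def by (rule Poly_Mapping.keys_sum)
  also have "\<dots> \<subseteq> (\<Union>a\<in>Poly_Mapping.keys v. Poly_Mapping.keys (f a))"
    by (intro UN_mono subset_refl keys_pscale)
  finally show ?thesis .
qed

text \<open>Basis vectors are independent, so lying in the span of some of them is a condition on
  the support. All bookkeeping of arity, degree and weight is done with supports.\<close>

lemma span_gen_iff: "v \<in> pm.span (gen ` A) \<longleftrightarrow> Poly_Mapping.keys v \<subseteq> A"
proof
  assume "v \<in> pm.span (gen ` A)"
  then show "Poly_Mapping.keys v \<subseteq> A"
  proof (induct rule: pm.span_induct_alt)
    case base
    then show ?case by simp
  next
    case (step c x y)
    from step(1) have "Poly_Mapping.keys x \<subseteq> A" by auto
    then show ?case
      using step keys_pscale[of c x] Poly_Mapping.keys_add[of "pscale c x" y] by blast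
  qed
next
  assume "Poly_Mapping.keys v \<subseteq> A"
  then have "lin gen v \<in> pm.span (gen ` A)"
    by (intro lin_in_span pm.span_base) auto
  then show "v \<in> pm.span (gen ` A)" by simp
qed

lemma tree_space_iff: "v \<in> tree_space X n e \<longleftrightarrow> Poly_Mapping.keys v \<subseteq> trees X n e"
  unfolding tree_space_def by (rule span_gen_iff)

lemma ksign_add: "ksign (a + b) = ksign a * ksign b"
  by (auto simp: ksign_def)

lemma ksign_square [simp]: "ksign a * ksign a = 1"
  by (auto simp: ksign_def)

lemma tensor_gen: "gen a \<otimes>\<^sub>p gen b = gen (a, b)"
  by (simp add: tensor_def lin_simps)

lemma lin_tensor: "lin h (x \<otimes>\<^sub>p y) = lin (\<lambda>a. lin (\<lambda>b. h (a, b)) y) x"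
  by (simp add: tensor_def lin_lin lin_simps)

lemma tensor_lin_left: "lin f x \<otimes>\<^sub>p y = lin (\<lambda>a. f a \<otimes>\<^sub>p y) x"
  by (simp add: tensor_def lin_lin)

lemma tensor_lin_right: "x \<otimes>\<^sub>p lin f y = lin (\<lambda>b. x \<otimes>\<^sub>p f b) y"
  unfolding tensor_def by (subst lin_swap) (simp add: lin_lin)

lemma tensor_left: "x \<otimes>\<^sub>p y = lin (\<lambda>a. gen a \<otimes>\<^sub>p y) x"
  using tensor_lin_left[of gen x y] by simp

lemma tensor_right: "x \<otimes>\<^sub>p y = lin (\<lambda>b. x \<otimes>\<^sub>p gen b) y"
  using tensor_lin_right[of x gen y] by simp

lemma tensor_simps:
  "(x + x') \<otimes>\<^sub>p y = x \<otimes>\<^sub>p y + x' \<otimes>\<^sub>p y" "(x - x') \<otimes>\<^sub>p y = x \<otimes>\<^sub>p y - x' \<otimes>\<^sub>p y"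
  "pscale c x \<otimes>\<^sub>p y = pscale c (x \<otimes>\<^sub>p y)" "0 \<otimes>\<^sub>p y = 0"
  "x \<otimes>\<^sub>p (y + y') = x \<otimes>\<^sub>p y + x \<otimes>\<^sub>p y'" "x \<otimes>\<^sub>p (y - y') = x \<otimes>\<^sub>p y - x \<otimes>\<^sub>p y'"
  "x \<otimes>\<^sub>p pscale c y = pscale c (x \<otimes>\<^sub>p y)" "x \<otimes>\<^sub>p 0 = 0"
  by (simp_all add: tensor_def lin_simps lin_fun_add lin_fun_diff lin_fun_pscale)

lemma subspace_vimage_lin:
  "pm.subspace W \<Longrightarrow> pm.subspace {v. lin f v \<in> W}"
  by (auto simp: pm.subspace_def lin_simps)

lemma subspace_vimage_tensor:
  "pm.subspace W \<Longrightarrow> pm.subspace {x. x \<otimes>\<^sub>p y \<in> W}"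
  "pm.subspace W \<Longrightarrow> pm.subspace {y. x \<otimes>\<^sub>p y \<in> W}"
  by (auto simp: pm.subspace_def tensor_simps)

section \<open>Sums over the positions of a list\<close>

text \<open>A position is presented by what precedes and what follows it, \<open>a @ t # b\<close>.
  Recursion on the list, in place of an index, turns concatenations and double sums into structural
  inductions and keeps the siblings visible to the sign rules.\<close>

primrec ssum :: "'t list \<Rightarrow> ('t list \<Rightarrow> 't \<Rightarrow> 't list \<Rightarrow> 'v::comm_monoid_add) \<Rightarrow> 'v" where
  "ssum [] = (\<lambda>G. 0)"
| "ssum (t # ts) = (\<lambda>G. G [] t ts + ssum ts (\<lambda>a. G (t # a)))"

lemma ssum_nth: "(\<Sum>i<length ts. G (take i ts) (ts ! i) (drop (i + 1) ts)) = ssum ts G"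
proof (induct ts arbitrary: G)
  case (Cons u us)
  show ?case
    using Cons[of "\<lambda>a. G (u # a)"] by (simp add: sum.lessThan_Suc_shift del: sum.lessThan_Suc)
qed simp

lemma ssum_append:
  "ssum (as @ bs) G = ssum as (\<lambda>a t b. G a t (b @ bs)) + ssum bs (\<lambda>a t b. G (as @ a) t b)"
  by (induct as arbitrary: G) (auto simp: add.assoc)

lemma ssum_cong:
  "ts = ts' \<Longrightarrow> (\<And>a t b. ts' = a @ t # b \<Longrightarrow> G a t b = H a t b) \<Longrightarrow> ssum ts G = ssum ts' H"
proof (induct ts arbitrary: G H ts')
  case Nil
  then show ?case by auto
next
  case (Cons u us)
  have "ssum us (\<lambda>a. G (u # a)) = ssum us (\<lambda>a. H (u # a))"
    by (rule Cons(1)) (use Cons(2,3) in auto)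
  moreover have "G [] u us = H [] u us" using Cons(2,3) by auto
  ultimately show ?case using Cons(2) by auto
qed

lemma ssum_zero [simp]: "ssum ts (\<lambda>a t b. 0) = 0"
  by (induct ts) auto

lemma ssum_add: "ssum ts (\<lambda>a t b. G a t b + H a t b) = ssum ts G + ssum ts H"
  by (induct ts arbitrary: G H) (auto simp: algebra_simps)

lemma ssum_map: "ssum (map f ts) G = ssum ts (\<lambda>a t b. G (map f a) (f t) (map f b))"
  by (induct ts arbitrary: G) auto

text \<open>Both sides run over the pairs of distinct positions, once indexed first by the later and
  once first by the earlier one. This is the exchange of summation behind the coderivation
  property.\<close>

lemma ssum_swap:
  "ssum ts (\<lambda>a t b. ssum a (\<lambda>a1 t1 b1. G a1 t1 b1 t b)) =
   ssum ts (\<lambda>a1 t1 b. ssum b (\<lambda>b1 t b2. G a1 t1 b1 t b2))"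
  by (induct ts arbitrary: G) (auto simp: ssum_add)

lemma ssum_hom:
  assumes "h 0 = 0" "\<And>x y. h (x + y) = h x + h y"
  shows "h (ssum ts G) = ssum ts (\<lambda>a t b. h (G a t b))"
  by (induct ts arbitrary: G) (auto simp: assms)

lemma lin_ssum: "lin f (ssum ts G) = ssum ts (\<lambda>a t b. lin f (G a t b))"
  by (rule ssum_hom) (auto simp: lin_add)

lemma pscale_ssum: "pscale c (ssum ts G) = ssum ts (\<lambda>a t b. pscale c (G a t b))"
  by (rule ssum_hom) (auto simp: pm.scale_right_distrib)

lemma lin_fun_ssum: "lin (\<lambda>x. ssum ts (\<lambda>a t b. G a t b x)) v = ssum ts (\<lambda>a t b. lin (G a t b) v)"
  by (induct ts arbitrary: G) (auto simp: lin_fun_add)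

lemma ssum_in_subspace:
  "pm.subspace W \<Longrightarrow> (\<And>a t b. ts = a @ t # b \<Longrightarrow> G a t b \<in> W) \<Longrightarrow> ssum ts G \<in> W"
proof (induct ts arbitrary: G)
  case Nil
  then show ?case by (simp add: pm.subspace_0)
next
  case (Cons u us)
  have "ssum us (\<lambda>a. G (u # a)) \<in> W"
    by (rule Cons(1)) (use Cons(2,3) in auto)
  then show ?case using Cons(2,3) by (auto intro: pm.subspace_add)
qed

lemma keys_ssum: "Poly_Mapping.keys (ssum ts G) \<subseteq> {k. \<exists>a t b. ts = a @ t # b \<and> k \<in> Poly_Mapping.keys (G a t b)}"
proof (induct ts arbitrary: G)
  case Nil
  then show ?case by simp
next
  case (Cons u us)
  show ?case
  proof
    fix k assume "k \<in> Poly_Mapping.keys (ssum (u # us) G)"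
    then consider "k \<in> Poly_Mapping.keys (G [] u us)" | "k \<in> Poly_Mapping.keys (ssum us (\<lambda>a. G (u # a)))"
      using Poly_Mapping.keys_add[of "G [] u us" "ssum us (\<lambda>a. G (u # a))"] by auto
    then show "k \<in> {k. \<exists>a t b. u # us = a @ t # b \<and> k \<in> Poly_Mapping.keys (G a t b)}"
    proof cases
      case 1
      then show ?thesis by blast
    next
      case 2
      then obtain a t b where "us = a @ t # b" "k \<in> Poly_Mapping.keys (G (u # a) t b)"
        using Cons[of "\<lambda>a. G (u # a)"] by blast
      then show ?thesis by (intro CollectI exI[of _ "u # a"] exI[of _ t] exI[of _ b]) simp
    qed
  qed
qed

section \<open>Relators between decorated trees\<close>

abbreviation tdegs :: "'p tree list \<Rightarrow> int" where
  "tdegs ts \<equiv> sum_list (map tdeg ts)"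

definition node_ctx :: "int \<Rightarrow> 'p \<Rightarrow> 'p tree list \<Rightarrow> 'p tree list \<Rightarrow> ('p tree \<Rightarrow>\<^sub>0 'k::field) \<Rightarrow> ('p tree \<Rightarrow>\<^sub>0 'k)" where
  "node_ctx e x a b = lin (\<lambda>t. gen (Node e x (a @ t # b)))"

lemma node_ctx_gen: "node_ctx e x a b (gen t) = gen (Node e x (a @ t # b))"
  by (simp add: node_ctx_def lin_simps)

lemma node_ctx_simps:
  "node_ctx e x a b (v + w) = node_ctx e x a b v + node_ctx e x a b w"
  "node_ctx e x a b (v - w) = node_ctx e x a b v - node_ctx e x a b w"
  "node_ctx e x a b (pscale c v) = pscale c (node_ctx e x a b v)"
  "node_ctx e x a b 0 = 0"
  by (simp_all add: node_ctx_def lin_simps)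

lemma lin_node_ctx: "lin f (node_ctx e x a b v) = lin (\<lambda>t. f (Node e x (a @ t # b))) v"
  by (simp add: node_ctx_def lin_lin lin_simps)

lemma node_ctx_lin: "node_ctx e x a b (lin f v) = lin (\<lambda>t. node_ctx e x a b (f t)) v"
  by (simp add: node_ctx_def lin_lin lin_simps)

text \<open>Plugging into a fixed context is injective on trees, so no terms cancel and the support
  is the exact image.\<close>

lemma keys_node_ctx: "Poly_Mapping.keys (node_ctx e x a b v) = (\<lambda>t. Node e x (a @ t # b)) ` Poly_Mapping.keys v"
proof -
  let ?f = "\<lambda>t. Node e x (a @ t # b)"
  have "Poly_Mapping.lookup (node_ctx e x a b v) (?f t) = Poly_Mapping.lookup v t" for t
    unfolding node_ctx_def lin_ext_def
    by (auto simp: Poly_Mapping.lookup_sum lookup_pscale lookup_single when_def in_keys_iff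
        if_distrib cong: if_cong)
  then have "?f ` Poly_Mapping.keys v \<subseteq> Poly_Mapping.keys (node_ctx e x a b v)"
    by (auto simp: in_keys_iff)
  then show ?thesis
    using keys_lin[of "\<lambda>t. gen (?f t)" v] by (auto simp: node_ctx_def)
qed

declare decorated.simps(2) [simp del]

lemma decorated_Node [simp]:
  "decorated X (Node e x ts) \<longleftrightarrow> x \<in> csp X (length ts) e \<and> (\<forall>t\<in>set ts. decorated X t)"
  by (auto simp: decorated.simps(2) list_all_iff)

abbreviation adj :: "nat \<Rightarrow> nat \<Rightarrow> nat" where
  "adj k \<equiv> transpose k (Suc k)"

text \<open>Scaling and addition are merged into one rule, and the symmetric group is replaced by
  its generators, so that an inductive argument about relators has to treat three simple cases.\<close>

inductive_set drel :: "('k::field, 'p::ab_group_add) collection \<Rightarrow> ('p tree \<Rightarrow>\<^sub>0 'k) set"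
  for X :: "('k, 'p) collection" where
  linear: "\<lbrakk>x \<in> csp X (length ts) e; y \<in> csp X (length ts) e; \<forall>t\<in>set ts. decorated X t\<rbrakk> \<Longrightarrow>
    gen (Node e (cscale X c x + cscale X c' y) ts) - pscale c (gen (Node e x ts))
      - pscale c' (gen (Node e y ts)) \<in> drel X"
| swap: "\<lbrakk>x \<in> csp X (length a + 2 + length b) e; \<forall>t\<in>set (a @ t # t' # b). decorated X t\<rbrakk> \<Longrightarrow>
    gen (Node e (cact X (length a + 2 + length b) (adj (length a)) x) (a @ t # t' # b))
      - pscale (ksign (tdeg t * tdeg t')) (gen (Node e x (a @ t' # t # b))) \<in> drel X"
| ctx: "\<lbrakk>r \<in> drel X; x \<in> csp X (length a + 1 + length b) e; \<forall>t\<in>set (a @ b). decorated X t\<rbrakk> \<Longrightarrow>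
    node_ctx e x a b r \<in> drel X"

abbreviation null :: "('k::field, 'p::ab_group_add) collection \<Rightarrow> ('p tree \<Rightarrow>\<^sub>0 'k) set" where
  "null X \<equiv> pm.span (drel X)"

lemma null_node_ctx:
  assumes "v \<in> null X" "x \<in> csp X (length a + 1 + length b) e" "\<forall>t\<in>set (a @ b). decorated X t"
  shows "node_ctx e x a b v \<in> null X"
  unfolding node_ctx_def
  by (rule lin_span[OF assms(1)])
    (auto simp: node_ctx_def[symmetric] intro!: pm.span_base drel.ctx assms(2,3))

text \<open>The instances are the suspended augmentation ideal and the suspended weight
  \<open>d\<close> part; the relators are analysed once for both.\<close>

locale coll =
  fixes X :: "('k::field, 'p::ab_group_add) collection"
  assumes vsX: "vector_space (cscale X)"
    and csp_subspace: "module.subspace (cscale X) (csp X n e)"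
    and cact_csp: "\<sigma> permutes {..<n} \<Longrightarrow> x \<in> csp X n e \<Longrightarrow> cact X n \<sigma> x \<in> csp X n e"
    and cact_id: "x \<in> csp X n e \<Longrightarrow> cact X n id x = x"
    and cact_comp: "\<lbrakk>\<sigma> permutes {..<n}; \<tau> permutes {..<n}; x \<in> csp X n e\<rbrakk>
          \<Longrightarrow> cact X n (\<sigma> \<circ> \<tau>) x = cact X n \<tau> (cact X n \<sigma> x)"
begin

sublocale vector_space "cscale X" by (rule vsX)

lemma csp_zero: "0 \<in> csp X n e"
  using csp_subspace subspace_0 by blast

lemma csp_add: "x \<in> csp X n e \<Longrightarrow> y \<in> csp X n e \<Longrightarrow> x + y \<in> csp X n e"
  using csp_subspace subspace_add by blast

lemma csp_scale: "x \<in> csp X n e \<Longrightarrow> cscale X c x \<in> csp X n e"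
  using csp_subspace subspace_scale by blast

end

section \<open>Inversions and Koszul signs\<close>

definition invs :: "nat \<Rightarrow> (nat \<Rightarrow> nat) \<Rightarrow> (nat \<times> nat) set" where
  "invs n \<sigma> = {(i, j). i < j \<and> j < n \<and> \<sigma> i > \<sigma> j}"

lemma perm_sign_invs: "perm_sign n \<sigma> g = (\<Prod>(i, j)\<in>invs n \<sigma>. ksign (g i * g j))"
  by (simp add: perm_sign_def invs_def)

lemma finite_invs: "finite (invs n \<sigma>)"
  by (rule finite_subset[of _ "{..<n} \<times> {..<n}"]) (auto simp: invs_def)

text \<open>At a descent, composing with the adjacent transposition destroys precisely the inversion
  \<open>(k, Suc k)\<close>; every other inversion is carried along with its entries
  renamed.\<close>

lemma invs_descent:
  assumes "Suc k < n" "\<sigma> k > \<sigma> (Suc k)"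
  defines "h \<equiv> \<lambda>(i, j). (adj k i, adj k j)"
  shows "invs n \<sigma> = insert (k, Suc k) (h ` invs n (\<sigma> \<circ> adj k))"
    "(k, Suc k) \<notin> h ` invs n (\<sigma> \<circ> adj k)" "inj_on h A"
proof -
  have *: "(i, j) \<in> invs n (\<sigma> \<circ> adj k) \<Longrightarrow> adj k i < adj k j \<and> adj k j < n \<and> \<sigma> (adj k i) > \<sigma> (adj k j)"
    for i j
    using assms(1,2) by (auto simp: invs_def transpose_def split: if_splits)
  have **: "(i, j) \<in> invs n \<sigma> \<Longrightarrow> (i, j) \<noteq> (k, Suc k) \<Longrightarrow> (adj k i, adj k j) \<in> invs n (\<sigma> \<circ> adj k)" for i j
    using assms(1,2) by (auto simp: invs_def transpose_def split: if_splits)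
  show "invs n \<sigma> = insert (k, Suc k) (h ` invs n (\<sigma> \<circ> adj k))"
  proof (intro set_eqI iffI)
    fix p assume p: "p \<in> invs n \<sigma>"
    obtain i j where ij: "p = (i, j)" by force
    have "p = h (adj k i, adj k j)" by (simp add: h_def ij)
    then show "p \<in> insert (k, Suc k) (h ` invs n (\<sigma> \<circ> adj k))"
      using **[of i j] p ij by auto
  next
    fix p assume "p \<in> insert (k, Suc k) (h ` invs n (\<sigma> \<circ> adj k))"
    then consider "p = (k, Suc k)" | i j where "(i, j) \<in> invs n (\<sigma> \<circ> adj k)" "p = (adj k i, adj k j)"
      by (auto simp: h_def)
    then show "p \<in> invs n \<sigma>"
    proof cases
      case 1
      then show ?thesis using assms(1,2) by (simp add: invs_def)
    next
      case 2
      then show ?thesis using *[OF 2(1)] by (simp add: invs_def)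
    qed
  qed
  show "(k, Suc k) \<notin> h ` invs n (\<sigma> \<circ> adj k)"
    using assms(1,2) by (auto simp: h_def invs_def transpose_def split: if_splits)
  show "inj_on h A"
    by (auto simp: inj_on_def h_def transpose_eq_iff)
qed

text \<open>The degrees are permuted along with the transposition, so the only factor split off is
  that of the destroyed inversion.\<close>

lemma perm_sign_descent:
  assumes "Suc k < n" "\<sigma> k > \<sigma> (Suc k)"
  shows "(perm_sign n \<sigma> g :: 'k::field) = ksign (g k * g (Suc k)) * perm_sign n (\<sigma> \<circ> adj k) (g \<circ> adj k)"
proof -
  note d = invs_descent[OF assms]
  let ?h = "\<lambda>(i, j). (adj k i, adj k j)"
  have "(perm_sign n \<sigma> g :: 'k) = ksign (g k * g (Suc k)) * (\<Prod>(i, j)\<in>?h ` invs n (\<sigma> \<circ> adj k). ksign (g i * g j))"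
    unfolding perm_sign_invs d(1)
    by (subst prod.insert) (use d(2) finite_invs in auto)
  also have "(\<Prod>(i, j)\<in>?h ` invs n (\<sigma> \<circ> adj k). ksign (g i * g j)) = (perm_sign n (\<sigma> \<circ> adj k) (g \<circ> adj k) :: 'k)"
    unfolding perm_sign_invs
    by (subst prod.reindex) (use d(3) in \<open>auto simp: comp_def case_prod_beta\<close>)
  finally show ?thesis .
qed

lemma card_invs_descent:
  assumes "Suc k < n" "\<sigma> k > \<sigma> (Suc k)"
  shows "card (invs n (\<sigma> \<circ> adj k)) < card (invs n \<sigma>)"
  unfolding invs_descent(1)[OF assms]
  by (subst card_insert_disjoint)
    (use invs_descent(2)[OF assms] finite_invs card_image[OF invs_descent(3)[OF assms]] in auto)

lemma perm_sign_id: "perm_sign n id g = 1"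
  by (auto simp: perm_sign_invs invs_def intro!: prod.neutral)

lemma perm_sign_adj:
  assumes "Suc k < n"
  shows "perm_sign n (adj k) g = ksign (g k * g (Suc k))"
  using perm_sign_descent[OF assms, of "adj k" g] by (simp add: perm_sign_id)

text \<open>Injectivity makes the ascents strict, which forces \<open>i \<le> \<sigma> i\<close>
  everywhere. This is the terminal case of the sorting below.\<close>

lemma no_descent_id:
  assumes p: "\<sigma> permutes {..<n}" and asc: "\<And>k. Suc k < n \<Longrightarrow> \<sigma> k \<le> \<sigma> (Suc k)"
  shows "\<sigma> = id"
proof (rule permutes_natset_ge[OF p], rule ballI)
  fix i assume "i \<in> {..<n}"
  then have "i < n" by simp
  then show "i \<le> \<sigma> i"
  proof (induct i)
    case (Suc i)
    have "\<sigma> i \<noteq> \<sigma> (Suc i)" using permutes_inj[OF p] by (metis injD n_not_Suc_n)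
    then show ?case using Suc asc[of i] by auto
  qed simp
qed

lemma nth_append_two:
  "(a @ t # t' # b) ! i = (if i < length a then a ! i else if i = length a then t
     else if i = Suc (length a) then t' else b ! (i - length a - 2))"
  by (auto simp: nth_append nth_Cons' numeral_2_eq_2)

lemma nth_adj_append_two:
  "(a @ t # t' # b) ! adj (length a) i = (a @ t' # t # b) ! i"
  unfolding nth_append_two by (auto simp: transpose_def)

lemma permute_list_adj:
  "permute_list (adj (length a)) (a @ t # t' # b) = a @ t' # t # b"
  by (rule nth_equalityI) (auto simp: permute_list_def nth_adj_append_two simp del: upt_Suc)

lemma adj_permutes: "Suc k < n \<Longrightarrow> adj k permutes {..<n}"
  by (rule permutes_swap_id) auto

lemma split_adj: "Suc k < length ts \<Longrightarrow> \<exists>a t t' b. ts = a @ t # t' # b \<and> length a = k"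
  by (rule exI[of _ "take k ts"], rule exI[of _ "ts ! k"], rule exI[of _ "ts ! Suc k"],
      rule exI[of _ "drop (Suc (Suc k)) ts"])
    (simp add: Cons_nth_drop_Suc Suc_lessD)

text \<open>Bubble sort: each descent is removed by one \<open>swap\<close> relator, and the Koszul
  signs of the single exchanges multiply to the sign of the whole permutation. Thus generators of
  the symmetric group suffice in \<open>drel\<close>.\<close>

lemma (in coll) null_equivariance:
  assumes "\<sigma> permutes {..<length ts}" "x \<in> csp X (length ts) e" "\<forall>t\<in>set ts. decorated X t"
  shows "gen (Node e (cact X (length ts) \<sigma> x) ts)
      - pscale (perm_sign (length ts) \<sigma> (\<lambda>i. tdeg (ts ! i)))
          (gen (Node e x (permute_list (inv \<sigma>) ts))) \<in> null X"
  using assms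
proof (induct "card (invs (length ts) \<sigma>)" arbitrary: \<sigma> ts rule: less_induct)
  case less
  let ?n = "length ts"
  show ?case
  proof (cases "\<exists>k. Suc k < ?n \<and> \<sigma> k > \<sigma> (Suc k)")
    case False
    then have "\<sigma> = id" using no_descent_id[OF less(2)] by (meson not_less)
    then show ?thesis by (simp add: perm_sign_id cact_id[OF less(3)] permute_list_def map_nth pm.span_zero)
  next
    case True
    then obtain k where k: "Suc k < ?n" "\<sigma> k > \<sigma> (Suc k)" by auto
    obtain a t t' b where ts: "ts = a @ t # t' # b" and la: "length a = k"
      using split_adj[OF k(1)] by blast
    \<comment> \<open>For the right action, acting by \<open>\<sigma>\<close> is acting by
      \<open>?\<tau>\<close> and then by the transposition; \<open>?us\<close> is the list of
      children after that exchange, and \<open>?\<tau>\<close> has fewer inversions.\<close>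
    let ?\<tau> = "\<sigma> \<circ> adj k" and ?us = "a @ t' # t # b"
    have len: "length ?us = ?n" "?n = length a + 2 + length b" by (auto simp: ts)
    have p: "?\<tau> permutes {..<?n}" using less(2) adj_permutes[OF k(1)] by (simp add: permutes_compose)
    have act: "cact X ?n \<sigma> x = cact X ?n (adj k) (cact X ?n ?\<tau> x)"
      using cact_comp[OF p adj_permutes[OF k(1)] less(3)] by (simp add: comp_assoc)
    have us: "?us = permute_list (adj k) ts" by (simp add: ts permute_list_adj la[symmetric])
    have deg: "(\<lambda>i. tdeg (?us ! i)) = (\<lambda>i. tdeg (ts ! i)) \<circ> adj k"
      unfolding ts la[symmetric] by (rule ext) (simp add: nth_adj_append_two)
    have "permute_list (inv ?\<tau>) ?us = permute_list (adj k \<circ> inv ?\<tau>) ts"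
      unfolding us by (rule permute_list_compose[symmetric]) (use p in \<open>auto intro: permutes_inv\<close>)
    also have "adj k \<circ> inv ?\<tau> = inv \<sigma>"
      using permutes_bij[OF less(2)] by (subst o_inv_distrib) (auto simp: comp_assoc[symmetric])
    finally have perm: "permute_list (inv ?\<tau>) ?us = permute_list (inv \<sigma>) ts" .
    have 1: "gen (Node e (cact X ?n ?\<tau> x) ?us)
      - pscale (perm_sign ?n ?\<tau> (\<lambda>i. tdeg (?us ! i))) (gen (Node e x (permute_list (inv \<sigma>) ts))) \<in> null X"
      using less(1)[of ?us ?\<tau>] p less(3,4) len(1) perm card_invs_descent[OF k] by (auto simp: ts)
    have "gen (Node e (cact X (length a + 2 + length b) (adj (length a)) (cact X ?n ?\<tau> x)) (a @ t # t' # b))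
      - pscale (ksign (tdeg t * tdeg t')) (gen (Node e (cact X ?n ?\<tau> x) ?us)) \<in> drel X"
      by (rule drel.swap) (use cact_csp[OF p less(3)] less(4) len in \<open>auto simp: ts\<close>)
    then have 2: "gen (Node e (cact X ?n \<sigma> x) ts)
      - pscale (ksign (tdeg t * tdeg t')) (gen (Node e (cact X ?n ?\<tau> x) ?us)) \<in> null X"
      using act la len(2) ts by (simp add: pm.span_base)
    have s: "perm_sign ?n \<sigma> (\<lambda>i. tdeg (ts ! i)) = ksign (tdeg t * tdeg t') * (perm_sign ?n ?\<tau> (\<lambda>i. tdeg (?us ! i)) :: 'k)"
    proof -
      have "ts ! k = t" "ts ! Suc k = t'" by (auto simp: ts nth_append la[symmetric])
      then show ?thesis unfolding deg by (subst perm_sign_descent[where \<sigma>=\<sigma>, OF k]) simp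
    qed
    \<comment> \<open>The intermediate tree with the children \<open>?us\<close> cancels.\<close>
    from pm.span_add[OF 2 pm.span_scale[OF 1, of "ksign (tdeg t * tdeg t')"]]
    show ?thesis by (simp add: s pm.scale_right_diff_distrib)
  qed
qed

section \<open>Homogeneity of the relations\<close>

definition ttype :: "'p tree \<Rightarrow> nat multiset \<times> int \<times> nat" where
  "ttype t = (mset (leaves t), tdeg t, twt t)"

lemma ttype_Node_eq:
  "ttype t = ttype t' \<Longrightarrow> ttype (Node e x (a @ t # b)) = ttype (Node e y (a @ t' # b))"
  by (auto simp: ttype_def)

text \<open>The multiset of leaf labels, the degree and the number of vertices survive every
  relator. That a bare leaf occurs in no relator lets later arguments assume a root vertex.\<close>

lemma drel_keys:
  assumes "coll X" "r \<in> drel X"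
  shows "\<exists>\<tau>. \<forall>t\<in>Poly_Mapping.keys r. decorated X t \<and> twt t > 0 \<and> ttype t = \<tau>"
  using assms(2)
proof induct
  case (linear x ts e y c c')
  interpret coll X by fact
  have "Poly_Mapping.keys (gen (Node e (cscale X c x + cscale X c' y) ts) - pscale c (gen (Node e x ts))
      - pscale c' (gen (Node e y ts))) \<subseteq> {Node e (cscale X c x + cscale X c' y) ts, Node e x ts, Node e y ts}"
    by (auto simp: in_keys_iff lookup_simps lookup_single when_def split: if_splits)
  then show ?case using linear
    by (intro exI[of _ "ttype (Node e x ts)"]) (auto simp: ttype_def intro!: csp_add csp_scale)
next
  case (swap x a b e t t')
  interpret coll X by fact
  have "Poly_Mapping.keys (gen (Node e (cact X (length a + 2 + length b) (adj (length a)) x) (a @ t # t' # b))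
      - pscale (ksign (tdeg t * tdeg t')) (gen (Node e x (a @ t' # t # b)))) \<subseteq>
     {Node e (cact X (length a + 2 + length b) (adj (length a)) x) (a @ t # t' # b), Node e x (a @ t' # t # b)}"
    by (auto simp: in_keys_iff lookup_simps lookup_single when_def split: if_splits)
  then show ?case using swap cact_csp[OF adj_permutes swap(1), of "length a"]
    by (intro exI[of _ "ttype (Node e x (a @ t' # t # b))"]) (auto simp: ttype_def)
next
  case (ctx r x a b e)
  then obtain \<tau> where \<tau>: "\<forall>t\<in>Poly_Mapping.keys r. decorated X t \<and> twt t > 0 \<and> ttype t = \<tau>" by blast
  show ?case
  proof (cases "Poly_Mapping.keys r = {}")
    case True
    then show ?thesis by (simp add: keys_node_ctx)
  next
    case False
    then obtain t0 where "t0 \<in> Poly_Mapping.keys r" by blast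
    with \<tau> ctx show ?thesis
      by (intro exI[of _ "ttype (Node e x (a @ t0 # b))"]) (auto simp: keys_node_ctx intro: ttype_Node_eq)
  qed
qed

text \<open>A generating relator is of one type, so a filter on types either keeps it whole or kills
  it.\<close>

lemma null_filter:
  assumes "coll X" "v \<in> null X"
  shows "lin (\<lambda>t. if Q (ttype t) then gen t else 0) v
      \<in> pm.span {r \<in> drel X. \<forall>t\<in>Poly_Mapping.keys r. Q (ttype t)}"
  using assms(2)
proof (rule lin_span, simp)
  fix r assume r: "r \<in> drel X"
  obtain \<tau> where \<tau>: "\<forall>t\<in>Poly_Mapping.keys r. ttype t = \<tau>" using drel_keys[OF assms(1) r] by blast
  show "lin (\<lambda>t. if Q (ttype t) then gen t else 0) r
      \<in> pm.span {r \<in> drel X. \<forall>t\<in>Poly_Mapping.keys r. Q (ttype t)}"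
  proof (cases "Q \<tau>")
    case True
    have "lin (\<lambda>t. if Q (ttype t) then gen t else 0) r = lin gen r"
      by (rule lin_ext_cong) (use \<tau> True in auto)
    then show ?thesis using r \<tau> True by (auto intro: pm.span_base)
  next
    case False
    have "lin (\<lambda>t. if Q (ttype t) then gen t else 0) r = lin (\<lambda>t. 0) r"
      by (rule lin_ext_cong) (use \<tau> False in auto)
    then show ?thesis by (simp add: pm.span_zero)
  qed
qed

definition tree_typ :: "nat \<Rightarrow> int \<Rightarrow> nat multiset \<times> int \<times> nat \<Rightarrow> bool" where
  "tree_typ n e = (\<lambda>(M, f, w). M = mset_set {..<n} \<and> f = e)"

lemma distinct_leaves_iff:
  "finite A \<Longrightarrow> distinct xs \<and> set xs = A \<longleftrightarrow> mset xs = mset_set A"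
  by (metis finite_set_mset_mset_set mset_eq_setD mset_set_set set_mset_mset
      distinct_count_atmost_1 count_mset_set' mset_set_set)

lemma trees_iff: "t \<in> trees X n e \<longleftrightarrow> decorated X t \<and> tree_typ n e (ttype t)"
  using distinct_leaves_iff[of "{..<n}" "leaves t"] by (auto simp: trees_def tree_typ_def ttype_def)

text \<open>\<open>relators\<close> puts no condition on the children, while \<open>drel\<close>
  asks for decorated ones. Unless a relator is zero, some tree of its support survives, and the
  decoration of that tree supplies those of the children.\<close>

lemma (in coll) relators_null:
  "r \<in> relators X \<Longrightarrow> \<forall>t\<in>Poly_Mapping.keys r. decorated X t \<Longrightarrow> r \<in> null X"
proof (induct r rule: relators.induct)
  case (additive x ts e y)
  let ?r = "gen (Node e (x + y) ts) - gen (Node e x ts) - gen (Node e y ts) :: 'p tree \<Rightarrow>\<^sub>0 'k"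
  show ?case
  proof (cases "?r = 0")
    case True
    then show ?thesis by (simp add: pm.span_zero)
  next
    case False
    then obtain t where t: "t \<in> Poly_Mapping.keys ?r" by (metis all_not_in_conv keys_eq_empty)
    then have "t \<in> {Node e (x + y) ts, Node e x ts, Node e y ts}"
      by (auto simp: in_keys_iff lookup_simps lookup_single when_def split: if_splits)
    then have "\<forall>t\<in>set ts. decorated X t" using additive(3) t by auto
    then have "gen (Node e (cscale X 1 x + cscale X 1 y) ts) - pscale 1 (gen (Node e x ts))
        - pscale 1 (gen (Node e y ts)) \<in> drel X"
      by (intro drel.linear additive)
    then show ?thesis by (simp add: pm.span_base)
  qed
next
  case (scaling x ts e c)
  let ?r = "gen (Node e (cscale X c x) ts) - pscale c (gen (Node e x ts)) :: 'p tree \<Rightarrow>\<^sub>0 'k"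
  show ?case
  proof (cases "?r = 0")
    case True
    then show ?thesis by (simp add: pm.span_zero)
  next
    case False
    then obtain t where t: "t \<in> Poly_Mapping.keys ?r" by (metis all_not_in_conv keys_eq_empty)
    then have "t \<in> {Node e (cscale X c x) ts, Node e x ts}"
      by (auto simp: in_keys_iff lookup_simps lookup_single when_def split: if_splits)
    then have "\<forall>t\<in>set ts. decorated X t" using scaling(2) t by auto
    \<comment> \<open>With second coefficient \<open>0\<close> the merged linear relation is pure
      scaling.\<close>
    then have "gen (Node e (cscale X c x + cscale X 0 x) ts) - pscale c (gen (Node e x ts))
        - pscale 0 (gen (Node e x ts)) \<in> drel X"
      by (intro drel.linear scaling)
    then show ?thesis by (simp add: pm.span_base)
  qed
next
  case (equivariance x ts e \<sigma>)
  let ?u = "Node e x (map (\<lambda>j. ts ! (inv \<sigma> j)) [0..<length ts])"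
  let ?s = "perm_sign (length ts) \<sigma> (\<lambda>i. tdeg (ts ! i)) :: 'k"
  let ?r = "gen (Node e (cact X (length ts) \<sigma> x) ts) - pscale ?s (gen ?u)"
  show ?case
  proof (cases "?r = 0")
    case True
    then show ?thesis by (simp add: pm.span_zero)
  next
    case False
    then obtain t where t: "t \<in> Poly_Mapping.keys ?r" by (metis all_not_in_conv keys_eq_empty)
    then have "t \<in> {Node e (cact X (length ts) \<sigma> x) ts, ?u}"
      by (auto simp: in_keys_iff lookup_simps lookup_single when_def split: if_splits)
    moreover have "set (permute_list (inv \<sigma>) ts) = set ts"
      by (rule set_permute_list) (use equivariance in \<open>auto intro: permutes_inv\<close>)
    ultimately have "\<forall>t\<in>set ts. decorated X t" using equivariance(3) t
      unfolding permute_list_def by auto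
    then show ?thesis
      using null_equivariance[OF equivariance(2,1)] by (simp add: permute_list_def)
  qed
next
  case (in_context r e x us vs)
  show ?case
  proof (cases "Poly_Mapping.keys r = {}")
    case True
    then show ?thesis by (simp add: pm.span_zero)
  next
    case False
    have d: "\<forall>t\<in>Poly_Mapping.keys r. decorated X (Node e x (us @ t # vs))"
      using in_context(3) by (simp add: node_ctx_def[symmetric] keys_node_ctx)
    then have "r \<in> null X" using in_context(2) by simp
    then show ?thesis unfolding node_ctx_def[symmetric]
      using d False by (intro null_node_ctx) (auto simp del: keys_eq_empty)
  qed
qed

lemma (in coll) drel_homogeneous:
  assumes "r \<in> drel X" "r \<in> relators X"
  shows "\<exists>\<tau>. r \<in> pm.span {r \<in> relators X. \<forall>t\<in>Poly_Mapping.keys r. decorated X t \<and> ttype t = \<tau>}"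
  using drel_keys[OF coll_axioms assms(1)] assms(2) by (blast intro: pm.span_base)

text \<open>Converse to \<open>relators_null\<close>: a merged linear relation is the sum of one
  additivity and two scaling relators. The common type is recorded because \<open>tree_null\<close>
  admits only relators supported in one arity and degree.\<close>

lemma (in coll) drel_relators:
  "r \<in> drel X \<Longrightarrow> \<exists>\<tau>. r \<in> pm.span {r \<in> relators X. \<forall>t\<in>Poly_Mapping.keys r. decorated X t \<and> ttype t = \<tau>}"
proof (induct r rule: drel.induct)
  case (linear x ts e y c c')
  let ?g = "\<lambda>x. gen (Node e x ts) :: 'p tree \<Rightarrow>\<^sub>0 'k"
  let ?\<tau> = "ttype (Node e x ts)"
  let ?R = "{r \<in> relators X. \<forall>t\<in>Poly_Mapping.keys r. decorated X t \<and> ttype t = ?\<tau>}"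
  have dec: "decorated X (Node e z ts) \<and> ttype (Node e z ts) = ?\<tau>" if "z \<in> csp X (length ts) e" for z
    using that linear(3) by (auto simp: ttype_def)
  have 1: "?g (cscale X c z) - pscale c (?g z) \<in> ?R" if "z \<in> csp X (length ts) e" for c z
  proof -
    have "Poly_Mapping.keys (?g (cscale X c z) - pscale c (?g z)) \<subseteq> {Node e (cscale X c z) ts, Node e z ts}"
      by (auto simp: in_keys_iff lookup_simps lookup_single when_def split: if_splits)
    then show ?thesis
      using relators.scaling[OF that, of c] dec[OF that] dec[OF csp_scale[OF that, of c]] by auto
  qed
  have 2: "?g (z + z') - ?g z - ?g z' \<in> ?R" if "z \<in> csp X (length ts) e" "z' \<in> csp X (length ts) e" for z z'
  proof -
    have "Poly_Mapping.keys (?g (z + z') - ?g z - ?g z') \<subseteq> {Node e (z + z') ts, Node e z ts, Node e z' ts}"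
      by (auto simp: in_keys_iff lookup_simps lookup_single when_def split: if_splits)
    then show ?thesis
      using relators.additive[OF that] dec[OF that(1)] dec[OF that(2)] dec[OF csp_add[OF that]] by auto
  qed
  have "(?g (cscale X c x + cscale X c' y) - ?g (cscale X c x) - ?g (cscale X c' y))
      + (?g (cscale X c x) - pscale c (?g x)) + (?g (cscale X c' y) - pscale c' (?g y)) \<in> pm.span ?R"
    by (intro pm.span_add pm.span_base 1 2 linear csp_scale)
  then show ?case by (intro exI[of _ ?\<tau>]) (simp add: algebra_simps)
next
  case (swap x a b e t t')
  let ?n = "length a + 2 + length b" and ?k = "length a"
  have p: "adj ?k permutes {..<?n}" by (rule adj_permutes) simp
  have "gen (Node e (cact X ?n (adj ?k) x) (a @ t # t' # b))
      - pscale (perm_sign ?n (adj ?k) (\<lambda>i. tdeg ((a @ t # t' # b) ! i)))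
          (gen (Node e x (permute_list (inv (adj ?k)) (a @ t # t' # b)))) \<in> relators X"
    using relators.equivariance[of x X "a @ t # t' # b" e "adj ?k"] swap(1) p
    by (simp add: permute_list_def del: upt_Suc)
  then have "gen (Node e (cact X ?n (adj ?k) x) (a @ t # t' # b))
      - pscale (ksign (tdeg t * tdeg t')) (gen (Node e x (a @ t' # t # b))) \<in> relators X"
    by (simp add: perm_sign_adj nth_append_two permute_list_adj)
  then show ?case by (rule drel_homogeneous[OF drel.swap[OF swap]])
next
  case (ctx r x a b e)
  then obtain \<tau> where \<tau>: "r \<in> pm.span {r \<in> relators X. \<forall>t\<in>Poly_Mapping.keys r. decorated X t \<and> ttype t = \<tau>}"
    by blast
  \<comment> \<open>The type of a tree in context depends only on the type of what is plugged in. If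
    no tree has type \<open>\<tau>\<close>, any value will do.\<close>
  obtain \<tau>' where \<tau>': "\<And>t. ttype t = \<tau> \<Longrightarrow> ttype (Node e x (a @ t # b)) = \<tau>'"
  proof (cases "\<exists>t::'p tree. ttype t = \<tau>")
    case True
    then obtain t :: "'p tree" where t: "ttype t = \<tau>" by blast
    show ?thesis by (rule that[of "ttype (Node e x (a @ t # b))"]) (rule ttype_Node_eq, simp add: t)
  next
    case False
    then show ?thesis using that by blast
  qed
  have "node_ctx e x a b r \<in> pm.span {r \<in> relators X. \<forall>t\<in>Poly_Mapping.keys r. decorated X t \<and> ttype t = \<tau>'}"
    unfolding node_ctx_def
  proof (rule lin_span[OF \<tau>], simp)
    fix r assume r: "r \<in> {r \<in> relators X. \<forall>t\<in>Poly_Mapping.keys r. decorated X t \<and> ttype t = \<tau>}"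
    then have "node_ctx e x a b r \<in> relators X"
      unfolding node_ctx_def by (intro relators.in_context) simp
    moreover have "\<forall>t\<in>Poly_Mapping.keys (node_ctx e x a b r). decorated X t \<and> ttype t = \<tau>'"
      using r \<tau>' ctx by (auto simp: keys_node_ctx)
    ultimately show "lin (\<lambda>t. gen (Node e x (a @ t # b))) r
        \<in> pm.span {r \<in> relators X. \<forall>t\<in>Poly_Mapping.keys r. decorated X t \<and> ttype t = \<tau>'}"
      by (intro pm.span_base) (simp add: node_ctx_def)
  qed
  then show ?case by blast
qed

lemma subspace_tree_space: "pm.subspace (tree_space X n e)"
  by (simp add: tree_space_def)

text \<open>By homogeneity, a null element supported in one arity and degree is a combination of
  relators supported there. Hence one may compute in \<open>null X\<close> and look at the support
  separately.\<close>

lemma (in coll) tree_null_iff: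
  "v \<in> tree_null X n e \<longleftrightarrow> v \<in> null X \<and> Poly_Mapping.keys v \<subseteq> trees X n e"
proof
  assume v: "v \<in> tree_null X n e"
  have "r \<in> null X" if "r \<in> relators X" "Poly_Mapping.keys r \<subseteq> trees X n e" for r
    by (rule relators_null) (use that in \<open>auto simp: trees_def\<close>)
  then have "tree_null X n e \<subseteq> null X"
    unfolding tree_null_def by (intro pm.span_minimal pm.subspace_span subsetI) simp
  moreover have "tree_null X n e \<subseteq> tree_space X n e"
    unfolding tree_null_def
    by (intro pm.span_minimal subsetI subspace_tree_space) (auto simp: tree_space_iff)
  ultimately show "v \<in> null X \<and> Poly_Mapping.keys v \<subseteq> trees X n e"
    using v subsetD tree_space_iff by metis
next
  assume v: "v \<in> null X \<and> Poly_Mapping.keys v \<subseteq> trees X n e"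
  let ?f = "\<lambda>t. if tree_typ n e (ttype t) then gen t else 0"
  have "lin ?f v = lin gen v"
    by (rule lin_ext_cong) (use v in \<open>auto simp: trees_iff\<close>)
  then have "v \<in> pm.span {r \<in> drel X. \<forall>t\<in>Poly_Mapping.keys r. tree_typ n e (ttype t)}"
    using null_filter[OF coll_axioms conjunct1[OF v], of "tree_typ n e"] by simp
  also have "\<dots> \<subseteq> tree_null X n e"
  proof (rule pm.span_minimal)
    show "pm.subspace (tree_null X n e)" by (simp add: tree_null_def)
    show "{r \<in> drel X. \<forall>t\<in>Poly_Mapping.keys r. tree_typ n e (ttype t)} \<subseteq> tree_null X n e"
    proof safe
      fix r assume r: "r \<in> drel X" "\<forall>t\<in>Poly_Mapping.keys r. tree_typ n e (ttype t)"
      obtain \<tau> where \<tau>: "r \<in> pm.span {r \<in> relators X. \<forall>t\<in>Poly_Mapping.keys r. decorated X t \<and> ttype t = \<tau>}"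
        using drel_relators[OF r(1)] by blast
      also have "\<dots> \<subseteq> pm.span (gen ` {t. ttype t = \<tau>})"
        by (rule pm.span_minimal) (auto simp: span_gen_iff)
      finally have *: "\<forall>t\<in>Poly_Mapping.keys r. ttype t = \<tau>" by (auto simp: span_gen_iff)
      show "r \<in> tree_null X n e"
      proof (cases "Poly_Mapping.keys r = {}")
        case True
        then show ?thesis by (simp add: tree_null_def pm.span_zero)
      next
        case False
        then have "tree_typ n e \<tau>" using * r(2) by auto
        then have "{r \<in> relators X. \<forall>t\<in>Poly_Mapping.keys r. decorated X t \<and> ttype t = \<tau>}
            \<subseteq> {r \<in> relators X. Poly_Mapping.keys r \<subseteq> trees X n e}"
          by (auto simp: trees_iff)
        then show ?thesis using \<tau> pm.span_mono unfolding tree_null_def by blast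
      qed
    qed
  qed
  finally show "v \<in> tree_null X n e" .
qed

lemma (in coll) tree_null_subset: "tree_null X n e \<subseteq> tree_space X n e" "tree_null X n e \<subseteq> null X"
  by (auto simp: tree_null_iff tree_space_iff)

section \<open>Relabelling leaves and mapping decorations\<close>

lemma decorated_relabel [simp]: "decorated X (relabel f t) \<longleftrightarrow> decorated X t"
  by (induct t) auto

lemma tdeg_relabel [simp]: "tdeg (relabel f t) = tdeg t"
  by (induct t) (auto simp: comp_def cong: map_cong)

lemma twt_relabel [simp]: "twt (relabel f t) = twt t"
  by (induct t) (auto simp: comp_def cong: map_cong)

lemma leaves_relabel: "leaves (relabel f t) = map f (leaves t)"
  by (induct t) (auto simp: comp_def map_concat cong: map_cong)

lemma relabel_relabel: "relabel f (relabel g t) = relabel (f \<circ> g) t"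
  by (induct t) auto

lemma relabel_cong: "(\<And>j. j \<in> set (leaves t) \<Longrightarrow> f j = g j) \<Longrightarrow> relabel f t = relabel g t"
  by (induct t) auto

lemma relabel_id: "(\<And>j. j \<in> set (leaves t) \<Longrightarrow> f j = j) \<Longrightarrow> relabel f t = t"
  by (induct t) (auto intro: map_idI)

definition rel :: "(nat \<Rightarrow> nat) \<Rightarrow> ('p tree \<Rightarrow>\<^sub>0 'k::field) \<Rightarrow> ('p tree \<Rightarrow>\<^sub>0 'k)" where
  "rel f = lin (\<lambda>t. gen (relabel f t))"

text \<open>The map receives arity and degree because the projection to weight \<open>d\<close> is
  chosen separately in each of them.\<close>

primrec tmap :: "(nat \<Rightarrow> int \<Rightarrow> 'p \<Rightarrow> 'q) \<Rightarrow> 'p tree \<Rightarrow> 'q tree" where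
  "tmap f (Leaf l) = Leaf l"
| "tmap f (Node e x ts) = Node e (f (length ts) e x) (map (tmap f) ts)"

lemma tdeg_tmap [simp]: "tdeg (tmap f t) = tdeg t"
  by (induct t) (auto simp: comp_def cong: map_cong)

lemma twt_tmap [simp]: "twt (tmap f t) = twt t"
  by (induct t) (auto simp: comp_def cong: map_cong)

lemma leaves_tmap [simp]: "leaves (tmap f t) = leaves t"
  by (induct t) (auto simp: comp_def cong: map_cong)

lemma null_rel:
  fixes X :: "('k::field, 'p::ab_group_add) collection"
  assumes "v \<in> null X"
  shows "rel f v \<in> null X"
  unfolding rel_def
proof (rule lin_span[OF assms], simp)
  fix r :: "'p tree \<Rightarrow>\<^sub>0 'k" assume "r \<in> drel X"
  then show "lin (\<lambda>t. gen (relabel f t)) r \<in> null X"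
  proof induct
    case (linear x ts e y c c')
    then show ?case
      using drel.linear[of x X "map (relabel f) ts" e y c c'] by (simp add: lin_simps pm.span_base)
  next
    case (swap x a b e t t')
    let ?g = "relabel f"
    have "gen (Node e (cact X (length (map ?g a) + 2 + length (map ?g b)) (adj (length (map ?g a))) x)
        (map ?g a @ ?g t # ?g t' # map ?g b))
      - pscale (ksign (tdeg (?g t) * tdeg (?g t')))
         (gen (Node e x (map ?g a @ ?g t' # ?g t # map ?g b))) \<in> drel X"
      by (rule drel.swap) (use swap in auto)
    then show ?case by (simp add: lin_simps pm.span_base)
  next
    case (ctx r x a b e)
    have "lin (\<lambda>t. gen (relabel f t)) (node_ctx e x a b r)
        = node_ctx e x (map (relabel f) a) (map (relabel f) b) (lin (\<lambda>t. gen (relabel f t)) r)"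
      by (simp add: lin_node_ctx node_ctx_lin node_ctx_gen)
    then show ?case by (simp, intro null_node_ctx) (use ctx in auto)
  qed
qed

lemma decorated_tmap:
  assumes "\<And>n e x. x \<in> csp X n e \<Longrightarrow> f n e x \<in> csp Y n e" "decorated X t"
  shows "decorated Y (tmap f t)"
  using assms(2) by (induct t) (auto intro: assms(1))

text \<open>Linear equivariant maps of decorations descend to the quotients. It serves for the
  inclusion of the weight \<open>d\<close> part and for the projection back onto it.\<close>

lemma null_tmap:
  fixes X :: "('k::field, 'p::ab_group_add) collection" and Y :: "('k, 'q::ab_group_add) collection"
  assumes csp: "\<And>n e x. x \<in> csp X n e \<Longrightarrow> f n e x \<in> csp Y n e"
    and lin: "\<And>n e x y c c'. \<lbrakk>x \<in> csp X n e; y \<in> csp X n e\<rbrakk> \<Longrightarrow>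
        f n e (cscale X c x + cscale X c' y) = cscale Y c (f n e x) + cscale Y c' (f n e y)"
    and act: "\<And>n e x \<sigma>. \<lbrakk>x \<in> csp X n e; \<sigma> permutes {..<n}\<rbrakk> \<Longrightarrow> f n e (cact X n \<sigma> x) = cact Y n \<sigma> (f n e x)"
    and v: "v \<in> null X"
  shows "lin (\<lambda>t. gen (tmap f t)) v \<in> null Y"
proof (rule lin_span[OF v], simp)
  fix r assume "r \<in> drel X"
  then show "lin (\<lambda>t. gen (tmap f t)) r \<in> null Y"
  proof induct
    case (linear x ts e y c c')
    have "gen (Node e (cscale Y c (f (length ts) e x) + cscale Y c' (f (length ts) e y)) (map (tmap f) ts))
      - pscale c (gen (Node e (f (length ts) e x) (map (tmap f) ts)))
      - pscale c' (gen (Node e (f (length ts) e y) (map (tmap f) ts))) \<in> drel Y"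
      by (rule drel.linear) (use linear csp decorated_tmap[of X f Y, OF csp] in auto)
    then show ?case by (simp add: lin_simps lin[OF linear(1,2)] pm.span_base)
  next
    case (swap x a b e t t')
    let ?n = "length a + 2 + length b"
    have "gen (Node e (cact Y (length (map (tmap f) a) + 2 + length (map (tmap f) b)) (adj (length (map (tmap f) a))) (f ?n e x))
        (map (tmap f) a @ tmap f t # tmap f t' # map (tmap f) b))
      - pscale (ksign (tdeg (tmap f t) * tdeg (tmap f t')))
         (gen (Node e (f ?n e x) (map (tmap f) a @ tmap f t' # tmap f t # map (tmap f) b))) \<in> drel Y"
      by (rule drel.swap) (use swap csp decorated_tmap[of X f Y, OF csp] in auto)
    moreover have "f ?n e (cact X ?n (adj (length a)) x) = cact Y ?n (adj (length a)) (f ?n e x)"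
      by (rule act[OF swap(1)]) (rule adj_permutes, simp)
    ultimately show ?case by (simp add: lin_simps pm.span_base)
  next
    case (ctx r x a b e)
    have "lin (\<lambda>t. gen (tmap f t)) (node_ctx e x a b r)
        = node_ctx e (f (length a + 1 + length b) e x) (map (tmap f) a) (map (tmap f) b) (lin (\<lambda>t. gen (tmap f t)) r)"
      by (simp add: lin_node_ctx node_ctx_lin node_ctx_gen)
    then show ?case by (simp, intro null_node_ctx)
      (use ctx csp[OF ctx(3)] decorated_tmap[of X f Y, OF csp] in auto)
  qed
qed

section \<open>Cutting and grafting\<close>

lemma ssum_diff:
  fixes G :: "'t list \<Rightarrow> 't \<Rightarrow> 't list \<Rightarrow> 'v::ab_group_add"
  shows "ssum ts (\<lambda>a t b. G a t b - H a t b) = ssum ts G - ssum ts H"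
  by (induct ts arbitrary: G H) (auto simp: algebra_simps)

lemma null_linear:
  "\<lbrakk>x \<in> csp X (length ts) e; y \<in> csp X (length ts) e; \<forall>t\<in>set ts. decorated X t\<rbrakk> \<Longrightarrow>
    gen (Node e (cscale X c x + cscale X c' y) ts) - pscale c (gen (Node e x ts))
      - pscale c' (gen (Node e y ts)) \<in> null X"
  by (intro pm.span_base drel.linear)

lemma null_swap:
  "\<lbrakk>x \<in> csp X (length a + 2 + length b) e; \<forall>t\<in>set (a @ t # t' # b). decorated X t\<rbrakk> \<Longrightarrow>
    gen (Node e (cact X (length a + 2 + length b) (adj (length a)) x) (a @ t # t' # b))
      - pscale (ksign (tdeg t * tdeg t')) (gen (Node e x (a @ t' # t # b))) \<in> null X"
  by (intro pm.span_base drel.swap)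

text \<open>Both the decomposition of a tree and the grafting onto a leaf are sums over positions: one
  child is replaced, and a remainder of degree \<open>dq q\<close> moves past the later siblings.\<close>

definition pos_ctx :: "('q \<Rightarrow> int) \<Rightarrow> int \<Rightarrow> 'p \<Rightarrow> 'p tree list \<Rightarrow> 'p tree list
    \<Rightarrow> ('p tree \<times> 'q \<Rightarrow>\<^sub>0 'k::field) \<Rightarrow> ('p tree \<times> 'q \<Rightarrow>\<^sub>0 'k)" where
  "pos_ctx dq e x a b =
    lin (\<lambda>p. pscale (ksign (tdegs b * dq (snd p))) (gen (Node e x (a @ fst p # b), snd p)))"

abbreviation "dec_ctx \<equiv> pos_ctx tdeg"
lemmas dec_ctx_def = pos_ctx_def[of tdeg]

primrec pos_sum :: "('q \<Rightarrow> int) \<Rightarrow> ('p tree \<Rightarrow> ('p tree \<times> 'q \<Rightarrow>\<^sub>0 'k::field)) \<Rightarrow> 'p tree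
    \<Rightarrow> ('p tree \<times> 'q \<Rightarrow>\<^sub>0 'k)" where
  "pos_sum dq f (Leaf j) = 0"
| "pos_sum dq f (Node e x ts) = ssum ts (\<lambda>a t b. pos_ctx dq e x a b (f t))"

text \<open>Pulls a sign that depends on the varying tree out of a relator, whose trees all have one
  degree.\<close>

lemma lin_const_deg:
  assumes "\<forall>t\<in>Poly_Mapping.keys r. tdeg t = d"
  shows "lin (\<lambda>t. pscale (ksign (f (tdeg t))) (g t)) r = pscale (ksign (f d)) (lin g r)"
  unfolding lin_fun_pscale[symmetric] by (rule lin_ext_cong) (use assms in auto)

lemma drel_tdeg:
  assumes "coll X" "r \<in> drel X"
  obtains d where "\<forall>t\<in>Poly_Mapping.keys r. tdeg t = d"
proof -
  obtain \<tau> where "\<forall>t\<in>Poly_Mapping.keys r. ttype t = \<tau>" using drel_keys[OF assms] by blast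
  then have "\<forall>t\<in>Poly_Mapping.keys r. tdeg t = fst (snd \<tau>)" by (auto simp: ttype_def)
  then show ?thesis using that by blast
qed

text \<open>Common core of the compatibility of cutting and of grafting with the relations: apart
  from terms at the root, the map acts at one child at a time. Only the parity of the degree balance
  matters for signs, and only parity can be asked, since a cut lowers the degree of the child while
  grafting raises it.\<close>

lemma pos_sum_null:
  fixes X :: "('k::field, 'p::ab_group_add) collection" and f :: "'p tree \<Rightarrow> ('p tree \<times> 'q \<Rightarrow>\<^sub>0 'k)"
  assumes "coll X" and W: "pm.subspace W"
    and W_null: "\<And>v q. v \<in> null X \<Longrightarrow> Q q \<Longrightarrow> v \<otimes>\<^sub>p gen q \<in> W"
    and keys: "\<And>t p. decorated X t \<Longrightarrow> p \<in> Poly_Mapping.keys (f t) \<Longrightarrow>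
      decorated X (fst p) \<and> Q (snd p) \<and> even (tdeg (fst p) + dq (snd p) - tdeg t)"
    and W_ctx: "\<And>e x a b v. \<lbrakk>v \<in> W; x \<in> csp X (length a + 1 + length b) e; \<forall>t\<in>set (a @ b). decorated X t\<rbrakk>
      \<Longrightarrow> pos_ctx dq e x a b v \<in> W"
    and root: "\<And>r. r \<in> drel X \<Longrightarrow> lin (\<lambda>t. f t - pos_sum dq f t) r \<in> W"
    and v: "v \<in> null X"
  shows "lin f v \<in> W"
proof (rule lin_span[OF v W])
  interpret coll X by fact
  note subs = ssum_in_subspace[OF W] lin_in_subspace[OF W]
    pm.subspace_scale[OF W] pm.subspace_add[OF W]
  fix r assume r: "r \<in> drel X"
  have step: "lin f r \<in> W" if "r \<in> drel X" "lin (pos_sum dq f) r \<in> W" for r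
    using subs(4)[OF root[OF that(1)] that(2)] by (simp add: lin_fun_diff)
  from r show "lin f r \<in> W"
  proof (induct r)
    case (linear x ts e y c c')
    let ?g = "\<lambda>z l a b. gen (Node e z (a @ l # b)) :: 'p tree \<Rightarrow>\<^sub>0 'k"
    let ?z = "cscale X c x + cscale X c' y"
    let ?r = "gen (Node e ?z ts) - pscale c (gen (Node e x ts)) - pscale c' (gen (Node e y ts))"
    have "lin (pos_sum dq f) ?r = ssum ts (\<lambda>a t b. pos_ctx dq e ?z a b (f t)
        - pscale c (pos_ctx dq e x a b (f t)) - pscale c' (pos_ctx dq e y a b (f t)))"
      by (simp add: lin_simps ssum_diff pscale_ssum)
    also have "\<dots> = ssum ts (\<lambda>a t b. lin (\<lambda>p. pscale (ksign (tdegs b * dq (snd p)))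
        ((?g ?z (fst p) a b - pscale c (?g x (fst p) a b) - pscale c' (?g y (fst p) a b)) \<otimes>\<^sub>p gen (snd p))) (f t))"
      by (simp add: pos_ctx_def lin_fun_diff[symmetric] lin_fun_pscale[symmetric] tensor_simps tensor_gen
          pm.scale_right_diff_distrib mult.commute)
    also have "\<dots> \<in> W"
      by (intro subs W_null null_linear) (use linear keys in auto)
    finally have "lin (pos_sum dq f) ?r \<in> W" .
    then show ?case by (intro step drel.linear[OF linear])
  next
    case (swap x a b e t t')
    let ?y = "cact X (length a + 2 + length b) (adj (length a)) x"
    let ?e = "ksign (tdeg t * tdeg t') :: 'k"
    let ?r = "gen (Node e ?y (a @ t # t' # b)) - pscale ?e (gen (Node e x (a @ t' # t # b)))"
    \<comment> \<open>The four parts are the positions left of the exchanged pair, right of it, and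
      its two members. In the first two the pair is exchanged in the presence of a replaced
      sibling.\<close>
    have 1: "ssum a (\<lambda>a1 t1 b1. pos_ctx dq e ?y a1 (b1 @ t # t' # b) (f t1)
        - pscale ?e (pos_ctx dq e x a1 (b1 @ t' # t # b) (f t1))) \<in> W"
    proof (rule subs(1), goal_cases)
      case (1 a1 t1 b1)
      have "pos_ctx dq e ?y a1 (b1 @ t # t' # b) (f t1) - pscale ?e (pos_ctx dq e x a1 (b1 @ t' # t # b) (f t1))
        = lin (\<lambda>p. pscale (ksign (tdegs (b1 @ t # t' # b) * dq (snd p)))
        ((gen (Node e ?y ((a1 @ fst p # b1) @ t # t' # b))
          - pscale ?e (gen (Node e x ((a1 @ fst p # b1) @ t' # t # b)))) \<otimes>\<^sub>p gen (snd p))) (f t1)"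
        by (simp add: pos_ctx_def lin_fun_diff[symmetric] lin_fun_pscale[symmetric] tensor_simps tensor_gen
          pm.scale_right_diff_distrib mult.commute add.left_commute)
      also have "\<dots> \<in> W"
      proof (rule subs(2), rule subs(3), rule W_null)
        fix p assume p: "p \<in> Poly_Mapping.keys (f t1)"
        show "gen (Node e ?y ((a1 @ fst p # b1) @ t # t' # b))
          - pscale ?e (gen (Node e x ((a1 @ fst p # b1) @ t' # t # b))) \<in> null X"
          using null_swap[of x X "a1 @ fst p # b1" b e t t'] swap keys[OF _ p] 1 by simp
        show "Q (snd p)" using keys[OF _ p] swap 1 by auto
      qed
      finally show ?case .
    qed
    have 2: "ssum b (\<lambda>a1 t1 b1. pos_ctx dq e ?y (a @ t # t' # a1) b1 (f t1)
        - pscale ?e (pos_ctx dq e x (a @ t' # t # a1) b1 (f t1))) \<in> W"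
    proof (rule subs(1), goal_cases)
      case (1 a1 t1 b1)
      have "pos_ctx dq e ?y (a @ t # t' # a1) b1 (f t1) - pscale ?e (pos_ctx dq e x (a @ t' # t # a1) b1 (f t1))
        = lin (\<lambda>p. pscale (ksign (tdegs b1 * dq (snd p)))
        ((gen (Node e ?y (a @ t # t' # (a1 @ fst p # b1)))
          - pscale ?e (gen (Node e x (a @ t' # t # (a1 @ fst p # b1))))) \<otimes>\<^sub>p gen (snd p))) (f t1)"
        by (simp add: pos_ctx_def lin_fun_diff[symmetric] lin_fun_pscale[symmetric] tensor_simps tensor_gen
          pm.scale_right_diff_distrib mult.commute)
      also have "\<dots> \<in> W"
      proof (rule subs(2), rule subs(3), rule W_null)
        fix p assume p: "p \<in> Poly_Mapping.keys (f t1)"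
        show "gen (Node e ?y (a @ t # t' # (a1 @ fst p # b1)))
          - pscale ?e (gen (Node e x (a @ t' # t # (a1 @ fst p # b1)))) \<in> null X"
          using null_swap[of x X a "a1 @ fst p # b1" e t t'] swap keys[OF _ p] 1 by simp
        show "Q (snd p)" using keys[OF _ p] swap 1 by auto
      qed
      finally show ?case .
    qed
    \<comment> \<open>The replaced child is itself exchanged. Its degree splits, modulo two, into
      that of the new child and that of the remainder, and the remainder passes \<open>t'\<close> in
      one of the two orders only.\<close>
    have 3: "pos_ctx dq e ?y a (t' # b) (f t) - pscale ?e (pos_ctx dq e x (a @ [t']) b (f t)) \<in> W"
    proof -
      have "pos_ctx dq e ?y a (t' # b) (f t) - pscale ?e (pos_ctx dq e x (a @ [t']) b (f t))
        = lin (\<lambda>p. pscale (ksign (tdegs (t' # b) * dq (snd p)))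
        ((gen (Node e ?y (a @ fst p # t' # b))
          - pscale (ksign (tdeg (fst p) * tdeg t')) (gen (Node e x (a @ t' # fst p # b)))) \<otimes>\<^sub>p gen (snd p))) (f t)"
        unfolding pos_ctx_def lin_fun_diff[symmetric] lin_fun_pscale[symmetric]
      proof (rule lin_ext_cong)
        fix p assume p: "p \<in> Poly_Mapping.keys (f t)"
        have "?e * ksign (tdegs b * dq (snd p)) = ksign (tdegs (t' # b) * dq (snd p)) * ksign (tdeg (fst p) * tdeg t')"
          using keys[OF _ p] swap(2) by (auto simp: ksign_def)
        then show "pscale (ksign (tdegs (t' # b) * dq (snd p))) (gen (Node e ?y (a @ fst p # t' # b), snd p)) -
           pscale ?e (pscale (ksign (tdegs b * dq (snd p))) (gen (Node e x ((a @ [t']) @ fst p # b), snd p))) =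
           pscale (ksign (tdegs (t' # b) * dq (snd p))) ((gen (Node e ?y (a @ fst p # t' # b))
          - pscale (ksign (tdeg (fst p) * tdeg t')) (gen (Node e x (a @ t' # fst p # b)))) \<otimes>\<^sub>p gen (snd p))"
          by (simp add: tensor_simps tensor_gen pm.scale_right_diff_distrib)
      qed
      also have "\<dots> \<in> W"
        by (intro subs W_null null_swap) (use swap keys[of t] in auto)
      finally show ?thesis .
    qed
    have 4: "pos_ctx dq e ?y (a @ [t]) b (f t') - pscale ?e (pos_ctx dq e x a (t # b) (f t')) \<in> W"
    proof -
      have "pos_ctx dq e ?y (a @ [t]) b (f t') - pscale ?e (pos_ctx dq e x a (t # b) (f t'))
        = lin (\<lambda>p. pscale (ksign (tdegs b * dq (snd p)))
        ((gen (Node e ?y (a @ t # fst p # b))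
          - pscale (ksign (tdeg t * tdeg (fst p))) (gen (Node e x (a @ fst p # t # b)))) \<otimes>\<^sub>p gen (snd p))) (f t')"
        unfolding pos_ctx_def lin_fun_diff[symmetric] lin_fun_pscale[symmetric]
      proof (rule lin_ext_cong)
        fix p assume p: "p \<in> Poly_Mapping.keys (f t')"
        have "?e * ksign (tdegs (t # b) * dq (snd p)) = ksign (tdegs b * dq (snd p)) * ksign (tdeg t * tdeg (fst p))"
          using keys[OF _ p] swap(2) by (auto simp: ksign_def)
        then show "pscale (ksign (tdegs b * dq (snd p))) (gen (Node e ?y ((a @ [t]) @ fst p # b), snd p)) -
           pscale ?e (pscale (ksign (tdegs (t # b) * dq (snd p))) (gen (Node e x (a @ fst p # t # b), snd p))) =
           pscale (ksign (tdegs b * dq (snd p))) ((gen (Node e ?y (a @ t # fst p # b))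
          - pscale (ksign (tdeg t * tdeg (fst p))) (gen (Node e x (a @ fst p # t # b)))) \<otimes>\<^sub>p gen (snd p))"
          by (simp add: tensor_simps tensor_gen pm.scale_right_diff_distrib)
      qed
      also have "\<dots> \<in> W"
        by (intro subs W_null null_swap) (use swap keys[of t'] in auto)
      finally show ?thesis .
    qed
    have "lin (pos_sum dq f) ?r =
      ssum a (\<lambda>a1 t1 b1. pos_ctx dq e ?y a1 (b1 @ t # t' # b) (f t1)
        - pscale ?e (pos_ctx dq e x a1 (b1 @ t' # t # b) (f t1)))
      + ssum b (\<lambda>a1 t1 b1. pos_ctx dq e ?y (a @ t # t' # a1) b1 (f t1)
        - pscale ?e (pos_ctx dq e x (a @ t' # t # a1) b1 (f t1)))
      + (pos_ctx dq e ?y a (t' # b) (f t) - pscale ?e (pos_ctx dq e x (a @ [t']) b (f t)))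
      + (pos_ctx dq e ?y (a @ [t]) b (f t') - pscale ?e (pos_ctx dq e x a (t # b) (f t')))"
      by (simp add: lin_simps ssum_append ssum_diff pscale_ssum[symmetric] pm.scale_right_distrib algebra_simps)
    also have "\<dots> \<in> W" by (intro subs 1 2 3 4)
    finally have "lin (pos_sum dq f) ?r \<in> W" .
    then show ?case by (intro step drel.swap[OF swap])
  next
    case (ctx r x a b e)
    obtain d where d: "\<forall>t\<in>Poly_Mapping.keys r. tdeg t = d" using drel_tdeg[OF assms(1) ctx(1)] .
    have r: "r \<in> null X" by (rule pm.span_base) (rule ctx)
    \<comment> \<open>The relator sits in one child. Acting on that child is the induction
      hypothesis; acting on a sibling leaves a relator in context, with a sign that is constant on
      it.\<close>
    have "lin (pos_sum dq f) (node_ctx e x a b r) =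
      lin (\<lambda>t. ssum a (\<lambda>a1 t1 b1. pos_ctx dq e x a1 (b1 @ t # b) (f t1))) r
      + pos_ctx dq e x a b (lin f r)
      + lin (\<lambda>t. ssum b (\<lambda>a1 t1 b1. pos_ctx dq e x (a @ t # a1) b1 (f t1))) r"
      by (simp add: lin_node_ctx ssum_append lin_fun_add pos_ctx_def lin_lin add.assoc)
    also have "\<dots> \<in> W"
    proof (intro subs(4) W_ctx ctx)
      show "lin (\<lambda>t. ssum a (\<lambda>a1 t1 b1. pos_ctx dq e x a1 (b1 @ t # b) (f t1))) r \<in> W"
        unfolding lin_fun_ssum
      proof (rule subs(1), goal_cases)
        case (1 a1 t1 b1)
        have "lin (\<lambda>t. pos_ctx dq e x a1 (b1 @ t # b) (f t1)) r
          = lin (\<lambda>p. lin (\<lambda>t. pscale (ksign (tdegs (b1 @ t # b) * dq (snd p)))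
              (gen (Node e x (a1 @ fst p # b1 @ t # b), snd p))) r) (f t1)"
          unfolding pos_ctx_def by (rule lin_swap)
        also have "\<dots> = lin (\<lambda>p. pscale (ksign ((tdegs b1 + d + tdegs b) * dq (snd p)))
              (node_ctx e x (a1 @ fst p # b1) b r \<otimes>\<^sub>p gen (snd p))) (f t1)"
          using lin_const_deg[OF d, of "\<lambda>i. (tdegs b1 + i + tdegs b) * dq (snd _)"]
          by (intro lin_ext_cong) (simp add: tensor_lin_left node_ctx_def tensor_gen add.assoc)
        also have "\<dots> \<in> W"
          by (intro subs W_null null_node_ctx r) (use ctx 1 keys[of t1] in auto)
        finally show ?case .
      qed
      show "lin (\<lambda>t. ssum b (\<lambda>a1 t1 b1. pos_ctx dq e x (a @ t # a1) b1 (f t1))) r \<in> W"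
        unfolding lin_fun_ssum
      proof (rule subs(1), goal_cases)
        case (1 a1 t1 b1)
        have "lin (\<lambda>t. pos_ctx dq e x (a @ t # a1) b1 (f t1)) r
          = lin (\<lambda>p. lin (\<lambda>t. pscale (ksign (tdegs b1 * dq (snd p)))
              (gen (Node e x (a @ t # a1 @ fst p # b1), snd p))) r) (f t1)"
          unfolding pos_ctx_def by (subst lin_swap) simp
        also have "\<dots> = lin (\<lambda>p. pscale (ksign (tdegs b1 * dq (snd p)))
              (node_ctx e x a (a1 @ fst p # b1) r \<otimes>\<^sub>p gen (snd p))) (f t1)"
          by (simp add: tensor_lin_left node_ctx_def tensor_gen lin_fun_pscale)
        also have "\<dots> \<in> W"
          by (intro subs W_null null_node_ctx r) (use ctx 1 keys[of t1] in auto)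
        finally show ?case .
      qed
    qed
    finally have "lin (pos_sum dq f) (node_ctx e x a b r) \<in> W" .
    then show ?case by (intro step drel.ctx[OF ctx(1,3,4)])
  qed
qed

text \<open>The decomposition of a tree along the edges above which the leaves are those labelled by
  \<open>S\<close>, the new leaf being labelled \<open>s\<close>. In contrast to \<open>tree_decomp\<close>, no leaf is renumbered.\<close>

primrec ecut :: "nat set \<Rightarrow> nat \<Rightarrow> 'p tree \<Rightarrow> ('p tree \<times> 'p tree \<Rightarrow>\<^sub>0 'k::field)" where
  "ecut S s (Leaf j) = (if S = set (leaves (Leaf j :: 'p tree)) then gen (Leaf s, Leaf j) else 0)"
| "ecut S s (Node e x ts) =
    (if S = set (leaves (Node e x ts)) then gen (Leaf s, Node e x ts) else 0)
    + (\<Sum>i<length ts. dec_ctx e x (take i ts) (drop (i + 1) ts) (map (ecut S s) ts ! i))"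

text \<open>\<open>ecut\<close> without the root edge: precisely the cuts whose lower part keeps the
  root vertex.\<close>

primrec ecut_above :: "nat set \<Rightarrow> nat \<Rightarrow> 'p tree \<Rightarrow> ('p tree \<times> 'p tree \<Rightarrow>\<^sub>0 'k::field)" where
  "ecut_above S s (Leaf j) = 0"
| "ecut_above S s (Node e x ts) = ssum ts (\<lambda>a t b. dec_ctx e x a b (ecut S s t))"

lemma ecut_eq: "ecut S s t = (if S = set (leaves t) then gen (Leaf s, t) else 0) + ecut_above S s t"
proof (cases t)
  case (Node e x ts)
  have "(\<Sum>i<length ts. dec_ctx e x (take i ts) (drop (i + 1) ts) (map (ecut S s) ts ! i))
      = ssum ts (\<lambda>a t b. dec_ctx e x a b (ecut S s t) :: _ \<Rightarrow>\<^sub>0 'b)"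
    by (subst ssum_nth[symmetric], rule sum.cong) auto
  then show ?thesis using Node by simp
qed simp

declare ecut.simps [simp del]

lemma keys_dec_ctx:
  "p \<in> Poly_Mapping.keys (dec_ctx e x a b v) \<Longrightarrow>
    \<exists>l. (l, snd p) \<in> Poly_Mapping.keys v \<and> fst p = Node e x (a @ l # b)"
  unfolding dec_ctx_def
  using subsetD[OF keys_lin, of p "\<lambda>p. pscale (ksign (tdegs b * tdeg (snd p))) (gen (Node e x (a @ fst p # b), snd p))" v]
  by (auto dest!: subsetD[OF keys_pscale])

lemma keys_ecut:
  "(l, u) \<in> Poly_Mapping.keys (ecut S s t :: _ \<Rightarrow>\<^sub>0 'k::field) \<Longrightarrow>
    mset (leaves l) + mset (leaves u) = add_mset s (mset (leaves t)) \<and> set (leaves u) = S \<and>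
    tdeg l + tdeg u = tdeg t \<and> twt l + twt u = twt t \<and>
    (decorated X t \<longrightarrow> decorated X l \<and> decorated X u)"
proof (induct t arbitrary: l u)
  case (Leaf j)
  then show ?case by (auto simp: ecut_eq split: if_splits)
next
  case (Node e x ts)
  let ?t = "Node e x ts"
  have "(l, u) \<in> Poly_Mapping.keys (if S = set (leaves ?t) then gen (Leaf s, ?t) else 0 :: _ \<Rightarrow>\<^sub>0 'k)
      \<union> Poly_Mapping.keys (ecut_above S s ?t :: _ \<Rightarrow>\<^sub>0 'k)"
    using subsetD[OF Poly_Mapping.keys_add Node(2)[unfolded ecut_eq[of S s ?t]]] .
  then consider "S = set (leaves ?t)" "l = Leaf s" "u = ?t"
    | "(l, u) \<in> Poly_Mapping.keys (ecut_above S s ?t :: _ \<Rightarrow>\<^sub>0 'k)"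
    by (auto split: if_splits simp del: leaves.simps)
  then show ?case
  proof cases
    case 1
    then show ?thesis by simp
  next
    case 2
    then obtain a t b where ts: "ts = a @ t # b"
      and p: "(l, u) \<in> Poly_Mapping.keys (dec_ctx e x a b (ecut S s t) :: _ \<Rightarrow>\<^sub>0 'k)"
      using keys_ssum[of ts "\<lambda>a t b. dec_ctx e x a b (ecut S s t) :: _ \<Rightarrow>\<^sub>0 'k"] by auto
    obtain l' where l': "(l', u) \<in> Poly_Mapping.keys (ecut S s t :: _ \<Rightarrow>\<^sub>0 'k)" "l = Node e x (a @ l' # b)"
      using keys_dec_ctx[OF p] by auto
    have "t \<in> set ts" by (simp add: ts)
    note IH = Node(1)[OF this l'(1)]
    then have "mset (leaves l') + mset (leaves u) = add_mset s (mset (leaves t))" by blast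
    then have "mset (leaves l) + mset (leaves u) = add_mset s (mset (leaves ?t))"
      by (simp add: l'(2) ts ac_simps)
    then show ?thesis using IH by (auto simp: l'(2) ts)
  qed
qed

text \<open>The relations of the tensor square in all arities at once. The other factor is a
  decorated tree, so that maps which are only controlled on decorated trees can be applied;
  \<open>tnull_tensor_null\<close> leads back to \<open>tensor_null\<close>.\<close>

definition tnull :: "('k::field, 'p::ab_group_add) collection \<Rightarrow> ('p tree \<times> 'p tree \<Rightarrow>\<^sub>0 'k) set" where
  "tnull X = pm.span ({r \<otimes>\<^sub>p gen u | r u. r \<in> drel X \<and> decorated X u}
    \<union> {gen l \<otimes>\<^sub>p r | l r. decorated X l \<and> r \<in> drel X})"

lemma subspace_tnull: "pm.subspace (tnull X)"
  by (simp add: tnull_def)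

lemma tnull_left:
  assumes "v \<in> null X" "decorated X u"
  shows "v \<otimes>\<^sub>p gen u \<in> tnull X"
proof -
  have "null X \<subseteq> {v. v \<otimes>\<^sub>p gen u \<in> tnull X}"
    by (intro pm.span_minimal subspace_vimage_tensor subspace_tnull)
      (use assms(2) in \<open>unfold tnull_def, blast intro: pm.span_base\<close>)
  then show ?thesis using assms(1) by blast
qed

lemma tnull_right:
  assumes "v \<in> null X" "decorated X l"
  shows "gen l \<otimes>\<^sub>p v \<in> tnull X"
proof -
  have "null X \<subseteq> {v. gen l \<otimes>\<^sub>p v \<in> tnull X}"
    by (intro pm.span_minimal subspace_vimage_tensor subspace_tnull)
      (use assms(2) in \<open>unfold tnull_def, blast intro: pm.span_base\<close>)
  then show ?thesis using assms(1) by blast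
qed

lemma lin_tnull:
  assumes "v \<in> tnull X" "pm.subspace W"
    and "\<And>r u. r \<in> drel X \<Longrightarrow> decorated X u \<Longrightarrow> lin (\<lambda>l. f (l, u)) r \<in> W"
    and "\<And>r l. r \<in> drel X \<Longrightarrow> decorated X l \<Longrightarrow> lin (\<lambda>u. f (l, u)) r \<in> W"
  shows "lin f v \<in> W"
  by (rule lin_span[OF assms(1)[unfolded tnull_def] assms(2)])
    (auto simp: lin_tensor lin_simps assms(3,4))

lemma dec_ctx_tnull:
  assumes "coll X" "v \<in> tnull X" "x \<in> csp X (length a + 1 + length b) e" "\<forall>t\<in>set (a @ b). decorated X t"
  shows "dec_ctx e x a b v \<in> tnull X"
  unfolding dec_ctx_def
proof (rule lin_tnull[OF assms(2) subspace_tnull], goal_cases)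
  case (1 r u)
  have "lin (\<lambda>l. pscale (ksign (tdegs b * tdeg u)) (gen (Node e x (a @ l # b), u))) r
      = pscale (ksign (tdegs b * tdeg u)) (node_ctx e x a b r \<otimes>\<^sub>p gen u)"
    by (simp add: lin_fun_pscale node_ctx_def tensor_lin_left tensor_gen)
  then show ?case
    by (simp, intro pm.subspace_scale[OF subspace_tnull] tnull_left null_node_ctx pm.span_base)
      (use 1 assms in auto)
next
  case (2 r l)
  obtain d where d: "\<forall>t\<in>Poly_Mapping.keys r. tdeg t = d" using drel_tdeg[OF assms(1) 2(1)] .
  have "lin (\<lambda>u. pscale (ksign (tdegs b * tdeg u)) (gen (Node e x (a @ l # b), u))) r
      = pscale (ksign (tdegs b * d)) (gen (Node e x (a @ l # b)) \<otimes>\<^sub>p r)"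
    using lin_const_deg[OF d, of "\<lambda>i. tdegs b * i" "\<lambda>u. gen (Node e x (a @ l # b), u)"]
    by (subst tensor_right) (simp add: tensor_gen)
  then show ?case
    by (simp, intro pm.subspace_scale[OF subspace_tnull] tnull_right pm.span_base)
      (use 2 assms in auto)
qed

lemma dec_ctx_simps:
  "dec_ctx e x a b (v + w) = dec_ctx e x a b v + dec_ctx e x a b w"
  "dec_ctx e x a b 0 = 0"
  by (simp_all add: dec_ctx_def lin_simps)

text \<open>Whether the root edge is cut depends only on the set of leaves, which is constant on a
  relator.\<close>

lemma ecut_root_tnull:
  fixes X :: "('k::field, 'p::ab_group_add) collection"
  assumes "coll X" "r \<in> drel X"
  shows "lin (\<lambda>t. if S = set (leaves t) then gen (Leaf s, t) else 0) r \<in> tnull X"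
proof -
  obtain \<tau> where \<tau>: "\<forall>t\<in>Poly_Mapping.keys r. ttype t = \<tau>" using drel_keys[OF assms] by blast
  then have L: "\<forall>t\<in>Poly_Mapping.keys r. set (leaves t) = set_mset (fst \<tau>)"
    by (auto simp: ttype_def)
  show ?thesis
  proof (cases "S = set_mset (fst \<tau>)")
    case True
    have "lin (\<lambda>t. if S = set (leaves t) then gen (Leaf s :: 'p tree, t) else 0) r = lin (\<lambda>t. gen (Leaf s) \<otimes>\<^sub>p gen t) r"
      by (rule lin_ext_cong) (use L True in \<open>auto simp: tensor_gen\<close>)
    also have "\<dots> = gen (Leaf s) \<otimes>\<^sub>p r" by (rule tensor_right[symmetric])
    finally show ?thesis using assms(2) by (simp only:) (intro tnull_right pm.span_base, auto)
  next
    case False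
    have "lin (\<lambda>t. if S = set (leaves t) then gen (Leaf s :: 'p tree, t) else 0) r = lin (\<lambda>t. 0) r"
      by (rule lin_ext_cong) (use L False in auto)
    then show ?thesis by (simp add: pm.subspace_0[OF subspace_tnull])
  qed
qed

lemma keys_ecut_decorated:
  assumes "p \<in> Poly_Mapping.keys (ecut S s t)" "decorated X t"
  shows "decorated X (fst p)" "decorated X (snd p)" "tdeg t = tdeg (fst p) + tdeg (snd p)"
  using keys_ecut[of "fst p" "snd p" S s t X, unfolded prod.collapse, OF assms(1)] assms(2) by auto

lemma ecut_above_pos_sum: "ecut_above S s = pos_sum tdeg (ecut S s)"
proof
  show "ecut_above S s t = pos_sum tdeg (ecut S s) t" for t
    by (cases t) simp_all
qed

lemma ecut_null:
  fixes X :: "('k::field, 'p::ab_group_add) collection"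
  assumes "coll X" "v \<in> null X"
  shows "lin (ecut S s) v \<in> tnull X"
proof (rule pos_sum_null[OF assms(1) subspace_tnull _ _ _ _ assms(2), where Q = "decorated X"])
  fix r assume r: "r \<in> drel X"
  have "lin (\<lambda>t. ecut S s t - pos_sum tdeg (ecut S s) t) r = lin (\<lambda>t. if S = set (leaves t) then gen (Leaf s, t) else 0) r"
    by (rule lin_ext_cong) (subst ecut_eq, simp add: ecut_above_pos_sum)
  then show "lin (\<lambda>t. ecut S s t - pos_sum tdeg (ecut S s) t) r \<in> tnull X"
    using ecut_root_tnull[OF assms(1) r] by simp
next
  fix t and p :: "'p tree \<times> 'p tree"
  assume t: "decorated X t" and p: "p \<in> Poly_Mapping.keys (ecut S s t :: _ \<Rightarrow>\<^sub>0 'k)"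
  show "decorated X (fst p) \<and> decorated X (snd p) \<and> even (tdeg (fst p) + tdeg (snd p) - tdeg t)"
    using keys_ecut_decorated[OF p t] by simp
qed (use tnull_left dec_ctx_tnull[OF assms(1)] in auto)

text \<open>The sign is the one with which \<open>ecut\<close> pulls \<open>u\<close> out, so that
  regrafting cancels it. As a sum over positions, and not a substitution, it is zero when the marked
  leaf is absent.\<close>

primrec plug :: "nat \<Rightarrow> 'p tree \<Rightarrow> 'p tree \<Rightarrow> ('p tree \<Rightarrow>\<^sub>0 'k::field)" where
  "plug s u (Leaf j) = (if j = s then gen u else 0)"
| "plug s u (Node e x ts) = (\<Sum>i<length ts. pscale (ksign (tdegs (drop (i + 1) ts) * tdeg u))
      (node_ctx e x (take i ts) (drop (i + 1) ts) (map (plug s u) ts ! i)))"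

lemma plug_Node: "plug s u (Node e x ts) =
    ssum ts (\<lambda>a t b. pscale (ksign (tdegs b * tdeg u)) (node_ctx e x a b (plug s u t)))"
  by (subst ssum_nth[symmetric]) simp

declare plug.simps(2) [simp del] plug_Node [simp]

lemma plug_notin: "s \<notin> set (leaves t) \<Longrightarrow> plug s u t = (0 :: 'p tree \<Rightarrow>\<^sub>0 'k::field)"
proof (induct t)
  case (Node e x ts)
  have "plug s u (Node e x ts) = (ssum ts (\<lambda>a t b. 0) :: 'p tree \<Rightarrow>\<^sub>0 'k)"
    unfolding plug_Node by (rule ssum_cong[OF refl]) (use Node in \<open>auto simp: node_ctx_simps\<close>)
  then show ?case by (simp del: plug_Node)
qed simp

lemma keys_plug:
  "t' \<in> Poly_Mapping.keys (plug s u t :: _ \<Rightarrow>\<^sub>0 'k::field) \<Longrightarrow>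
    tdeg t' = tdeg t + tdeg u \<and> (decorated X t \<longrightarrow> decorated X u \<longrightarrow> decorated X t')"
proof (induct t arbitrary: t')
  case (Leaf j)
  then show ?case by (auto split: if_splits)
next
  case (Node e x ts)
  obtain a t b where ts: "ts = a @ t # b"
    and p: "t' \<in> Poly_Mapping.keys (pscale (ksign (tdegs b * tdeg u)) (node_ctx e x a b (plug s u t)) :: _ \<Rightarrow>\<^sub>0 'k)"
    using subsetD[OF keys_ssum Node(2)[unfolded plug_Node]] by blast
  obtain t1 where t1: "t1 \<in> Poly_Mapping.keys (plug s u t :: _ \<Rightarrow>\<^sub>0 'k)" "t' = Node e x (a @ t1 # b)"
    using subsetD[OF keys_pscale p] unfolding keys_node_ctx by blast
  show ?case using Node(1)[OF _ t1(1)] by (auto simp: ts t1(2))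
qed

lemma subspace_null: "pm.subspace (null X)"
  by simp

lemma plug_null_left:
  fixes X :: "('k::field, 'p::ab_group_add) collection"
  assumes "coll X" "v \<in> null X" "decorated X u"
  shows "lin (plug s u) v \<in> null X"
proof -
  \<comment> \<open>Grafting leaves no remainder, but a trivial one of degree \<open>tdeg u\<close>
    makes \<open>pos_ctx\<close> produce the sign of moving \<open>u\<close> into its place.\<close>
  let ?d = "\<lambda>_. tdeg u" and ?f = "\<lambda>t. lin (\<lambda>t'. gen (t', ())) (plug s u t) :: 'p tree \<times> unit \<Rightarrow>\<^sub>0 'k"
  let ?W = "{v. lin (\<lambda>p. gen (fst p)) v \<in> null X} :: ('p tree \<times> unit \<Rightarrow>\<^sub>0 'k) set"
  have ctx: "lin (\<lambda>p. gen (fst p)) (pos_ctx ?d e x a b v)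
      = pscale (ksign (tdegs b * tdeg u)) (node_ctx e x a b (lin (\<lambda>p. gen (fst p)) v))"
    for e x a b and v :: "'p tree \<times> unit \<Rightarrow>\<^sub>0 'k"
    by (simp add: pos_ctx_def lin_lin lin_simps lin_fun_pscale node_ctx_def)
  have "lin ?f v \<in> ?W"
  proof (rule pos_sum_null[OF assms(1) _ _ _ _ _ assms(2), where Q = "\<lambda>_. True" and dq = ?d])
    show "pm.subspace ?W" by (rule subspace_vimage_lin[OF subspace_null])
    show "v \<otimes>\<^sub>p gen q \<in> ?W" if "v \<in> null X" for v and q :: unit
      using that by (simp add: lin_tensor lin_simps)
    show "decorated X (fst p) \<and> True \<and> even (tdeg (fst p) + tdeg u - tdeg t)"
      if t: "decorated X t" and p: "p \<in> Poly_Mapping.keys (?f t)" for t p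
    proof -
      obtain t' where t': "t' \<in> Poly_Mapping.keys (plug s u t :: _ \<Rightarrow>\<^sub>0 'k)" "p = (t', ())"
        using subsetD[OF keys_lin p] by auto
      show ?thesis using keys_plug[OF t'(1), of X] t'(2) t assms(3) by simp
    qed
    show "pos_ctx ?d e x a b v \<in> ?W"
      if "v \<in> ?W" "x \<in> csp X (length a + 1 + length b) e" "\<forall>t\<in>set (a @ b). decorated X t" for e x a b v
      using that by (simp add: ctx pm.span_scale null_node_ctx)
    show "lin (\<lambda>t. ?f t - pos_sum ?d ?f t) r \<in> ?W" if r: "r \<in> drel X" for r
    proof -
      have "lin (\<lambda>t. ?f t - pos_sum ?d ?f t) r = lin (\<lambda>t. 0) r"
      proof (rule lin_ext_cong)
        fix t assume "t \<in> Poly_Mapping.keys r"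
        then have "twt t > 0" using drel_keys[OF assms(1) r] by blast
        then obtain e x ts where t: "t = Node e x ts" by (cases t) auto
        show "?f t - pos_sum ?d ?f t = 0"
          by (simp add: t lin_ssum lin_simps pos_ctx_def node_ctx_def lin_lin lin_fun_pscale)
      qed
      then show ?thesis by (simp add: pm.span_zero)
    qed
  qed
  then show ?thesis by (simp add: lin_lin lin_simps)
qed

lemma plug_null_right:
  fixes X :: "('k::field, 'p::ab_group_add) collection"
  assumes "coll X" "r \<in> drel X" "decorated X t"
  shows "lin (\<lambda>u. plug s u t) r \<in> null X"
  using assms(3)
proof (induct t)
  case (Leaf j)
  then show ?case using assms(2) by (cases "j = s") (auto simp: pm.span_base pm.span_zero)
next
  case (Node e x ts)
  obtain d where d: "\<forall>t\<in>Poly_Mapping.keys r. tdeg t = d" using drel_tdeg[OF assms(1,2)] .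
  have "lin (\<lambda>u. plug s u (Node e x ts)) r =
      ssum ts (\<lambda>a t b. lin (\<lambda>u. pscale (ksign (tdegs b * tdeg u)) (node_ctx e x a b (plug s u t))) r)"
    by (simp add: lin_fun_ssum)
  also have "\<dots> = ssum ts (\<lambda>a t b. pscale (ksign (tdegs b * d)) (node_ctx e x a b (lin (\<lambda>u. plug s u t) r)))"
  proof (rule ssum_cong[OF refl])
    fix a b :: "'p tree list" and t
    show "lin (\<lambda>u. pscale (ksign (tdegs b * tdeg u)) (node_ctx e x a b (plug s u t))) r
      = pscale (ksign (tdegs b * d)) (node_ctx e x a b (lin (\<lambda>u. plug s u t) r))"
      using lin_const_deg[OF d, of "\<lambda>i. tdegs b * i"] by (simp add: node_ctx_lin)
  qed
  also have "\<dots> \<in> null X"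
    by (intro ssum_in_subspace[OF subspace_null] pm.subspace_scale[OF subspace_null] null_node_ctx Node(1))
      (use Node(2) in auto)
  finally show ?case .
qed

lemma plug_tnull:
  assumes "coll X" "v \<in> tnull X"
  shows "lin (\<lambda>p. plug s (snd p) (fst p)) v \<in> null X"
  by (rule lin_tnull[OF assms(2) subspace_null])
    (auto intro: plug_null_left[OF assms(1)] plug_null_right[OF assms(1)] pm.span_base)

text \<open>The count can exceed one: a vertex with a single child has the same leaves as that
  child.\<close>

primrec vertices_over :: "nat set \<Rightarrow> 'p tree \<Rightarrow> nat" where
  "vertices_over S (Leaf j) = 0"
| "vertices_over S (Node e x ts) =
    (if S = set (leaves (Node e x ts)) then 1 else 0) + sum_list (map (vertices_over S) ts)"

lemma plug_node_only:
  assumes "s \<notin> set (leaves (Node e x (a @ t # b)))"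
  shows "(plug s u (Node e x (a @ l # b)) :: 'p tree \<Rightarrow>\<^sub>0 'k::field) = pscale (ksign (tdegs b * tdeg u)) (node_ctx e x a b (plug s u l))"
proof -
  have "ssum a (\<lambda>a1 t1 b1. pscale (ksign (tdegs (b1 @ l # b) * tdeg u)) (node_ctx e x a1 (b1 @ l # b) (plug s u t1)))
      = (ssum a (\<lambda>a t b. 0) :: 'p tree \<Rightarrow>\<^sub>0 'k)"
    by (rule ssum_cong[OF refl]) (use assms in \<open>auto simp: plug_notin node_ctx_simps\<close>)
  moreover have "ssum b (\<lambda>a1 t1 b1. pscale (ksign (tdegs b1 * tdeg u)) (node_ctx e x (a @ l # a1) b1 (plug s u t1)))
      = (ssum b (\<lambda>a t b. 0) :: 'p tree \<Rightarrow>\<^sub>0 'k)"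
    by (rule ssum_cong[OF refl]) (use assms in \<open>auto simp: plug_notin node_ctx_simps\<close>)
  ultimately show ?thesis by (simp add: ssum_append)
qed

lemma ssum_of_nat:
  "ssum ts (\<lambda>a t b. pscale (of_nat (f t)) v) = pscale (of_nat (sum_list (map f ts))) v"
  by (induct ts) (auto simp: pm.scale_left_distrib)

abbreviation plug_vertex :: "nat \<Rightarrow> 'p tree \<times> 'p tree \<Rightarrow> ('p tree \<Rightarrow>\<^sub>0 'k::field)" where
  "plug_vertex s p \<equiv> (if twt (snd p) > 0 then plug s (snd p) (fst p) else 0)"

text \<open>Cut and regrafting both happen inside one child, and the sign of passing the later
  siblings occurs once in each, hence cancels.\<close>

lemma plug_ecut_above:
  fixes ts :: "'p tree list"
  assumes "\<And>t. t \<in> set ts \<Longrightarrow> lin (plug_vertex s) (ecut S s t)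
      = pscale (of_nat (vertices_over S t)) (gen t :: 'p tree \<Rightarrow>\<^sub>0 'k::field)"
    and "s \<notin> set (leaves (Node e x ts))"
  shows "lin (plug_vertex s) (ecut_above S s (Node e x ts))
    = pscale (of_nat (sum_list (map (vertices_over S) ts))) (gen (Node e x ts) :: 'p tree \<Rightarrow>\<^sub>0 'k)"
proof -
  have "lin (plug_vertex s) (ecut_above S s (Node e x ts))
      = ssum ts (\<lambda>a t b. lin (plug_vertex s) (dec_ctx e x a b (ecut S s t)) :: 'p tree \<Rightarrow>\<^sub>0 'k)"
    by (simp add: lin_ssum)
  also have "\<dots> = ssum ts (\<lambda>a t b. pscale (of_nat (vertices_over S t)) (gen (Node e x ts)))"
  proof (rule ssum_cong[OF refl])
    fix a t b assume ts: "ts = a @ t # b"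
    have "lin (plug_vertex s) (dec_ctx e x a b (ecut S s t))
        = lin (\<lambda>p. node_ctx e x a b (plug_vertex s p :: 'p tree \<Rightarrow>\<^sub>0 'k)) (ecut S s t)"
      unfolding dec_ctx_def lin_lin
      by (rule lin_ext_cong)
        (use assms(2) in \<open>auto simp: lin_simps ts plug_node_only[of s e x a t b] node_ctx_simps simp del: plug_Node\<close>)
    also have "\<dots> = node_ctx e x a b (lin (plug_vertex s) (ecut S s t))"
      by (rule node_ctx_lin[symmetric])
    also have "\<dots> = pscale (of_nat (vertices_over S t)) (gen (Node e x ts))"
      by (simp add: assms(1) ts node_ctx_simps node_ctx_gen)
    finally show "lin (plug_vertex s) (dec_ctx e x a b (ecut S s t)) = \<dots>" .
  qed
  also have "\<dots> = pscale (of_nat (sum_list (map (vertices_over S) ts))) (gen (Node e x ts))"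
    by (rule ssum_of_nat)
  finally show ?thesis .
qed

text \<open>With the root edge included, every vertex over \<open>S\<close> is the root of exactly
  one upper part, and each such cut gives back one copy of the tree.\<close>

lemma plug_ecut:
  "s \<notin> set (leaves t) \<Longrightarrow>
    lin (plug_vertex s) (ecut S s t) = pscale (of_nat (vertices_over S t)) (gen t :: 'p tree \<Rightarrow>\<^sub>0 'k::field)"
proof (induct t)
  case (Leaf j)
  then show ?case by (simp add: ecut_eq lin_simps)
next
  case (Node e x ts)
  let ?T = "Node e x ts"
  have 1: "lin (plug_vertex s) (ecut_above S s ?T)
      = pscale (of_nat (sum_list (map (vertices_over S) ts))) (gen ?T :: 'p tree \<Rightarrow>\<^sub>0 'k)"
    by (rule plug_ecut_above) (use Node in auto)
  show ?case
  proof (cases "S = set (leaves ?T)")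
    case True
    then have "(ecut S s ?T :: _ \<Rightarrow>\<^sub>0 'k) = gen (Leaf s, ?T) + ecut_above S s ?T" "vertices_over S ?T = 1 + sum_list (map (vertices_over S) ts)"
      unfolding ecut_eq[of S s ?T] by simp_all
    moreover have "lin (plug_vertex s) (gen (Leaf s, ?T)) = (gen ?T :: 'p tree \<Rightarrow>\<^sub>0 'k)"
      by (simp add: lin_simps)
    ultimately show ?thesis by (simp only: lin_add 1 of_nat_add of_nat_1 pm.scale_left_distrib pm.scale_one)
  next
    case False
    then have "(ecut S s ?T :: _ \<Rightarrow>\<^sub>0 'k) = 0 + ecut_above S s ?T" "vertices_over S ?T = 0 + sum_list (map (vertices_over S) ts)"
      unfolding ecut_eq[of S s ?T] by simp_all
    then show ?thesis by (simp only: add_0 1)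
  qed
qed

text \<open>Each vertex is counted for exactly one \<open>S\<close>, its own set of leaves.\<close>

lemma sum_vertices_over:
  "finite A \<Longrightarrow> set (leaves t) \<subseteq> A \<Longrightarrow> (\<Sum>S\<in>Pow A. vertices_over S t) = twt t"
proof (induct t)
  case (Node e x ts)
  have "(\<Sum>S\<in>Pow A. sum_list (map (vertices_over S) us)) = sum_list (map twt us)" if "set us \<subseteq> set ts" for us
    using that
  proof (induct us)
    case (Cons u us)
    have "(\<Sum>S\<in>Pow A. vertices_over S u) = twt u"
      using Node(1)[of u] Node(2,3) Cons(2) by auto
    then show ?case using Cons by (simp add: sum.distrib)
  qed simp
  then show ?case using Node(2,3) by (simp add: sum.distrib del: leaves.simps)
qed simp

text \<open>Every edge with vertices at both ends is cut for exactly one set of leaves, so regluing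
  all cuts multiplies a tree by its number of inner edges. In characteristic zero this
  shows that an element of weight at least two is determined by its reduced decompositions.\<close>

lemma sum_plug_ecut:
  fixes t :: "'p tree"
  assumes "finite A" "set (leaves t) \<subseteq> A" "s \<notin> A"
  shows "(\<Sum>S\<in>Pow A. lin (\<lambda>p. if twt (fst p) > 0 \<and> twt (snd p) > 0 then plug s (snd p) (fst p) else 0) (ecut S s t))
    = pscale (of_nat (twt t - 1)) (gen t :: 'p tree \<Rightarrow>\<^sub>0 'k::field)"
proof (cases t)
  case (Leaf j)
  then have "lin (\<lambda>p. if twt (fst p) > 0 \<and> twt (snd p) > 0 then plug s (snd p) (fst p) else 0) (ecut S s t)
      = (0 :: 'p tree \<Rightarrow>\<^sub>0 'k)" for S
    by (cases "S = {j}") (simp_all add: ecut_eq lin_simps)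
  then show ?thesis using Leaf by simp
next
  case (Node e x ts)
  let ?f = "\<lambda>p. if twt (fst p) > 0 \<and> twt (snd p) > 0 then plug s (snd p) (fst p) else 0 :: 'p tree \<Rightarrow>\<^sub>0 'k"
  \<comment> \<open>Asking for a vertex below the cut drops only the root edge, so the vertices
    other than the root are counted, one for each inner edge.\<close>
  have "lin ?f (ecut S s t) = pscale (of_nat (sum_list (map (vertices_over S) ts))) (gen t)" for S
  proof -
    have "lin ?f (ecut_above S s t) = lin (plug_vertex s) (ecut_above S s t)"
    proof (rule lin_ext_cong)
      fix p assume "p \<in> Poly_Mapping.keys (ecut_above S s t :: _ \<Rightarrow>\<^sub>0 'k)"
      then obtain a t b where p: "p \<in> Poly_Mapping.keys (dec_ctx e x a b (ecut S s t) :: _ \<Rightarrow>\<^sub>0 'k)"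
        using keys_ssum[of ts "\<lambda>a t b. dec_ctx e x a b (ecut S s t) :: _ \<Rightarrow>\<^sub>0 'k"] unfolding Node by auto
      obtain l where "fst p = Node e x (a @ l # b)" using keys_dec_ctx[OF p] by auto
      then show "?f p = plug_vertex s p" by simp
    qed
    also have "\<dots> = pscale (of_nat (sum_list (map (vertices_over S) ts))) (gen t)"
      unfolding Node by (rule plug_ecut_above, rule plug_ecut) (use assms Node in auto)
    finally show ?thesis
      unfolding ecut_eq[of S s t] lin_add by (cases "S = set (leaves t)") (simp_all add: lin_simps)
  qed
  then have "(\<Sum>S\<in>Pow A. lin ?f (ecut S s t)) = pscale (of_nat (\<Sum>S\<in>Pow A. sum_list (map (vertices_over S) ts))) (gen t)"
    by (simp add: pm.scale_sum_left)
  also have "(\<Sum>S\<in>Pow A. sum_list (map (vertices_over S) ts)) = twt t - 1"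
    using sum_vertices_over[OF assms(1,2)] assms(1,2) unfolding Node
    by (simp add: sum.distrib del: leaves.simps)
  finally show ?thesis .
qed

section \<open>The bar differential\<close>

text \<open>\<open>contract_child\<close> with the position replaced by the two lists of siblings,
  in the form in which \<open>ssum\<close> presents it.\<close>

primrec contract :: "('k, 'p) wg_operad \<Rightarrow> int \<Rightarrow> 'p \<Rightarrow> 'p tree list \<Rightarrow> 'p tree list \<Rightarrow> 'p tree
    \<Rightarrow> ('p tree \<Rightarrow>\<^sub>0 'k::field)" where
  "contract P e x a b (Leaf l) = 0"
| "contract P e x a b (Node f y us) = pscale (ksign (f * tdegs a + (e - 1)))
    (gen (Node (e + f - 1) (pcomp P (length a + 1 + length b) (length us) (length a) x y) (a @ us @ b)))"

definition bar_at :: "('k, 'p) wg_operad \<Rightarrow> int \<Rightarrow> 'p \<Rightarrow> 'p tree list \<Rightarrow> 'p tree list \<Rightarrow> 'p tree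
    \<Rightarrow> ('p tree \<Rightarrow>\<^sub>0 'k::field)" where
  "bar_at P e x a b t =
    contract P e x a b t + pscale (ksign (e + tdegs a)) (node_ctx e x a b (bar_tree P t))"

lemma bar_tree_Node: "bar_tree P (Node e x ts) = ssum ts (\<lambda>a t b. bar_at P e x a b t)"
proof -
  have "contract_child P e x ts i (ts ! i) = contract P e x (take i ts) (drop (i + 1) ts) (ts ! i)"
    if "i < length ts" for i
  proof -
    have "length (take i ts) + 1 + length (drop (i + 1) ts) = length ts" "length (take i ts) = i" using that by auto
    then show ?thesis by (cases "ts ! i") (simp_all only: contract_child.simps contract.simps)
  qed
  then have "bar_tree P (Node e x ts) = (\<Sum>i<length ts. bar_at P e x (take i ts) (drop (i + 1) ts) (ts ! i))"
    by (simp add: bar_at_def node_ctx_def)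
  also have "\<dots> = ssum ts (\<lambda>a t b. bar_at P e x a b t)"
    by (rule ssum_nth)
  finally show ?thesis .
qed

declare bar_tree.simps(2) [simp del] bar_tree_Node [simp]

lemma ksign_cong: "even (a - b) \<Longrightarrow> ksign a = ksign b"
  by (simp add: ksign_def)

lemma keys_contract:
  "t' \<in> Poly_Mapping.keys (contract P e x a b t) \<Longrightarrow>
    \<exists>f y us. t = Node f y us \<and>
      t' = Node (e + f - 1) (pcomp P (length a + 1 + length b) (length us) (length a) x y) (a @ us @ b)"
  by (cases t) (auto dest!: subsetD[OF keys_pscale])

lemma keys_bar_at:
  assumes "t' \<in> Poly_Mapping.keys (bar_at P e x a b t)"
  shows "t' \<in> Poly_Mapping.keys (contract P e x a b t) \<or>
    (\<exists>t1\<in>Poly_Mapping.keys (bar_tree P t). t' = Node e x (a @ t1 # b))"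
proof -
  have "t' \<in> Poly_Mapping.keys (contract P e x a b t) \<union>
      Poly_Mapping.keys (pscale (ksign (e + tdegs a)) (node_ctx e x a b (bar_tree P t)))"
    using subsetD[OF Poly_Mapping.keys_add assms[unfolded bar_at_def]] .
  then show ?thesis using subsetD[OF keys_pscale] unfolding keys_node_ctx[symmetric]
    by (metis (no_types, lifting) Un_iff imageE keys_node_ctx)
qed

lemma keys_bar_tree:
  "t' \<in> Poly_Mapping.keys (bar_tree P t) \<Longrightarrow>
    leaves t' = leaves t \<and> tdeg t' = tdeg t - 1 \<and> Suc (twt t') = twt t"
proof (induct t arbitrary: t')
  case (Node e x ts)
  obtain a t b where ts: "ts = a @ t # b" and t': "t' \<in> Poly_Mapping.keys (bar_at P e x a b t)"
    using subsetD[OF keys_ssum Node(2)[unfolded bar_tree_Node]] by blast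
  show ?case
    using keys_bar_at[OF t']
  proof
    assume "t' \<in> Poly_Mapping.keys (contract P e x a b t)"
    then show ?thesis by (auto simp: ts dest!: keys_contract)
  next
    assume "\<exists>t1\<in>Poly_Mapping.keys (bar_tree P t). t' = Node e x (a @ t1 # b)"
    then obtain t1 where t1: "t1 \<in> Poly_Mapping.keys (bar_tree P t)" "t' = Node e x (a @ t1 # b)" by blast
    show ?thesis using Node(1)[OF _ t1(1)] by (auto simp: ts t1(2))
  qed
qed simp

abbreviation bar_pair :: "('k, 'p) wg_operad \<Rightarrow> 'p tree \<times> 'p tree \<Rightarrow> ('p tree \<times> 'p tree \<Rightarrow>\<^sub>0 'k::field)" where
  "bar_pair P p \<equiv> bar_tree P (fst p) \<otimes>\<^sub>p gen (snd p)
    + pscale (ksign (tdeg (fst p))) (gen (fst p) \<otimes>\<^sub>p bar_tree P (snd p))"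

lemma dec_ctx_gen: "dec_ctx e x a b (gen p) =
    pscale (ksign (tdegs b * tdeg (snd p))) (gen (Node e x (a @ fst p # b)) \<otimes>\<^sub>p gen (snd p))"
  by (simp add: dec_ctx_def lin_simps tensor_gen)

lemma dec_ctx_pscale: "dec_ctx e x a b (pscale c v) = pscale c (dec_ctx e x a b v)"
  by (simp add: dec_ctx_def lin_simps)

lemma dec_ctx_lin: "dec_ctx e x a b (lin f v) = lin (\<lambda>q. dec_ctx e x a b (f q)) v"
  by (simp add: dec_ctx_def lin_lin)

lemma dec_ctx_alt: "dec_ctx e x a b v = lin (\<lambda>p. pscale (ksign (tdegs b * tdeg (snd p)))
    (gen (Node e x (a @ fst p # b)) \<otimes>\<^sub>p gen (snd p))) v"
  by (simp add: dec_ctx_def tensor_gen)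

text \<open>The cut is made to the left of the contracted child. On one side \<open>f\<close> passes
  the upper part, on the other the upper part passes \<open>f\<close>; both contribute
  \<open>f * tdeg (snd p)\<close>.\<close>

lemma cut_contract_left:
  assumes p: "p \<in> Poly_Mapping.keys (ecut S s t1 :: _ \<Rightarrow>\<^sub>0 'k::field)"
  shows "pscale (ksign (f * tdegs (a1 @ t1 # b1) + (e - 1)))
      (pscale (ksign (tdegs (b1 @ us @ b) * tdeg (snd p))) v)
    = pscale (ksign (tdegs (b1 @ Node f y us # b) * tdeg (snd p)))
      (pscale (ksign (f * tdegs (a1 @ fst p # b1) + (e - 1)) :: 'k) v)"
proof -
  have "tdeg t1 = tdeg (fst p) + tdeg (snd p)" using keys_ecut[of "fst p" "snd p"] p by (metis prod.collapse)
  then show ?thesis by (simp add: ksign_add[symmetric] algebra_simps)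
qed

text \<open>The edges that remain after contraction lie in the siblings or inside \<open>t\<close>.
  The contracted edge itself can no longer be cut; on the right its cut drops out because
  \<open>contract\<close> vanishes on the leaf that it leaves behind.\<close>

lemma ecut_above_contract:
  "lin (ecut_above S s) (contract P e x a b t :: 'p tree \<Rightarrow>\<^sub>0 'k::field) =
    ssum a (\<lambda>a1 t1 b1. lin (\<lambda>p. pscale (ksign (tdegs (b1 @ t # b) * tdeg (snd p)))
        (contract P e x (a1 @ fst p # b1) b t \<otimes>\<^sub>p gen (snd p))) (ecut S s t1))
    + lin (\<lambda>p. pscale (ksign (tdegs b * tdeg (snd p))) (contract P e x a b (fst p) \<otimes>\<^sub>p gen (snd p))) (ecut S s t)
    + ssum b (\<lambda>a1 t1 b1. lin (\<lambda>p. pscale (ksign (tdegs b1 * tdeg (snd p)))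
        (contract P e x a (a1 @ fst p # b1) t \<otimes>\<^sub>p gen (snd p))) (ecut S s t1))"
proof (cases t)
  case (Leaf j)
  then show ?thesis by (cases "S = {j}") (simp_all add: ecut_eq tensor_simps lin_simps)
next
  case (Node f y us)
  let ?z = "pcomp P (length a + 1 + length b) (length us) (length a) x y"
  let ?s = "ksign (f * tdegs a + (e - 1)) :: 'k"
  have 1: "pscale ?s (ssum a (\<lambda>a1 t1 b1. dec_ctx (e + f - 1) ?z a1 (b1 @ us @ b) (ecut S s t1)))
    = ssum a (\<lambda>a1 t1 b1. lin (\<lambda>p. pscale (ksign (tdegs (b1 @ t # b) * tdeg (snd p)))
        (contract P e x (a1 @ fst p # b1) b t \<otimes>\<^sub>p gen (snd p))) (ecut S s t1))"
    unfolding pscale_ssum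
  proof (rule ssum_cong[OF refl])
    fix a1 t1 b1 assume a: "a = a1 @ t1 # b1"
    show "pscale ?s (dec_ctx (e + f - 1) ?z a1 (b1 @ us @ b) (ecut S s t1))
      = lin (\<lambda>p. pscale (ksign (tdegs (b1 @ t # b) * tdeg (snd p)))
        (contract P e x (a1 @ fst p # b1) b t \<otimes>\<^sub>p gen (snd p))) (ecut S s t1)"
      unfolding dec_ctx_alt lin_fun_pscale[symmetric]
    proof (rule lin_ext_cong)
      fix p assume p: "p \<in> Poly_Mapping.keys (ecut S s t1 :: _ \<Rightarrow>\<^sub>0 'k)"
      show "pscale ?s (pscale (ksign (tdegs (b1 @ us @ b) * tdeg (snd p)))
          (gen (Node (e + f - 1) ?z (a1 @ fst p # b1 @ us @ b)) \<otimes>\<^sub>p gen (snd p)))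
        = pscale (ksign (tdegs (b1 @ t # b) * tdeg (snd p)))
          (contract P e x (a1 @ fst p # b1) b t \<otimes>\<^sub>p gen (snd p))"
        unfolding a Node cut_contract_left[OF p, of f a1 b1 e us b _ y]
        by (simp add: tensor_simps)
    qed
  qed
  have 2: "pscale ?s (ssum b (\<lambda>a1 t1 b1. dec_ctx (e + f - 1) ?z (a @ us @ a1) b1 (ecut S s t1)))
    = ssum b (\<lambda>a1 t1 b1. lin (\<lambda>p. pscale (ksign (tdegs b1 * tdeg (snd p)))
        (contract P e x a (a1 @ fst p # b1) t \<otimes>\<^sub>p gen (snd p))) (ecut S s t1))"
    unfolding pscale_ssum
    by (rule ssum_cong[OF refl])
      (simp add: dec_ctx_alt lin_fun_pscale[symmetric] Node tensor_simps mult.commute)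
  have 3: "pscale ?s (ssum us (\<lambda>a1 t1 b1. dec_ctx (e + f - 1) ?z (a @ a1) (b1 @ b) (ecut S s t1)))
    = lin (\<lambda>p. pscale (ksign (tdegs b * tdeg (snd p))) (contract P e x a b (fst p) \<otimes>\<^sub>p gen (snd p))) (ecut S s t)"
      (is "?l = lin ?g _")
  proof -
    have "lin ?g (ecut S s t) = lin ?g (ecut_above S s t)"
      unfolding ecut_eq[of S s t] lin_add by (cases "S = set (leaves t)") (simp_all add: lin_simps tensor_simps)
    also have "\<dots> = ssum us (\<lambda>a1 t1 b1. lin ?g (dec_ctx f y a1 b1 (ecut S s t1)))"
      by (simp add: Node lin_ssum)
    also have "\<dots> = ?l"
      unfolding pscale_ssum
    proof (rule ssum_cong[OF refl])
      fix a1 t1 b1 assume us: "us = a1 @ t1 # b1"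
      have "lin ?g (dec_ctx f y a1 b1 (ecut S s t1)) = lin (\<lambda>p. pscale ?s
          (pscale (ksign (tdegs (b1 @ b) * tdeg (snd p))) (gen (Node (e + f - 1) ?z (a @ a1 @ fst p # b1 @ b)) \<otimes>\<^sub>p gen (snd p))))
          (ecut S s t1)"
        unfolding dec_ctx_def lin_lin
        by (rule lin_ext_cong)
          (simp add: lin_simps us tensor_simps tensor_gen ksign_add[symmetric] algebra_simps)
      then show "lin ?g (dec_ctx f y a1 b1 (ecut S s t1))
          = pscale ?s (dec_ctx (e + f - 1) ?z (a @ a1) (b1 @ b) (ecut S s t1))"
        by (simp add: dec_ctx_alt lin_fun_pscale del: pm.scale_scale)
    qed
    finally show ?thesis by simp
  qed
  have "lin (ecut_above S s) (contract P e x a b t)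
    = pscale ?s (ssum a (\<lambda>a1 t1 b1. dec_ctx (e + f - 1) ?z a1 (b1 @ us @ b) (ecut S s t1)))
     + pscale ?s (ssum us (\<lambda>a1 t1 b1. dec_ctx (e + f - 1) ?z (a @ a1) (b1 @ b) (ecut S s t1)))
     + pscale ?s (ssum b (\<lambda>a1 t1 b1. dec_ctx (e + f - 1) ?z (a @ us @ a1) b1 (ecut S s t1)))"
    by (simp add: Node lin_simps ssum_append pm.scale_right_distrib add.assoc)
  then show ?thesis unfolding 1 2 3 .
qed

text \<open>Companion of \<open>ecut_above_contract\<close> for the terms of the differential inside
  the child \<open>t\<close>; its middle term is where the induction hypothesis of the Leibniz rule
  enters.\<close>

lemma ecut_above_node_ctx_bar:
  fixes t :: "'p tree"
  shows "pscale (ksign (e + tdegs a)) (lin (ecut_above S s) (node_ctx e x a b (bar_tree P t :: 'p tree \<Rightarrow>\<^sub>0 'k::field))) =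
    ssum a (\<lambda>a1 t1 b1. lin (\<lambda>p. pscale (ksign (tdegs (b1 @ t # b) * tdeg (snd p)))
        (pscale (ksign (e + tdegs (a1 @ fst p # b1))) (node_ctx e x (a1 @ fst p # b1) b (bar_tree P t)) \<otimes>\<^sub>p gen (snd p))) (ecut S s t1))
    + pscale (ksign (e + tdegs a)) (dec_ctx e x a b (lin (ecut S s) (bar_tree P t)))
    + ssum b (\<lambda>a1 t1 b1. lin (\<lambda>p. pscale (ksign (tdegs b1 * tdeg (snd p)))
        (pscale (ksign (e + tdegs a)) (node_ctx e x a (a1 @ fst p # b1) (bar_tree P t)) \<otimes>\<^sub>p gen (snd p))) (ecut S s t1))"
proof -
  let ?s = "ksign (e + tdegs a) :: 'k"
  have d: "\<forall>t'\<in>Poly_Mapping.keys (bar_tree P t). tdeg t' = tdeg t - 1" using keys_bar_tree by blast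
  have 1: "pscale ?s (lin (\<lambda>t. ssum a (\<lambda>a1 t1 b1. dec_ctx e x a1 (b1 @ t # b) (ecut S s t1))) (bar_tree P t))
    = ssum a (\<lambda>a1 t1 b1. lin (\<lambda>p. pscale (ksign (tdegs (b1 @ t # b) * tdeg (snd p)))
        (pscale (ksign (e + tdegs (a1 @ fst p # b1))) (node_ctx e x (a1 @ fst p # b1) b (bar_tree P t)) \<otimes>\<^sub>p gen (snd p))) (ecut S s t1))"
    unfolding lin_fun_ssum pscale_ssum
  proof (rule ssum_cong[OF refl])
    fix a1 t1 b1 assume a: "a = a1 @ t1 # b1"
    have "pscale ?s (lin (\<lambda>t'. dec_ctx e x a1 (b1 @ t' # b) (ecut S s t1)) (bar_tree P t))
      = lin (\<lambda>p. pscale ?s (lin (\<lambda>t'. pscale (ksign (tdegs (b1 @ t' # b) * tdeg (snd p)))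
              (gen (Node e x (a1 @ fst p # b1 @ t' # b)) \<otimes>\<^sub>p gen (snd p))) (bar_tree P t))) (ecut S s t1)"
      unfolding dec_ctx_alt lin_fun_pscale by (subst lin_swap) simp
    also have "\<dots> = lin (\<lambda>p. pscale (ksign (tdegs (b1 @ t # b) * tdeg (snd p)))
        (pscale (ksign (e + tdegs (a1 @ fst p # b1))) (node_ctx e x (a1 @ fst p # b1) b (bar_tree P t)) \<otimes>\<^sub>p gen (snd p))) (ecut S s t1)"
    proof (rule lin_ext_cong)
      fix p assume p: "p \<in> Poly_Mapping.keys (ecut S s t1 :: _ \<Rightarrow>\<^sub>0 'k)"
      have t1: "tdeg t1 = tdeg (fst p) + tdeg (snd p)" using keys_ecut[of "fst p" "snd p"] p by (metis prod.collapse)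
      have "lin (\<lambda>t'. pscale (ksign (tdegs (b1 @ t' # b) * tdeg (snd p)))
              (gen (Node e x (a1 @ fst p # b1 @ t' # b)) \<otimes>\<^sub>p gen (snd p))) (bar_tree P t)
          = pscale (ksign ((tdegs b1 + (tdeg t - 1) + tdegs b) * tdeg (snd p)))
            (node_ctx e x (a1 @ fst p # b1) b (bar_tree P t) \<otimes>\<^sub>p gen (snd p))"
        using lin_const_deg[OF d, of "\<lambda>i. (tdegs b1 + i + tdegs b) * tdeg (snd p)"]
        by (simp add: node_ctx_def tensor_lin_left add.assoc)
      \<comment> \<open>The upper part passes a tree whose degree has dropped by one; this is
        compensated by the differential, which passes the upper part only when it is applied before
        the cut.\<close>
      then show "pscale ?s (lin (\<lambda>t'. pscale (ksign (tdegs (b1 @ t' # b) * tdeg (snd p)))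
              (gen (Node e x (a1 @ fst p # b1 @ t' # b)) \<otimes>\<^sub>p gen (snd p))) (bar_tree P t))
        = pscale (ksign (tdegs (b1 @ t # b) * tdeg (snd p)))
        (pscale (ksign (e + tdegs (a1 @ fst p # b1))) (node_ctx e x (a1 @ fst p # b1) b (bar_tree P t)) \<otimes>\<^sub>p gen (snd p))"
        by (simp add: t1 a tensor_simps ksign_add[symmetric] algebra_simps)
    qed
    finally show "pscale ?s (lin (\<lambda>t'. dec_ctx e x a1 (b1 @ t' # b) (ecut S s t1)) (bar_tree P t)) = \<dots>" .
  qed
  have 2: "pscale ?s (lin (\<lambda>t'. ssum b (\<lambda>a1 t1 b1. dec_ctx e x (a @ t' # a1) b1 (ecut S s t1))) (bar_tree P t))
    = ssum b (\<lambda>a1 t1 b1. lin (\<lambda>p. pscale (ksign (tdegs b1 * tdeg (snd p)))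
        (pscale ?s (node_ctx e x a (a1 @ fst p # b1) (bar_tree P t)) \<otimes>\<^sub>p gen (snd p))) (ecut S s t1))"
    unfolding lin_fun_ssum pscale_ssum
  proof (rule ssum_cong[OF refl])
    fix a1 t1 b1 assume b: "b = a1 @ t1 # b1"
    have "pscale ?s (lin (\<lambda>t'. dec_ctx e x (a @ t' # a1) b1 (ecut S s t1)) (bar_tree P t))
      = lin (\<lambda>p. pscale ?s (lin (\<lambda>t'. pscale (ksign (tdegs b1 * tdeg (snd p)))
              (gen (Node e x (a @ t' # a1 @ fst p # b1)) \<otimes>\<^sub>p gen (snd p))) (bar_tree P t))) (ecut S s t1)"
      unfolding dec_ctx_alt lin_fun_pscale by (subst lin_swap) (simp add: lin_fun_pscale)
    then show "pscale ?s (lin (\<lambda>t'. dec_ctx e x (a @ t' # a1) b1 (ecut S s t1)) (bar_tree P t))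
      = lin (\<lambda>p. pscale (ksign (tdegs b1 * tdeg (snd p)))
        (pscale ?s (node_ctx e x a (a1 @ fst p # b1) (bar_tree P t)) \<otimes>\<^sub>p gen (snd p))) (ecut S s t1)"
      by (simp add: node_ctx_def tensor_lin_left tensor_simps lin_fun_pscale mult.commute)
  qed
  have "lin (ecut_above S s) (node_ctx e x a b (bar_tree P t)) =
      lin (\<lambda>t'. ssum a (\<lambda>a1 t1 b1. dec_ctx e x a1 (b1 @ t' # b) (ecut S s t1))) (bar_tree P t)
      + dec_ctx e x a b (lin (ecut S s) (bar_tree P t))
      + lin (\<lambda>t'. ssum b (\<lambda>a1 t1 b1. dec_ctx e x (a @ t' # a1) b1 (ecut S s t1))) (bar_tree P t)"
    by (simp add: lin_node_ctx ssum_append lin_fun_add dec_ctx_lin add.assoc)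
  then show ?thesis unfolding 1[symmetric] 2[symmetric] by (simp add: pm.scale_right_distrib)
qed

text \<open>Both sides are double sums over children, one child being cut and the other
  differentiated or contracted into the root. They are matched by exchanging the summations and
  comparing the terms at a single child.\<close>

lemma bar_leibniz_above:
  fixes ts :: "'p tree list"
  assumes IH: "\<And>t. t \<in> set ts \<Longrightarrow> lin (ecut S s) (bar_tree P t) = (lin (bar_pair P) (ecut S s t) :: _ \<Rightarrow>\<^sub>0 'k::field)"
  shows "lin (ecut_above S s) (bar_tree P (Node e x ts)) = (lin (bar_pair P) (ecut_above S s (Node e x ts)) :: _ \<Rightarrow>\<^sub>0 'k)"
proof -
  \<comment> \<open>In \<open>L\<close> the cut child precedes the differentiated one, in
    \<open>R\<close> it follows. \<open>M\<close> collects the terms with both at the same child,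
    including the differential of the upper part.\<close>
  define L where "L a1 t1 b1 t b = lin (\<lambda>p. pscale (ksign (tdegs (b1 @ t # b) * tdeg (snd p)))
        (bar_at P e x (a1 @ fst p # b1) b t \<otimes>\<^sub>p gen (snd p))) (ecut S s t1 :: _ \<Rightarrow>\<^sub>0 'k)" for a1 t1 b1 t b
  define R where "R a t a1 t1 b1 = lin (\<lambda>p. pscale (ksign (tdegs b1 * tdeg (snd p)))
        (bar_at P e x a (a1 @ fst p # b1) t \<otimes>\<^sub>p gen (snd p))) (ecut S s t1 :: _ \<Rightarrow>\<^sub>0 'k)" for a t a1 t1 b1
  define M where "M a t b = lin (\<lambda>p. pscale (ksign (tdegs b * tdeg (snd p)))
        (bar_at P e x a b (fst p) \<otimes>\<^sub>p gen (snd p)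
        + pscale (ksign (e + tdegs (a @ fst p # b))) (gen (Node e x (a @ fst p # b)) \<otimes>\<^sub>p bar_tree P (snd p))))
      (ecut S s t :: _ \<Rightarrow>\<^sub>0 'k)" for a t b
  have 1: "lin (ecut_above S s) (bar_at P e x a b t) =
      ssum a (\<lambda>a1 t1 b1. L a1 t1 b1 t b) + M a t b + ssum b (\<lambda>a1 t1 b1. R a t a1 t1 b1)" if t: "t \<in> set ts" for a t b
  proof -
    have "pscale (ksign (e + tdegs a)) (dec_ctx e x a b (lin (ecut S s) (bar_tree P t)))
        = lin (\<lambda>p. pscale (ksign (tdegs b * tdeg (snd p)))
          (pscale (ksign (e + tdegs a)) (node_ctx e x a b (bar_tree P (fst p))) \<otimes>\<^sub>p gen (snd p)
          + pscale (ksign (e + tdegs (a @ fst p # b))) (gen (Node e x (a @ fst p # b)) \<otimes>\<^sub>p bar_tree P (snd p)))) (ecut S s t :: _ \<Rightarrow>\<^sub>0 'k)"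
      unfolding IH[OF t] dec_ctx_lin lin_fun_pscale[symmetric]
    proof (rule lin_ext_cong)
      fix p :: "'p tree \<times> 'p tree"
      have "dec_ctx e x a b (bar_tree P (fst p) \<otimes>\<^sub>p gen (snd p))
          = pscale (ksign (tdegs b * tdeg (snd p)) :: 'k) (node_ctx e x a b (bar_tree P (fst p)) \<otimes>\<^sub>p gen (snd p))"
        by (subst tensor_left) (simp add: dec_ctx_lin tensor_gen dec_ctx_gen node_ctx_def tensor_lin_left lin_fun_pscale)
      moreover have d: "\<forall>t'\<in>Poly_Mapping.keys (bar_tree P (snd p)). tdeg t' = tdeg (snd p) - 1"
        using keys_bar_tree by blast
      \<comment> \<open>The upper part has lost one degree before passing \<open>b\<close>; the
        missing \<open>tdegs b\<close> reappears as the differential passing \<open>b\<close> on the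
        other side.\<close>
      have "dec_ctx e x a b (gen (fst p) \<otimes>\<^sub>p bar_tree P (snd p))
          = pscale (ksign (tdegs b * (tdeg (snd p) - 1)) :: 'k) (gen (Node e x (a @ fst p # b)) \<otimes>\<^sub>p bar_tree P (snd p))"
        using lin_const_deg[OF d, of "\<lambda>i. tdegs b * i" "\<lambda>u. gen (Node e x (a @ fst p # b), u)"]
        by (subst (1 2) tensor_right) (simp add: tensor_gen dec_ctx_lin dec_ctx_gen)
      ultimately show "pscale (ksign (e + tdegs a)) (dec_ctx e x a b (bar_pair P p))
        = pscale (ksign (tdegs b * tdeg (snd p)))
          (pscale (ksign (e + tdegs a)) (node_ctx e x a b (bar_tree P (fst p))) \<otimes>\<^sub>p gen (snd p)
          + pscale (ksign (e + tdegs (a @ fst p # b)) :: 'k) (gen (Node e x (a @ fst p # b)) \<otimes>\<^sub>p bar_tree P (snd p)))"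
        using ksign_cong[where ?'a = 'k, of "e + tdegs a + tdeg (fst p) + tdegs b * (tdeg (snd p) - 1)"
            "tdegs b * tdeg (snd p) + (e + tdegs (a @ fst p # b))"]
        by (simp add: dec_ctx_simps dec_ctx_pscale tensor_simps pm.scale_right_distrib ksign_add[symmetric] algebra_simps)
    qed
    then show ?thesis
      unfolding bar_at_def L_def R_def M_def lin_add lin_pscale ecut_above_contract ecut_above_node_ctx_bar
        tensor_simps(1) pm.scale_right_distrib lin_fun_add ssum_add
      by (simp add: algebra_simps)
  qed
  have 2: "lin (bar_pair P) (dec_ctx e x a b (ecut S s t)) =
      ssum a (\<lambda>a1 t1 b1. R a1 t1 b1 t b) + M a t b + ssum b (\<lambda>a1 t1 b1. L a t a1 t1 b1)" for a t b
  proof -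
    have "lin (bar_pair P) (dec_ctx e x a b (ecut S s t)) =
      lin (\<lambda>p. ssum a (\<lambda>a1 t1 b1. pscale (ksign (tdegs b * tdeg (snd p))) (bar_at P e x a1 (b1 @ fst p # b) t1 \<otimes>\<^sub>p gen (snd p)))
        + pscale (ksign (tdegs b * tdeg (snd p))) (bar_at P e x a b (fst p) \<otimes>\<^sub>p gen (snd p)
        + pscale (ksign (e + tdegs (a @ fst p # b))) (gen (Node e x (a @ fst p # b)) \<otimes>\<^sub>p bar_tree P (snd p)))
        + ssum b (\<lambda>a1 t1 b1. pscale (ksign (tdegs b * tdeg (snd p))) (bar_at P e x (a @ fst p # a1) b1 t1 \<otimes>\<^sub>p gen (snd p))))
      (ecut S s t :: _ \<Rightarrow>\<^sub>0 'k)"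
      unfolding dec_ctx_def lin_lin
    proof (rule lin_ext_cong)
      fix p :: "'p tree \<times> 'p tree"
      have t: "ssum us G \<otimes>\<^sub>p gen (snd p) = ssum us (\<lambda>a t b. G a t b \<otimes>\<^sub>p (gen (snd p) :: _ \<Rightarrow>\<^sub>0 'k))" for us G
        by (rule ssum_hom) (auto simp: tensor_simps)
      show "lin (bar_pair P) (pscale (ksign (tdegs b * tdeg (snd p))) (gen (Node e x (a @ fst p # b), snd p))) =
        ssum a (\<lambda>a1 t1 b1. pscale (ksign (tdegs b * tdeg (snd p))) (bar_at P e x a1 (b1 @ fst p # b) t1 \<otimes>\<^sub>p gen (snd p)))
        + pscale (ksign (tdegs b * tdeg (snd p))) (bar_at P e x a b (fst p) \<otimes>\<^sub>p gen (snd p)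
        + pscale (ksign (e + tdegs (a @ fst p # b))) (gen (Node e x (a @ fst p # b)) \<otimes>\<^sub>p bar_tree P (snd p)))
        + ssum b (\<lambda>a1 t1 b1. pscale (ksign (tdegs b * tdeg (snd p)) :: 'k) (bar_at P e x (a @ fst p # a1) b1 t1 \<otimes>\<^sub>p gen (snd p)))"
        by (simp add: lin_simps ssum_append tensor_simps t pscale_ssum[symmetric] pm.scale_right_distrib del: pm.scale_scale)
    qed
    moreover have "ssum b (\<lambda>a1 t1 b1. lin (\<lambda>p. pscale (ksign (tdegs b * tdeg (snd p)))
        (bar_at P e x (a @ fst p # a1) b1 t1 \<otimes>\<^sub>p gen (snd p))) (ecut S s t))
      = ssum b (\<lambda>a1 t1 b1. L a t a1 t1 b1)"
      by (rule ssum_cong[OF refl]) (simp add: L_def)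
    ultimately show ?thesis unfolding lin_fun_add lin_fun_ssum by (simp only: R_def M_def lin_fun_add)
  qed
  have "lin (ecut_above S s) (bar_tree P (Node e x ts)) = ssum ts (\<lambda>a t b.
      ssum a (\<lambda>a1 t1 b1. L a1 t1 b1 t b) + M a t b + ssum b (\<lambda>a1 t1 b1. R a t a1 t1 b1))"
    unfolding bar_tree_Node lin_ssum by (rule ssum_cong[OF refl], rule 1) simp
  also have "\<dots> = ssum ts (\<lambda>a t b.
      ssum a (\<lambda>a1 t1 b1. R a1 t1 b1 t b) + M a t b + ssum b (\<lambda>a1 t1 b1. L a t a1 t1 b1))"
    \<comment> \<open>One side is indexed first by the differentiated child, the other first by the
      cut child.\<close>
    unfolding ssum_add ssum_swap[of ts L] ssum_swap[of ts R] by simp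
  also have "\<dots> = lin (bar_pair P) (ecut_above S s (Node e x ts))"
    unfolding 2[symmetric] by (simp add: lin_ssum)
  finally show ?thesis .
qed

text \<open>The coderivation property, for each set of leaves separately. The root edge needs no
  sign argument: the differential keeps the leaves, vanishes on the lower part, which is a bare
  leaf, and that leaf has degree zero.\<close>

lemma bar_leibniz:
  fixes t :: "'p tree"
  shows "lin (ecut S s) (bar_tree P t) = (lin (bar_pair P) (ecut S s t) :: _ \<Rightarrow>\<^sub>0 'k::field)"
proof (induct t)
  case (Leaf j)
  then show ?case by (cases "S = {j}") (simp_all add: ecut_eq lin_simps tensor_simps)
next
  case (Node e x ts)
  let ?T = "Node e x ts"
  let ?root = "\<lambda>t. if S = set (leaves t) then gen (Leaf s, t) else 0"
  have "lin ?root (bar_tree P ?T) = lin (\<lambda>t. if S = set (leaves ?T) then gen (Leaf s :: 'p tree) \<otimes>\<^sub>p gen t else 0) (bar_tree P ?T)"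
    by (rule lin_ext_cong) (use keys_bar_tree[of _ P ?T] in \<open>simp only: tensor_gen\<close>)
  also have "\<dots> = lin (bar_pair P) (if S = set (leaves ?T) then gen (Leaf s, ?T) else 0)"
    by (cases "S = set (leaves ?T)")
      (simp_all add: lin_simps tensor_simps tensor_right[symmetric] ksign_def del: bar_tree_Node leaves.simps)
  finally have "lin ?root (bar_tree P ?T) = lin (bar_pair P) (if S = set (leaves ?T) then gen (Leaf s, ?T) else 0)" .
  moreover have "lin (ecut S s) (bar_tree P ?T) = lin ?root (bar_tree P ?T) + lin (ecut_above S s) (bar_tree P ?T)"
    unfolding lin_fun_add[symmetric] by (rule lin_ext_cong) (rule ecut_eq)
  moreover have "lin (ecut_above S s) (bar_tree P ?T) = lin (bar_pair P) (ecut_above S s ?T)"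
    by (rule bar_leibniz_above) (rule Node)
  ultimately show ?case unfolding ecut_eq[of S s ?T] lin_add by simp
qed

lemma susp_simps [simp]:
  "cscale (susp X) = cscale X" "csp (susp X) n e = csp X n (e - 1)" "cact (susp X) = cact X"
  by (simp_all add: susp_def)

lemma aug_coll_simps [simp]:
  "cscale (aug_coll P) = scl P" "csp (aug_coll P) = aug P" "cact (aug_coll P) = act P"
  by (simp_all add: aug_coll_def)

lemma wt_coll_simps [simp]:
  "cscale (wt_coll P d) = scl P" "csp (wt_coll P d) n e = wpart P n d e" "cact (wt_coll P d) = act P"
  by (simp_all add: wt_coll_def)

section \<open>Permutations induced by partial composition\<close>

lemma perm_comp_id_adj:
  assumes "Suc k < m"
  shows "perm_comp m i id (adj k) = adj (i + k)"
  using assms by (auto simp: fun_eq_iff perm_comp_def transpose_def Let_def)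

lemma perm_comp_adj_id_before:
  assumes "i < k"
  shows "perm_comp m i (adj k) id = adj (k + m - 1)"
  using assms by (auto simp: fun_eq_iff perm_comp_def transpose_def Let_def)

lemma perm_comp_adj_id_after:
  assumes "Suc k < i"
  shows "perm_comp m i (adj k) id = adj k"
  using assms by (auto simp: fun_eq_iff perm_comp_def transpose_def Let_def)

text \<open>Exchanging an input that carries a block of \<open>m\<close> inputs with its right
  neighbour gives the cycle that moves one entry across the block.\<close>

lemma perm_comp_adj_id:
  "perm_comp m k (adj k) id j = (if k \<le> j \<and> j < k + m then Suc j else if j = k + m then k else j)"
  by (auto simp: perm_comp_def transpose_def Let_def)

lemma perm_comp_adj_id_permutes:
  assumes "k + m < n"
  shows "perm_comp m k (adj k) id permutes {..<n}"
proof (rule bij_imp_permutes)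
  let ?f = "\<lambda>j. if k < j \<and> j \<le> k + m then j - 1 else if j = k then k + m else j"
  show "bij_betw (perm_comp m k (adj k) id) {..<n} {..<n}"
    by (rule bij_betw_byWitness[where f' = ?f]) (use assms in \<open>auto simp: perm_comp_adj_id\<close>)
  show "perm_comp m k (adj k) id j = j" if "j \<notin> {..<n}" for j
    using that assms by (auto simp: perm_comp_adj_id)
qed

lemma nth_block: "(a @ t # us @ b) ! perm_comp (length us) (length a) (adj (length a)) id j = (a @ us @ t # b) ! j"
  unfolding perm_comp_adj_id by (auto simp: nth_append nth_Cons' Suc_diff_le)

lemma permute_list_block:
  fixes a us b :: "'t list"
  defines "\<pi> \<equiv> perm_comp (length us) (length a) (adj (length a)) id"
  shows "permute_list (inv \<pi>) (a @ us @ t # b) = a @ t # us @ b"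
proof -
  let ?n = "length (a @ t # us @ b)"
  have p: "\<pi> permutes {..<?n}" unfolding \<pi>_def by (rule perm_comp_adj_id_permutes) simp
  have 1: "a @ us @ t # b = permute_list \<pi> (a @ t # us @ b)"
    unfolding \<pi>_def
    by (rule nth_equalityI) (auto simp: permute_list_def nth_block simp del: upt_Suc)
  show ?thesis
    unfolding 1 using permute_list_compose[OF permutes_inv[OF p], of \<pi>] permutes_surj[OF p]
    by (simp add: surj_iff)
qed

text \<open>The only inversions are between the members of the block and the one sibling that
  crosses it, so the exponents add up to the degree of the block times that of the sibling.\<close>

lemma perm_sign_block:
  "(perm_sign (length (a @ us @ t # b)) (perm_comp (length us) (length a) (adj (length a)) id)
     (\<lambda>i. tdeg ((a @ us @ t # b) ! i)) :: 'k::field) = ksign (tdegs us * tdeg t)"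
proof -
  let ?\<pi> = "perm_comp (length us) (length a) (adj (length a)) id"
  let ?h = "\<lambda>q. (length a + q, length a + length us)"
  have inv: "invs (length (a @ us @ t # b)) ?\<pi> = ?h ` {..<length us}"
  proof (intro set_eqI iffI)
    fix p assume "p \<in> invs (length (a @ us @ t # b)) ?\<pi>"
    then have "fst p \<ge> length a" "fst p < length a + length us" "snd p = length a + length us"
      by (auto simp: invs_def perm_comp_adj_id split: if_splits)
    then show "p \<in> ?h ` {..<length us}"
      by (intro image_eqI[of _ _ "fst p - length a"]) (auto simp: prod_eq_iff)
  qed (auto simp: invs_def perm_comp_adj_id)
  have "(\<Prod>q<length us. ksign (tdeg (us ! q) * tdeg t)) = (ksign (tdegs us * tdeg t) :: 'k)"
  proof (induct us)
    case (Cons u us)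
    then show ?case
      by (simp add: prod.lessThan_Suc_shift ksign_add[symmetric] algebra_simps del: prod.lessThan_Suc)
  qed (simp add: ksign_def)
  then show ?thesis
    unfolding perm_sign_invs inv
    by (subst prod.reindex) (auto simp: inj_on_def nth_append)
qed

section \<open>Compatibility of the bar differential with the relations\<close>

context connected_wg_operad
begin

sublocale V: vector_space "scl P" by (rule vs)

abbreviation "D \<equiv> susp (aug_coll P)"

lemma wpart_whole: "x \<in> wpart P n k e \<Longrightarrow> x \<in> whole P n e"
  unfolding whole_def by (rule V.span_base) blast

lemma wpart_aug: "x \<in> wpart P n k e \<Longrightarrow> k \<ge> 1 \<Longrightarrow> x \<in> aug P n e"
  unfolding aug_def by (rule V.span_base) auto

lemma aug_whole: "x \<in> aug P n e \<Longrightarrow> x \<in> whole P n e"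
  unfolding aug_def whole_def
  using V.span_mono[of "\<Union>k\<in>{1..}. wpart P n k e" "\<Union>k. wpart P n k e"] by blast

lemma subspace_aug: "V.subspace (aug P n e)"
  unfolding aug_def by simp

lemma subspace_whole: "V.subspace (whole P n e)"
  unfolding whole_def by simp

lemmas aug_closed = V.subspace_0[OF subspace_aug] V.subspace_add[OF subspace_aug] V.subspace_scale[OF subspace_aug]
lemmas whole_closed = V.subspace_0[OF subspace_whole] V.subspace_add[OF subspace_whole] V.subspace_scale[OF subspace_whole]

lemma act_zero: "\<sigma> permutes {..<n} \<Longrightarrow> act P n \<sigma> 0 = 0"
  using act_scale[of \<sigma> n 0 e 0] whole_closed(1) by simp

lemma act_aug:
  assumes "\<sigma> permutes {..<n}" "x \<in> aug P n e"
  shows "act P n \<sigma> x \<in> aug P n e"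
proof -
  \<comment> \<open>Membership in \<open>whole\<close> is carried along because the linearity of the
    action is only available there.\<close>
  have "x \<in> {x. x \<in> whole P n e \<and> act P n \<sigma> x \<in> aug P n e}"
    using assms(2)[unfolded aug_def]
  proof (rule V.span_minimal[THEN set_mp, rotated 2])
    show "(\<Union>k\<in>{1..}. wpart P n k e) \<subseteq> {x. x \<in> whole P n e \<and> act P n \<sigma> x \<in> aug P n e}"
      using wpart_whole act_wpart[OF assms(1)] wpart_aug by fastforce
    show "V.subspace {x. x \<in> whole P n e \<and> act P n \<sigma> x \<in> aug P n e}"
      by (rule V.subspaceI)
        (auto simp: act_add[OF assms(1)] act_scale[OF assms(1)] act_zero[OF assms(1)] aug_closed whole_closed)
  qed
  then show ?thesis by simp
qed

lemma pcomp_aug: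
  assumes "i < n" "x \<in> aug P n e" "y \<in> aug P m f"
  shows "pcomp P n m i x y \<in> aug P (n + m - 1) (e + f)"
proof -
  have zl: "pcomp P n m i 0 y = 0" if "y \<in> whole P m f" for y
    using pcomp_scale_left[OF assms(1) whole_closed(1) that, of 0] by simp
  have zr: "pcomp P n m i x 0 = 0" if "x \<in> whole P n e" for x
    using pcomp_scale_right[OF assms(1) that whole_closed(1)[of m f], of 0] by simp
  have 1: "pcomp P n m i x y \<in> aug P (n + m - 1) (e + f)" if x: "x \<in> wpart P n k e" "k \<ge> 1" for x k
  proof -
    have "y \<in> {y. y \<in> whole P m f \<and> pcomp P n m i x y \<in> aug P (n + m - 1) (e + f)}"
      using assms(3)[unfolded aug_def]
    proof (rule V.span_minimal[THEN set_mp, rotated 2])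
      show "(\<Union>k\<in>{1..}. wpart P m k f) \<subseteq> {y. y \<in> whole P m f \<and> pcomp P n m i x y \<in> aug P (n + m - 1) (e + f)}"
        using wpart_whole wpart_aug[OF pcomp_wpart[OF assms(1) x(1)]] by fastforce
      show "V.subspace {y. y \<in> whole P m f \<and> pcomp P n m i x y \<in> aug P (n + m - 1) (e + f)}"
        using wpart_whole[OF x(1)]
        by (intro V.subspaceI)
          (auto simp: pcomp_add_right[OF assms(1)] pcomp_scale_right[OF assms(1)] zr aug_closed whole_closed)
    qed
    then show ?thesis by simp
  qed
  have "x \<in> {x. x \<in> whole P n e \<and> pcomp P n m i x y \<in> aug P (n + m - 1) (e + f)}"
    using assms(2)[unfolded aug_def]
  proof (rule V.span_minimal[THEN set_mp, rotated 2])
    show "(\<Union>k\<in>{1..}. wpart P n k e) \<subseteq> {x. x \<in> whole P n e \<and> pcomp P n m i x y \<in> aug P (n + m - 1) (e + f)}"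
      using wpart_whole 1 by fastforce
    show "V.subspace {x. x \<in> whole P n e \<and> pcomp P n m i x y \<in> aug P (n + m - 1) (e + f)}"
      using aug_whole[OF assms(3)]
      by (intro V.subspaceI)
        (auto simp: pcomp_add_left[OF assms(1)] pcomp_scale_left[OF assms(1)] zl aug_closed whole_closed)
  qed
  then show ?thesis by simp
qed

lemma pcomp_linear_right:
  assumes "i < n" "x \<in> aug P n e" "y \<in> aug P m f" "z \<in> aug P m f"
  shows "pcomp P n m i x (scl P c y + scl P c' z) = scl P c (pcomp P n m i x y) + scl P c' (pcomp P n m i x z)"
  using assms(3,4)[THEN aug_whole]
  by (simp add: pcomp_add_right[OF assms(1) aug_whole[OF assms(2)], of _ _ f]
      pcomp_scale_right[OF assms(1) aug_whole[OF assms(2)], of _ _ f] whole_closed)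

lemma pcomp_linear_left:
  assumes "i < n" "x \<in> aug P n e" "z \<in> aug P n e" "y \<in> aug P m f"
  shows "pcomp P n m i (scl P c x + scl P c' z) y = scl P c (pcomp P n m i x y) + scl P c' (pcomp P n m i z y)"
  using assms(2,3)[THEN aug_whole]
  by (simp add: pcomp_add_left[OF assms(1) _ _ aug_whole[OF assms(4)], of _ e]
      pcomp_scale_left[OF assms(1) _ aug_whole[OF assms(4)], of _ e] whole_closed)

lemma coll_D: "coll D"
  by (rule coll.intro) (auto simp: vs subspace_aug act_aug intro: act_id act_comp aug_whole)

lemma coll_wt: "coll (susp (wt_coll P d))"
  by (rule coll.intro) (auto simp: vs wpart_subspace act_wpart intro: act_id act_comp wpart_whole)

interpretation D: coll D by (rule coll_D)

lemma contract_decorated: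
  assumes "decorated D (Node e x (a @ t # b))" "t' \<in> Poly_Mapping.keys (contract P e x a b t)"
  shows "decorated D t'"
proof -
  obtain f y us where *: "t = Node f y us"
    "t' = Node (e + f - 1) (pcomp P (length a + 1 + length b) (length us) (length a) x y) (a @ us @ b)"
    using keys_contract[OF assms(2)] by blast
  have "pcomp P (length a + 1 + length b) (length us) (length a) x y
      \<in> aug P (length a + 1 + length b + length us - 1) (e - 1 + (f - 1))"
    by (rule pcomp_aug) (use assms(1) * in auto)
  then show ?thesis using assms(1) * by (auto simp: algebra_simps)
qed

lemma bar_decorated: "decorated D t \<Longrightarrow> t' \<in> Poly_Mapping.keys (bar_tree P t) \<Longrightarrow> decorated D t'"
proof (induct t arbitrary: t')
  case (Node e x ts)
  obtain a t b where ts: "ts = a @ t # b" and t': "t' \<in> Poly_Mapping.keys (bar_at P e x a b t)"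
    using subsetD[OF keys_ssum Node(3)[unfolded bar_tree_Node]] by blast
  show ?case
    using keys_bar_at[OF t']
  proof
    assume "t' \<in> Poly_Mapping.keys (contract P e x a b t)"
    then show ?thesis using contract_decorated Node(2) ts by blast
  next
    assume "\<exists>t1\<in>Poly_Mapping.keys (bar_tree P t). t' = Node e x (a @ t1 # b)"
    then obtain t1 where t1: "t1 \<in> Poly_Mapping.keys (bar_tree P t)" "t' = Node e x (a @ t1 # b)" by blast
    show ?thesis using Node(1)[OF _ _ t1(1)] Node(2) by (auto simp: ts t1(2))
  qed
qed simp

text \<open>Relators located in the contracted child. A linear relation or a transposition at its
  root vertex passes through the second argument of the composition; a relator deeper inside merely
  gets a new context. Relators at the parent are the subject of \<open>contract_linear_null\<close>
  and the \<open>contract_swap\<close> lemmas.\<close>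

lemma contract_null:
  assumes r: "r \<in> drel D" and x: "x \<in> aug P (length a + 1 + length b) (e - 1)"
    and ab: "\<forall>t\<in>set (a @ b). decorated D t"
  shows "lin (contract P e x a b) r \<in> null D"
  using r
proof cases
  case (linear y us f z c c')
  let ?n = "length a + 1 + length b"
  let ?p = "pcomp P ?n (length us) (length a) x"
  have i: "length a < ?n" by simp
  have yz: "y \<in> aug P (length us) (f - 1)" "z \<in> aug P (length us) (f - 1)" using linear by auto
  have "?p (scl P c y + scl P c' z) = scl P c (?p y) + scl P c' (?p z)"
    by (rule pcomp_linear_right[OF i x yz])
  then have "lin (contract P e x a b) r = pscale (ksign (f * tdegs a + (e - 1)))
     (gen (Node (e + f - 1) (cscale D c (?p y) + cscale D c' (?p z)) (a @ us @ b))
      - pscale c (gen (Node (e + f - 1) (?p y) (a @ us @ b)))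
      - pscale c' (gen (Node (e + f - 1) (?p z) (a @ us @ b))))"
    by (simp add: linear(1) lin_simps pm.scale_right_diff_distrib mult.commute)
  also have "\<dots> \<in> null D"
  proof (intro pm.span_scale null_linear)
    have "?p w \<in> csp D (length (a @ us @ b)) (e + f - 1)" if "w \<in> aug P (length us) (f - 1)" for w
      using pcomp_aug[OF i x that] by (simp add: algebra_simps)
    then show "?p y \<in> csp D (length (a @ us @ b)) (e + f - 1)" "?p z \<in> csp D (length (a @ us @ b)) (e + f - 1)"
      using yz by blast+
    show "\<forall>t\<in>set (a @ us @ b). decorated D t" using linear ab by auto
  qed
  finally show ?thesis .
next
  case (swap y A B f t t')
  let ?n = "length a + 1 + length b" and ?m = "length A + 2 + length B" and ?k = "length A"
  let ?p = "pcomp P ?n ?m (length a) x"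
  have i: "length a < ?n" by simp
  have k: "Suc ?k < ?m" by simp
  have y: "y \<in> aug P ?m (f - 1)" using swap by simp
  have eq: "?p (act P ?m (adj ?k) y) = act P (?n + ?m - 1) (adj (length a + ?k)) (?p y)"
    using pcomp_equivariant[OF i permutes_id adj_permutes[OF k] aug_whole[OF x] aug_whole[OF y]]
    by (simp only: perm_comp_id_adj[OF k] act_id[OF aug_whole[OF x]] id_apply)
  have "lin (contract P e x a b) r = pscale (ksign (f * tdegs a + (e - 1)))
     (gen (Node (e + f - 1) (cact D (length (a @ A) + 2 + length (B @ b)) (adj (length (a @ A))) (?p y)) ((a @ A) @ t # t' # (B @ b)))
      - pscale (ksign (tdeg t * tdeg t')) (gen (Node (e + f - 1) (?p y) ((a @ A) @ t' # t # (B @ b)))))"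
    using eq by (simp add: swap(1) lin_simps pm.scale_right_diff_distrib mult.commute add_ac)
  also have "\<dots> \<in> null D"
  proof (intro pm.span_scale null_swap)
    show "?p y \<in> csp D (length (a @ A) + 2 + length (B @ b)) (e + f - 1)"
      using pcomp_aug[OF i x y] by (simp add: algebra_simps)
    show "\<forall>t\<in>set ((a @ A) @ t # t' # B @ b). decorated D t" using swap ab by auto
  qed
  finally show ?thesis .
next
  case (ctx r' y A B f)
  let ?n = "length a + 1 + length b" and ?m = "length A + 1 + length B"
  let ?p = "pcomp P ?n ?m (length a) x y"
  have "lin (contract P e x a b) r = pscale (ksign (f * tdegs a + (e - 1)))
      (node_ctx (e + f - 1) ?p (a @ A) (B @ b) r')"
    unfolding ctx(1) lin_node_ctx by (simp add: lin_fun_pscale node_ctx_def)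
  also have "\<dots> \<in> null D"
  proof (intro pm.span_scale null_node_ctx pm.span_base ctx)
    have "?p \<in> aug P (?n + ?m - 1) (e - 1 + (f - 1))"
      by (rule pcomp_aug) (use x ctx in auto)
    then show "?p \<in> csp D (length (a @ A) + 1 + length (B @ b)) (e + f - 1)"
      by (simp add: algebra_simps)
    show "\<forall>t\<in>set ((a @ A) @ B @ b). decorated D t" using ctx ab by auto
  qed
  finally show ?thesis .
qed

text \<open>Contraction replaces one of the two exchanged siblings by its children, so the
  transposition becomes the block permutation carrying \<open>t'\<close> across all of
  \<open>us\<close>.\<close>

lemma contract_swap_first:
  assumes x: "x \<in> aug P (length A + 2 + length B) (e - 1)" and dec: "\<forall>t\<in>set (A @ t # t' # B). decorated D t"
  shows "contract P e (act P (length A + 2 + length B) (adj (length A)) x) A (t' # B) t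
    - pscale (ksign (tdeg t * tdeg t')) (contract P e x (A @ [t']) B t) \<in> null D"
proof (cases t)
  case (Leaf j)
  then show ?thesis by (simp add: pm.span_zero)
next
  case (Node f y us)
  let ?n = "length A + 2 + length B" and ?m = "length us" and ?k = "length A"
  let ?\<pi> = "perm_comp ?m ?k (adj ?k) id"
  let ?L = "A @ us @ t' # B"
  let ?z = "pcomp P ?n ?m (Suc ?k) x y"
  have y: "y \<in> aug P ?m (f - 1)" using dec Node by simp
  have L: "length ?L = ?n + ?m - 1" by simp
  have eq: "pcomp P ?n ?m ?k (act P ?n (adj ?k) x) y = act P (length ?L) ?\<pi> ?z"
    using pcomp_equivariant[OF _ adj_permutes permutes_id aug_whole[OF x] aug_whole[OF y], of ?k ?k]
    unfolding L by (simp add: act_id[OF aug_whole[OF y]])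
  have z: "?z \<in> csp D (length ?L) (e + f - 1)"
    using pcomp_aug[OF _ x y, of "Suc ?k"] by (simp add: algebra_simps)
  have "gen (Node (e + f - 1) (cact D (length ?L) ?\<pi> ?z) ?L)
      - pscale (perm_sign (length ?L) ?\<pi> (\<lambda>i. tdeg (?L ! i)))
          (gen (Node (e + f - 1) ?z (permute_list (inv ?\<pi>) ?L))) \<in> null D"
    by (rule D.null_equivariance) (use z dec Node in \<open>auto intro!: perm_comp_adj_id_permutes\<close>)
  then have "gen (Node (e + f - 1) (act P (length ?L) ?\<pi> ?z) ?L)
      - pscale (ksign (tdegs us * tdeg t')) (gen (Node (e + f - 1) ?z (A @ t' # us @ B))) \<in> null D"
    unfolding perm_sign_block permute_list_block by simp
  then have "pscale (ksign (f * tdegs A + (e - 1))) (gen (Node (e + f - 1) (act P (length ?L) ?\<pi> ?z) ?L)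
      - pscale (ksign (tdegs us * tdeg t')) (gen (Node (e + f - 1) ?z (A @ t' # us @ B)))) \<in> null D"
    by (rule pm.span_scale)
  \<comment> \<open>The degree of \<open>t\<close> is \<open>f + tdegs us\<close>: the block
    permutation accounts for \<open>tdegs us\<close> passing \<open>t'\<close>, the contraction of
    the second tree for \<open>f\<close> passing \<open>t'\<close>.\<close>
  moreover have "ksign (f * tdegs A + (e - 1)) * ksign (tdegs us * tdeg t')
      = ksign (tdeg t * tdeg t') * (ksign (f * tdegs (A @ [t']) + (e - 1)) :: 'k)"
    unfolding ksign_add[symmetric] by (rule ksign_cong) (simp add: Node algebra_simps)
  ultimately show ?thesis
    using eq by (simp add: Node pm.scale_right_diff_distrib)
qed

text \<open>The transposition is an involution, so this is \<open>contract_swap_first\<close> for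
  the transposed decoration, with the roles of the two siblings exchanged.\<close>

lemma contract_swap_second:
  assumes x: "x \<in> aug P (length A + 2 + length B) (e - 1)" and dec: "\<forall>t\<in>set (A @ t # t' # B). decorated D t"
  shows "contract P e (act P (length A + 2 + length B) (adj (length A)) x) (A @ [t]) B t'
    - pscale (ksign (tdeg t * tdeg t')) (contract P e x A (t # B) t') \<in> null D"
proof -
  let ?n = "length A + 2 + length B" and ?k = "length A"
  let ?e = "ksign (tdeg t * tdeg t') :: 'k"
  have p: "adj ?k permutes {..<?n}" by (rule adj_permutes) simp
  have "act P ?n (adj ?k) (act P ?n (adj ?k) x) = x"
    using act_comp[OF p p aug_whole[OF x]] act_id[OF aug_whole[OF x]] by simp
  then have "contract P e x A (t # B) t'
      - pscale ?e (contract P e (act P ?n (adj ?k) x) (A @ [t]) B t') \<in> null D"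
    using contract_swap_first[OF act_aug[OF p x], of t' t] dec by (simp add: mult.commute)
  \<comment> \<open>The sign \<open>?e\<close> squares to one, so this scaling exchanges the two
    terms of the relation.\<close>
  then have "pscale (- ?e) (contract P e x A (t # B) t'
      - pscale ?e (contract P e (act P ?n (adj ?k) x) (A @ [t]) B t')) \<in> null D"
    by (rule pm.span_scale)
  then show ?thesis by (simp add: pm.scale_right_diff_distrib algebra_simps)
qed

end

text \<open>This and the following lemmas are relators with a linear combination in one child: the
  differential of a child is not a single tree.\<close>

lemma node_ctx_linear_null:
  assumes "x \<in> csp X (length a + 1 + length b) e" "y \<in> csp X (length a + 1 + length b) e"
    and "\<forall>t\<in>set (a @ b) \<union> Poly_Mapping.keys v. decorated X t"
  shows "node_ctx e (cscale X c x + cscale X c' y) a b v - pscale c (node_ctx e x a b v)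
    - pscale c' (node_ctx e y a b v) \<in> null X"
  unfolding node_ctx_def lin_fun_diff[symmetric] lin_fun_pscale[symmetric]
  by (intro lin_in_subspace[OF subspace_null] null_linear) (use assms in auto)

lemma node_ctx_swap_null:
  assumes "x \<in> csp X (length A + 2 + length B) e"
    and "\<forall>t\<in>set (A @ B) \<union> Poly_Mapping.keys v. decorated X t" "decorated X t"
    and d: "\<forall>t\<in>Poly_Mapping.keys v. tdeg t = d"
  shows "node_ctx e (cact X (length A + 2 + length B) (adj (length A)) x) A (t # B) v
      - pscale (ksign (d * tdeg t)) (node_ctx e x (A @ [t]) B v) \<in> null X"
    and "node_ctx e (cact X (length A + 2 + length B) (adj (length A)) x) (A @ [t]) B v
      - pscale (ksign (tdeg t * d)) (node_ctx e x A (t # B) v) \<in> null X"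
  unfolding node_ctx_def lin_fun_diff[symmetric] lin_fun_pscale[symmetric]
proof (intro lin_in_subspace[OF subspace_null], goal_cases)
  case (1 t1)
  then show ?case using null_swap[OF assms(1), of t1 t] assms by auto
next
  show "lin (\<lambda>ta. gen (Node e (cact X (length A + 2 + length B) (adj (length A)) x) ((A @ [t]) @ ta # B))
      - pscale (ksign (tdeg t * d)) (gen (Node e x (A @ ta # t # B)))) v \<in> null X"
  proof (intro lin_in_subspace[OF subspace_null], goal_cases)
    case (1 t1)
    then show ?case using null_swap[OF assms(1), of t t1] assms by auto
  qed
qed

lemma node_ctx_swap_before_null:
  assumes "x \<in> csp X n e" "\<forall>t\<in>set (A @ A' @ t # t' # B) \<union> Poly_Mapping.keys v. decorated X t"
    and n: "n = length A + length A' + 3 + length B" "k = Suc (length A + length A')"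
  shows "node_ctx e (cact X n (adj k) x) A (A' @ t # t' # B) v
      - pscale (ksign (tdeg t * tdeg t')) (node_ctx e x A (A' @ t' # t # B) v) \<in> null X"
  unfolding node_ctx_def lin_fun_diff[symmetric] lin_fun_pscale[symmetric]
proof (intro lin_in_subspace[OF subspace_null], goal_cases)
  case (1 t1)
  have n': "n = length (A @ t1 # A') + 2 + length B" "k = length (A @ t1 # A')" using n by auto
  have "gen (Node e (cact X n (adj k) x) ((A @ t1 # A') @ t # t' # B))
      - pscale (ksign (tdeg t * tdeg t')) (gen (Node e x ((A @ t1 # A') @ t' # t # B))) \<in> null X"
    unfolding n'(1) n'(2) by (rule null_swap) (use assms 1 in \<open>auto simp: numeral_3_eq_3\<close>)
  then show ?case by simp
qed

lemma node_ctx_swap_after_null: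
  assumes "x \<in> csp X n e" "\<forall>t\<in>set (A @ t # t' # B @ B') \<union> Poly_Mapping.keys v. decorated X t"
    and n: "n = length A + 3 + length B + length B'"
  shows "node_ctx e (cact X n (adj (length A)) x) (A @ t # t' # B) B' v
      - pscale (ksign (tdeg t * tdeg t')) (node_ctx e x (A @ t' # t # B) B' v) \<in> null X"
  unfolding node_ctx_def lin_fun_diff[symmetric] lin_fun_pscale[symmetric]
proof (intro lin_in_subspace[OF subspace_null], goal_cases)
  case (1 t1)
  have n': "n = length A + 2 + length (B @ t1 # B')" using n by auto
  have "gen (Node e (cact X n (adj (length A)) x) (A @ t # t' # B @ t1 # B'))
      - pscale (ksign (tdeg t * tdeg t')) (gen (Node e x (A @ t' # t # B @ t1 # B'))) \<in> null X"
    unfolding n' by (rule null_swap) (use assms 1 in \<open>auto simp: numeral_3_eq_3 add.assoc\<close>)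
  then show ?case by simp
qed

context connected_wg_operad
begin

interpretation D: coll D by (rule coll_D)

lemma contract_linear_null:
  assumes "x \<in> aug P (length a + 1 + length b) (e - 1)" "y \<in> aug P (length a + 1 + length b) (e - 1)"
    and dec: "\<forall>t\<in>set (a @ t # b). decorated D t"
  shows "contract P e (scl P c x + scl P c' y) a b t - pscale c (contract P e x a b t)
    - pscale c' (contract P e y a b t) \<in> null D"
proof (cases t)
  case (Leaf j)
  then show ?thesis by (simp add: pm.span_zero)
next
  case (Node f z us)
  let ?n = "length a + 1 + length b"
  let ?p = "\<lambda>x. pcomp P ?n (length us) (length a) x z"
  have z: "z \<in> aug P (length us) (f - 1)" using dec Node by simp
  have i: "length a < ?n" by simp
  have w: "?p w \<in> csp D (length (a @ us @ b)) (e + f - 1)" if "w \<in> aug P ?n (e - 1)" for w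
    using pcomp_aug[OF i that z] by (simp add: algebra_simps)
  have "pscale (ksign (f * tdegs a + (e - 1)))
     (gen (Node (e + f - 1) (cscale D c (?p x) + cscale D c' (?p y)) (a @ us @ b))
      - pscale c (gen (Node (e + f - 1) (?p x) (a @ us @ b)))
      - pscale c' (gen (Node (e + f - 1) (?p y) (a @ us @ b)))) \<in> null D"
    by (intro pm.span_scale null_linear w assms) (use dec Node in auto)
  moreover have "?p (scl P c x + scl P c' y) = scl P c (?p x) + scl P c' (?p y)"
    by (rule pcomp_linear_left[OF i assms(1,2) z])
  ultimately show ?thesis by (simp add: Node pm.scale_right_diff_distrib mult.commute)
qed

text \<open>The contracted child stands left of the exchanged pair, whose position therefore shifts
  by the arity of the child minus one.\<close>

lemma contract_swap_before:
  assumes x: "x \<in> aug P n (e - 1)"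
    and dec: "\<forall>t\<in>set (A @ t1 # A' @ t # t' # B). decorated D t"
    and n: "n = length A + length A' + 3 + length B" and k: "k = Suc (length A + length A')"
  shows "contract P e (act P n (adj k) x) A (A' @ t # t' # B) t1
    - pscale (ksign (tdeg t * tdeg t')) (contract P e x A (A' @ t' # t # B) t1) \<in> null D"
proof (cases t1)
  case (Leaf j)
  then show ?thesis by (simp add: pm.span_zero)
next
  case (Node f y us)
  let ?m = "length us"
  let ?z = "pcomp P n ?m (length A) x y" and ?e = "ksign (tdeg t * tdeg t') :: 'k"
  let ?s = "ksign (f * tdegs A + (e - 1)) :: 'k"
  have nn: "length A + 1 + length (A' @ t # t' # B) = n" "length A + 1 + length (A' @ t' # t # B) = n"
    using n by auto
  have y: "y \<in> aug P ?m (f - 1)" using dec Node by simp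
  have i: "length A < n" and k': "Suc k < n" and ik: "length A < k" using n k by auto
  have fix_i: "adj k (length A) = length A" using ik by (simp add: transpose_def)
  have eq: "pcomp P n ?m (length A) (act P n (adj k) x) y = act P (n + ?m - 1) (adj (k + ?m - 1)) ?z"
    using pcomp_equivariant[OF i adj_permutes[OF k'] permutes_id aug_whole[OF x] aug_whole[OF y]]
    by (simp only: act_id[OF aug_whole[OF y]] perm_comp_adj_id_before[OF ik] fix_i)
  have n': "n + ?m - 1 = length (A @ us @ A') + 2 + length B" "k + ?m - 1 = length (A @ us @ A')"
    using n k by auto
  have z: "?z \<in> aug P (n + ?m - 1) (e + f - 1 - 1)"
    using pcomp_aug[OF i x y] by (simp add: algebra_simps)
  have "gen (Node (e + f - 1) (cact D (n + ?m - 1) (adj (k + ?m - 1)) ?z) ((A @ us @ A') @ t # t' # B))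
      - pscale ?e (gen (Node (e + f - 1) ?z ((A @ us @ A') @ t' # t # B))) \<in> null D"
    unfolding n'
  proof (rule null_swap)
    show "?z \<in> csp D (length (A @ us @ A') + 2 + length B) (e + f - 1)" using z unfolding n' by simp
  qed (use dec Node in auto)
  from pm.span_scale[OF this, of ?s]
  have "pscale ?s (gen (Node (e + f - 1) (act P (n + ?m - 1) (adj (k + ?m - 1)) ?z) (A @ us @ A' @ t # t' # B)))
      - pscale ?e (pscale ?s (gen (Node (e + f - 1) ?z (A @ us @ A' @ t' # t # B)))) \<in> null D"
    by (simp only: pm.scale_right_diff_distrib pm.scale_scale mult.commute susp_simps aug_coll_simps append_assoc)
  then show ?thesis
    unfolding Node contract.simps nn eq .
qed

text \<open>The contracted child stands right of the exchanged pair, so the positions stay;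
  contraction passes both members, in either order with the same sign.\<close>

lemma contract_swap_after:
  assumes x: "x \<in> aug P n (e - 1)"
    and dec: "\<forall>t\<in>set (A @ t # t' # B @ t1 # B'). decorated D t"
    and n: "n = length A + 3 + length B + length B'"
  shows "contract P e (act P n (adj (length A)) x) (A @ t # t' # B) B' t1
    - pscale (ksign (tdeg t * tdeg t')) (contract P e x (A @ t' # t # B) B' t1) \<in> null D"
proof (cases t1)
  case (Leaf j)
  then show ?thesis by (simp add: pm.span_zero)
next
  case (Node f y us)
  define i where "i = length A + 2 + length B"
  let ?m = "length us" and ?k = "length A"
  let ?z = "pcomp P n ?m i x y" and ?e = "ksign (tdeg t * tdeg t') :: 'k"
  let ?s = "ksign (f * tdegs (A @ t' # t # B) + (e - 1)) :: 'k"
  have nn: "length (A @ t # t' # B) = i" "length (A @ t' # t # B) = i" "i + 1 + length B' = n"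
    using n by (auto simp: i_def)
  have y: "y \<in> aug P ?m (f - 1)" using dec Node by simp
  have i: "i < n" and k: "Suc ?k < n" "Suc ?k < i" using n by (auto simp: i_def)
  have fix_i: "adj ?k i = i" using k by (simp add: transpose_def)
  have eq: "pcomp P n ?m i (act P n (adj ?k) x) y = act P (n + ?m - 1) (adj ?k) ?z"
    using pcomp_equivariant[OF i adj_permutes[OF k(1)] permutes_id aug_whole[OF x] aug_whole[OF y]]
    by (simp only: act_id[OF aug_whole[OF y]] perm_comp_adj_id_after[OF k(2)] fix_i)
  have n': "n + ?m - 1 = length A + 2 + length (B @ us @ B')" using n by auto
  have z: "?z \<in> aug P (n + ?m - 1) (e + f - 1 - 1)"
    using pcomp_aug[OF i x y] by (simp add: algebra_simps)
  have "gen (Node (e + f - 1) (cact D (n + ?m - 1) (adj ?k) ?z) (A @ t # t' # B @ us @ B'))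
      - pscale ?e (gen (Node (e + f - 1) ?z (A @ t' # t # B @ us @ B'))) \<in> null D"
    unfolding n'
  proof (rule null_swap)
    show "?z \<in> csp D (length A + 2 + length (B @ us @ B')) (e + f - 1)" using z unfolding n' by simp
  qed (use dec Node in auto)
  from pm.span_scale[OF this, of ?s]
  have "pscale ?s (gen (Node (e + f - 1) (act P (n + ?m - 1) (adj ?k) ?z) ((A @ t # t' # B) @ us @ B')))
      - pscale ?e (pscale ?s (gen (Node (e + f - 1) ?z ((A @ t' # t # B) @ us @ B')))) \<in> null D"
    by (simp only: pm.scale_right_diff_distrib pm.scale_scale mult.commute susp_simps aug_coll_simps append_assoc append_Cons)
  moreover have "tdegs (A @ t # t' # B) = tdegs (A @ t' # t # B)" by simp
  ultimately show ?thesis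
    unfolding Node contract.simps nn eq by (simp only:)
qed

lemma keys_bar_decorated:
  "decorated D t \<Longrightarrow> \<forall>t'\<in>Poly_Mapping.keys (bar_tree P t). decorated D t' \<and> tdeg t' = tdeg t - 1"
  using bar_decorated keys_bar_tree by blast

text \<open>Makes the differential well defined on the cofree cooperad of the suspended augmentation
  ideal. The three kinds of relators reflect bilinearity and equivariance of the compositions and
  locality of the contractions.\<close>

lemma bar_null:
  assumes "v \<in> null D"
  shows "lin (bar_tree P) v \<in> null D"
proof (rule lin_span[OF assms subspace_null])
  note subs = ssum_in_subspace[OF subspace_null] lin_in_subspace[OF subspace_null]
    pm.subspace_scale[OF subspace_null] pm.subspace_add[OF subspace_null]
  fix r assume "r \<in> drel D"
  then show "lin (bar_tree P) r \<in> null D"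
  proof (induct r)
    case (linear x ts e y c c')
    let ?z = "scl P c x + scl P c' y"
    have "lin (bar_tree P) (gen (Node e ?z ts) - pscale c (gen (Node e x ts)) - pscale c' (gen (Node e y ts)))
      = ssum ts (\<lambda>a t b. bar_at P e ?z a b t - pscale c (bar_at P e x a b t) - pscale c' (bar_at P e y a b t))"
      by (simp add: lin_simps ssum_diff pscale_ssum)
    also have "\<dots> \<in> null D"
    proof (rule subs(1))
      fix a t b assume ts: "ts = a @ t # b"
      have "(contract P e ?z a b t - pscale c (contract P e x a b t) - pscale c' (contract P e y a b t))
        + pscale (ksign (e + tdegs a)) (node_ctx e ?z a b (bar_tree P t)
          - pscale c (node_ctx e x a b (bar_tree P t)) - pscale c' (node_ctx e y a b (bar_tree P t))) \<in> null D"
        by (intro subs contract_linear_null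
            node_ctx_linear_null[where X = D and x = x and y = y and c = c and c' = c', simplified susp_simps aug_coll_simps])
          (use linear keys_bar_decorated ts in auto)
      then show "bar_at P e ?z a b t - pscale c (bar_at P e x a b t) - pscale c' (bar_at P e y a b t) \<in> null D"
        unfolding bar_at_def by (simp add: pm.scale_right_diff_distrib pm.scale_right_distrib algebra_simps)
    qed
    finally show ?case by simp
  next
    case (swap x A B e t t')
    let ?n = "length A + 2 + length B"
    let ?y = "act P ?n (adj (length A)) x"
    let ?e = "ksign (tdeg t * tdeg t') :: 'k"
    let ?b = "bar_at P e"
    have x: "x \<in> aug P ?n (e - 1)" and dec: "\<forall>t\<in>set (A @ t # t' # B). decorated D t" using swap by auto
    \<comment> \<open>Contraction and inner differential are treated apart, as their exchange signs
      \<open>?e\<close> and \<open>g\<close> differ: the inner differential has changed the degree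
      of the child.\<close>
    have combine: "?b z a b u - pscale ?e (?b z' a' b' u) \<in> null D"
      if "contract P e z a b u - pscale ?e (contract P e z' a' b' u) \<in> null D"
        "node_ctx e z a b (bar_tree P u) - pscale g (node_ctx e z' a' b' (bar_tree P u)) \<in> null D"
        "?e * ksign (e + tdegs a') = ksign (e + tdegs a) * g" for z z' a a' b b' u g
    proof -
      have "?b z a b u - pscale ?e (?b z' a' b' u) = (contract P e z a b u - pscale ?e (contract P e z' a' b' u))
        + pscale (ksign (e + tdegs a)) (node_ctx e z a b (bar_tree P u) - pscale g (node_ctx e z' a' b' (bar_tree P u)))"
        unfolding bar_at_def using that(3)
        by (simp add: pm.scale_right_diff_distrib pm.scale_right_distrib)
      then show ?thesis using that(1,2) by (simp add: subs)
    qed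
    have 1: "ssum A (\<lambda>a1 t1 b1. ?b ?y a1 (b1 @ t # t' # B) t1 - pscale ?e (?b x a1 (b1 @ t' # t # B) t1)) \<in> null D"
    proof (rule subs(1))
      fix a1 t1 b1 assume A: "A = a1 @ t1 # b1"
      show "?b ?y a1 (b1 @ t # t' # B) t1 - pscale ?e (?b x a1 (b1 @ t' # t # B) t1) \<in> null D"
      proof (rule combine[where g = ?e])
        show "contract P e ?y a1 (b1 @ t # t' # B) t1 - pscale ?e (contract P e x a1 (b1 @ t' # t # B) t1) \<in> null D"
          by (rule contract_swap_before) (use x dec A in auto)
        show "node_ctx e ?y a1 (b1 @ t # t' # B) (bar_tree P t1) - pscale ?e (node_ctx e x a1 (b1 @ t' # t # B) (bar_tree P t1)) \<in> null D"
          by (rule node_ctx_swap_before_null[where X = D, simplified susp_simps aug_coll_simps])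
            (use x dec A keys_bar_decorated in auto)
      qed (simp add: mult.commute)
    qed
    have 2: "ssum B (\<lambda>a1 t1 b1. ?b ?y (A @ t # t' # a1) b1 t1 - pscale ?e (?b x (A @ t' # t # a1) b1 t1)) \<in> null D"
    proof (rule subs(1))
      fix a1 t1 b1 assume B: "B = a1 @ t1 # b1"
      show "?b ?y (A @ t # t' # a1) b1 t1 - pscale ?e (?b x (A @ t' # t # a1) b1 t1) \<in> null D"
      proof (rule combine[where g = ?e])
        show "contract P e ?y (A @ t # t' # a1) b1 t1 - pscale ?e (contract P e x (A @ t' # t # a1) b1 t1) \<in> null D"
          by (rule contract_swap_after) (use x dec B in auto)
        show "node_ctx e ?y (A @ t # t' # a1) b1 (bar_tree P t1) - pscale ?e (node_ctx e x (A @ t' # t # a1) b1 (bar_tree P t1)) \<in> null D"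
          by (rule node_ctx_swap_after_null[where X = D, simplified susp_simps aug_coll_simps])
            (use x dec B keys_bar_decorated in auto)
      qed (simp add: mult.commute add.left_commute)
    qed
    have 3: "?b ?y A (t' # B) t - pscale ?e (?b x (A @ [t']) B t) \<in> null D"
    \<comment> \<open>The differentiated child has lost one degree; the missing factor
      \<open>tdeg t'\<close> is the sign of the differential passing \<open>t'\<close> in the
      exchanged order.\<close>
    proof (rule combine[where g = "ksign ((tdeg t - 1) * tdeg t')"])
      show "contract P e ?y A (t' # B) t - pscale ?e (contract P e x (A @ [t']) B t) \<in> null D"
        by (rule contract_swap_first[OF x dec])
      show "node_ctx e ?y A (t' # B) (bar_tree P t)
          - pscale (ksign ((tdeg t - 1) * tdeg t')) (node_ctx e x (A @ [t']) B (bar_tree P t)) \<in> null D"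
        by (rule node_ctx_swap_null(1)[where X = D, simplified susp_simps aug_coll_simps])
          (use x dec keys_bar_decorated in auto)
      show "?e * ksign (e + tdegs (A @ [t'])) = ksign (e + tdegs A) * ksign ((tdeg t - 1) * tdeg t')"
        unfolding ksign_add[symmetric] by (rule ksign_cong) (simp add: algebra_simps)
    qed
    have 4: "?b ?y (A @ [t]) B t' - pscale ?e (?b x A (t # B) t') \<in> null D"
    proof (rule combine[where g = "ksign (tdeg t * (tdeg t' - 1))"])
      show "contract P e ?y (A @ [t]) B t' - pscale ?e (contract P e x A (t # B) t') \<in> null D"
        by (rule contract_swap_second[OF x dec])
      show "node_ctx e ?y (A @ [t]) B (bar_tree P t')
          - pscale (ksign (tdeg t * (tdeg t' - 1))) (node_ctx e x A (t # B) (bar_tree P t')) \<in> null D"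
        by (rule node_ctx_swap_null(2)[where X = D, simplified susp_simps aug_coll_simps])
          (use x dec keys_bar_decorated in auto)
      show "?e * ksign (e + tdegs A) = ksign (e + tdegs (A @ [t])) * ksign (tdeg t * (tdeg t' - 1))"
        unfolding ksign_add[symmetric] by (rule ksign_cong) (simp add: algebra_simps)
    qed
    have "lin (bar_tree P) (gen (Node e ?y (A @ t # t' # B)) - pscale ?e (gen (Node e x (A @ t' # t # B))))
      = ssum A (\<lambda>a1 t1 b1. ?b ?y a1 (b1 @ t # t' # B) t1 - pscale ?e (?b x a1 (b1 @ t' # t # B) t1))
      + ssum B (\<lambda>a1 t1 b1. ?b ?y (A @ t # t' # a1) b1 t1 - pscale ?e (?b x (A @ t' # t # a1) b1 t1))
      + (?b ?y A (t' # B) t - pscale ?e (?b x (A @ [t']) B t))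
      + (?b ?y (A @ [t]) B t' - pscale ?e (?b x A (t # B) t'))"
      unfolding ssum_diff pscale_ssum[symmetric] lin_simps bar_tree_Node ssum_append ssum.simps
        pm.scale_right_distrib by (simp add: algebra_simps)
    also have "\<dots> \<in> null D" by (intro subs 1 2 3 4)
    finally show ?case by simp
  next
    case (ctx r x a b e)
    obtain d where d: "\<forall>t\<in>Poly_Mapping.keys r. tdeg t = d" using drel_tdeg[OF coll_D ctx(1)] .
    have r: "r \<in> null D" by (rule pm.span_base) (rule ctx)
    have x: "x \<in> aug P (length a + 1 + length b) (e - 1)" and dec: "\<forall>t\<in>set (a @ b). decorated D t" using ctx by auto
    \<comment> \<open>The differential acts on a sibling before the relator, on the child containing
      it, or on a sibling after it. Only the last case has a sign depending on the relator, through
      its constant degree.\<close>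
    have "lin (bar_tree P) (node_ctx e x a b r) =
      lin (\<lambda>t. ssum a (\<lambda>a1 t1 b1. bar_at P e x a1 (b1 @ t # b) t1)) r
      + (lin (contract P e x a b) r + pscale (ksign (e + tdegs a)) (node_ctx e x a b (lin (bar_tree P) r)))
      + lin (\<lambda>t. ssum b (\<lambda>a1 t1 b1. bar_at P e x (a @ t # a1) b1 t1)) r"
      by (simp add: lin_node_ctx ssum_append lin_fun_add lin_fun_pscale[symmetric] node_ctx_lin bar_at_def[of P e x a b] add.assoc)
    also have "\<dots> \<in> null D"
    proof (intro subs(3,4) null_node_ctx ctx contract_null x dec)
      show "lin (\<lambda>t. ssum a (\<lambda>a1 t1 b1. bar_at P e x a1 (b1 @ t # b) t1)) r \<in> null D"
        unfolding lin_fun_ssum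
      proof (rule subs(1))
        fix a1 t1 b1 assume a: "a = a1 @ t1 # b1"
        have 1: "lin (\<lambda>t. contract P e x a1 (b1 @ t # b) t1) r \<in> null D"
        proof (cases t1)
          case (Leaf j)
          then show ?thesis by (simp add: pm.span_zero)
        next
          case (Node f y us)
          let ?p = "pcomp P (length a + 1 + length b) (length us) (length a1) x y"
          have "lin (\<lambda>t. contract P e x a1 (b1 @ t # b) t1) r
            = pscale (ksign (f * tdegs a1 + (e - 1))) (node_ctx (e + f - 1) ?p (a1 @ us @ b1) b r)"
            by (simp add: Node node_ctx_def lin_fun_pscale a add.assoc)
          also have "\<dots> \<in> null D"
          proof (intro pm.span_scale null_node_ctx r)
            have "?p \<in> aug P (length a + 1 + length b + length us - 1) (e - 1 + (f - 1))"
              by (rule pcomp_aug) (use x dec Node a in auto)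
            then show "?p \<in> csp D (length (a1 @ us @ b1) + 1 + length b) (e + f - 1)"
              by (simp add: a algebra_simps)
          qed (use dec Node a in auto)
          finally show ?thesis .
        qed
        have "lin (\<lambda>t. node_ctx e x a1 (b1 @ t # b) (bar_tree P t1)) r
          = lin (\<lambda>t1'. node_ctx e x (a1 @ t1' # b1) b r) (bar_tree P t1)"
          unfolding node_ctx_def by (subst lin_swap) simp
        also have "\<dots> \<in> null D"
          by (intro subs null_node_ctx r) (use x dec a keys_bar_decorated in auto)
        finally have 2: "lin (\<lambda>t. node_ctx e x a1 (b1 @ t # b) (bar_tree P t1)) r \<in> null D" .
        show "lin (\<lambda>t. bar_at P e x a1 (b1 @ t # b) t1) r \<in> null D"
          unfolding bar_at_def lin_fun_add lin_fun_pscale by (intro subs 1 2)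
      qed
      show "lin (\<lambda>t. ssum b (\<lambda>a1 t1 b1. bar_at P e x (a @ t # a1) b1 t1)) r \<in> null D"
        unfolding lin_fun_ssum
      proof (rule subs(1))
        fix a1 t1 b1 assume b: "b = a1 @ t1 # b1"
        have 1: "lin (\<lambda>t. contract P e x (a @ t # a1) b1 t1) r \<in> null D"
        proof (cases t1)
          case (Leaf j)
          then show ?thesis by (simp add: pm.span_zero)
        next
          case (Node f y us)
          let ?p = "pcomp P (length a + 1 + length b) (length us) (length a + 1 + length a1) x y"
          have "lin (\<lambda>t. contract P e x (a @ t # a1) b1 t1) r
            = lin (\<lambda>t. pscale (ksign (f * (tdegs a + (tdeg t + tdegs a1)) + (e - 1))) (gen (Node (e + f - 1) ?p (a @ t # a1 @ us @ b1)))) r"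
            by (simp add: Node b add.assoc)
          also have "\<dots> = pscale (ksign (f * (tdegs a + (d + tdegs a1)) + (e - 1))) (node_ctx (e + f - 1) ?p a (a1 @ us @ b1) r)"
            unfolding node_ctx_def by (rule lin_const_deg[OF d])
          also have "\<dots> \<in> null D"
          proof (intro pm.span_scale null_node_ctx r)
            have "?p \<in> aug P (length a + 1 + length b + length us - 1) (e - 1 + (f - 1))"
              by (rule pcomp_aug) (use x dec Node b in auto)
            then show "?p \<in> csp D (length a + 1 + length (a1 @ us @ b1)) (e + f - 1)"
              by (simp add: b algebra_simps)
          qed (use dec Node b in auto)
          finally show ?thesis .
        qed
        have "lin (\<lambda>t. node_ctx e x (a @ t # a1) b1 (bar_tree P t1)) r
          = lin (\<lambda>t1'. node_ctx e x a (a1 @ t1' # b1) r) (bar_tree P t1)"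
          unfolding node_ctx_def by (subst lin_swap) simp
        also have "\<dots> \<in> null D"
          by (intro subs null_node_ctx r) (use x dec b keys_bar_decorated in auto)
        finally have 2: "lin (\<lambda>t. node_ctx e x (a @ t # a1) b1 (bar_tree P t1)) r \<in> null D" .
        have "lin (\<lambda>t. pscale (ksign (e + tdegs (a @ t # a1))) (node_ctx e x (a @ t # a1) b1 (bar_tree P t1))) r
          = pscale (ksign (e + (tdegs a + (d + tdegs a1)))) (lin (\<lambda>t. node_ctx e x (a @ t # a1) b1 (bar_tree P t1)) r)"
          using lin_const_deg[OF d, of "\<lambda>i. e + (tdegs a + (i + tdegs a1))"] by simp
        then show "lin (\<lambda>t. bar_at P e x (a @ t # a1) b1 t1) r \<in> null D"
          unfolding bar_at_def lin_fun_add using subs(4)[OF 1 subs(3)[OF 2]] by (simp only:)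
      qed
    qed
    finally show ?case .
  qed
qed

end

section \<open>Cofree cooperads\<close>

lemma ksign_zero [simp]: "ksign 0 = 1"
  by (simp add: ksign_def)

lemma sum_list_filter_concat:
  "(\<Sum>x\<leftarrow>filter Q (concat (map h ks)). g x) = (\<Sum>k\<leftarrow>ks. \<Sum>x\<leftarrow>filter Q (h k). g x)"
  by (induct ks) auto

text \<open>\<open>cuts\<close> renumbers the leaves while descending, \<open>ecut\<close> keeps
  them and marks the new leaf by \<open>s\<close>; one relabelling at the end reconciles the two.
  The map \<open>f\<close> is general so that the induction can absorb the root context into
  it.\<close>

lemma sum_cuts_ecut:
  fixes f :: "'p tree \<Rightarrow> 'p tree \<Rightarrow> ('c \<Rightarrow>\<^sub>0 'k::field)"
  assumes "s \<notin> set (leaves t)"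
  shows "(\<Sum>(c, l, u)\<leftarrow>filter (\<lambda>(c, l, u). set (leaves u) = S) (cuts m i t). pscale (ksign (c * tdeg u)) (f l u))
    = lin (\<lambda>p. f (relabel ((collapse m i)(s := i)) (fst p)) (snd p)) (ecut S s t)"
  using assms
proof (induct t arbitrary: f)
  case (Leaf j)
  then show ?case by (auto simp: ecut_eq lin_simps)
next
  case (Node e x ts)
  let ?Q = "\<lambda>(c, l, u). set (leaves u) = S"
  let ?g = "\<lambda>f (c, l, u). pscale (ksign (c * tdeg u)) (f l u) :: 'c \<Rightarrow>\<^sub>0 'k"
  let ?K = "(collapse m i)(s := i)"
  let ?h = "\<lambda>k. map (\<lambda>(c, l, u). (c + tdegs (drop (k + 1) ts),
         Node e x (map (relabel (collapse m i)) (take k ts) @ l # map (relabel (collapse m i)) (drop (k + 1) ts)), u))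
      (cuts m i (ts ! k))"
  let ?F = "\<lambda>p. f (relabel ?K (fst p)) (snd p)"
  \<comment> \<open>The label \<open>s\<close> does not occur in the uncut siblings, so its special
    value is invisible there.\<close>
  have rel: "map (relabel (collapse m i)) us = map (relabel ?K) us" if "set us \<subseteq> set ts" for us
    using that Node(2) by (auto intro!: relabel_cong)
  have 1: "(\<Sum>x\<leftarrow>filter ?Q (?h k). ?g f x) = lin ?F (dec_ctx e x (take k ts) (drop (k + 1) ts) (ecut S s (ts ! k)))"
    if k: "k < length ts" for k
  proof -
    let ?N = "\<lambda>l. Node e x (map (relabel (collapse m i)) (take k ts) @ l # map (relabel (collapse m i)) (drop (k + 1) ts))"
    let ?f = "\<lambda>l u. pscale (ksign (tdegs (drop (k + 1) ts) * tdeg u)) (f (?N l) u)"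
    have "(\<Sum>x\<leftarrow>filter ?Q (?h k). ?g f x) = (\<Sum>x\<leftarrow>filter ?Q (cuts m i (ts ! k)). ?g ?f x)"
    proof -
      have "(\<Sum>x\<leftarrow>filter ?Q (map (\<lambda>(c, l, u). (c + tdegs (drop (k + 1) ts), ?N l, u)) cs). ?g f x)
        = (\<Sum>x\<leftarrow>filter ?Q cs. ?g ?f x)" for cs
        by (induct cs) (auto simp: ksign_add[symmetric] algebra_simps)
      then show ?thesis .
    qed
    also have "\<dots> = lin (\<lambda>p. ?f (relabel ?K (fst p)) (snd p)) (ecut S s (ts ! k))"
      by (rule Node(1)) (use k Node(2) in auto)
    also have "\<dots> = lin ?F (dec_ctx e x (take k ts) (drop (k + 1) ts) (ecut S s (ts ! k)))"
      unfolding rel[OF set_take_subset] rel[OF set_drop_subset] by (simp add: dec_ctx_def lin_lin lin_simps)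
    finally show ?thesis .
  qed
  have "(\<Sum>x\<leftarrow>filter ?Q (cuts m i (Node e x ts)). ?g f x)
    = (if S = set (leaves (Node e x ts)) then f (Leaf i) (Node e x ts) else 0)
      + (\<Sum>k<length ts. \<Sum>x\<leftarrow>filter ?Q (?h k). ?g f x)"
  proof -
    have "cuts m i (Node e x ts) = (0, Leaf i, Node e x ts) # concat (map ?h [0..<length ts])"
      unfolding cuts.simps by (intro arg_cong2[where f = "(#)"] arg_cong[where f = concat] map_cong) auto
    moreover have "(\<Sum>x\<leftarrow>filter ?Q ((0, a, T) # cs). ?g f x)
      = (if S = set (leaves T) then f a T else 0) + (\<Sum>x\<leftarrow>filter ?Q cs. ?g f x)" for a T cs
      by auto
    moreover have "(\<Sum>x\<leftarrow>filter ?Q (concat (map ?h [0..<length ts])). ?g f x) = (\<Sum>k<length ts. \<Sum>x\<leftarrow>filter ?Q (?h k). ?g f x)"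
      unfolding sum_list_filter_concat by (simp only: interv_sum_list_conv_sum_set_nat atLeast0LessThan set_upt)
    ultimately show ?thesis by (simp only:)
  qed
  also have "(\<Sum>k<length ts. \<Sum>x\<leftarrow>filter ?Q (?h k). ?g f x)
      = (\<Sum>k<length ts. lin ?F (dec_ctx e x (take k ts) (drop (k + 1) ts) (ecut S s (ts ! k))))"
    by (rule sum.cong) (use 1 in auto)
  also have "\<dots> = ssum ts (\<lambda>a t b. lin ?F (dec_ctx e x a b (ecut S s t)))"
    by (rule ssum_nth)
  also have "\<dots> = lin ?F (ecut_above S s (Node e x ts))"
    by (simp add: lin_ssum)
  also have "(if S = set (leaves (Node e x ts)) then f (Leaf i) (Node e x ts) else 0)
      = lin ?F (if S = set (leaves (Node e x ts)) then gen (Leaf s, Node e x ts) else 0)"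
    by (simp add: lin_simps)
  finally show ?case
    unfolding ecut_eq[of S s "Node e x ts"] lin_add .
qed

abbreviation rel_pair :: "(nat \<Rightarrow> nat) \<Rightarrow> (nat \<Rightarrow> nat) \<Rightarrow> ('p tree \<times> 'p tree \<Rightarrow>\<^sub>0 'k::field) \<Rightarrow> ('p tree \<times> 'p tree \<Rightarrow>\<^sub>0 'k)" where
  "rel_pair f g \<equiv> lin (\<lambda>p. gen (relabel f (fst p), relabel g (snd p)))"

lemma tree_decomp_ecut:
  assumes "s \<notin> set (leaves t)"
  shows "tree_decomp m i t = rel_pair ((collapse m i)(s := i)) (\<lambda>j. j - i) (ecut {i..<i + m} s t)"
  unfolding tree_decomp_def by (rule sum_cuts_ecut[OF assms])

lemma tnull_rel_pair:
  assumes "v \<in> tnull X"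
  shows "rel_pair f g v \<in> tnull X"
proof (rule lin_tnull[OF assms subspace_tnull], goal_cases)
  case (1 r u)
  have "lin (\<lambda>l. gen (relabel f (fst (l, u)), relabel g (snd (l, u)))) r = rel f r \<otimes>\<^sub>p gen (relabel g u)"
    by (simp add: rel_def tensor_lin_left tensor_gen)
  then show ?case using 1 by (simp add: tnull_left null_rel pm.span_base)
next
  case (2 r l)
  have "lin (\<lambda>u. gen (relabel f (fst (l, u)), relabel g (snd (l, u)))) r = gen (relabel f l) \<otimes>\<^sub>p rel g r"
    by (simp add: rel_def tensor_lin_right tensor_gen)
  then show ?case using 2 by (simp add: tnull_right null_rel pm.span_base)
qed

lemma ecut_trees:
  assumes t: "t \<in> trees X n e" and p: "p \<in> Poly_Mapping.keys (ecut S n t :: _ \<Rightarrow>\<^sub>0 'k::field)" and S: "n \<notin> S"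
  shows "distinct (leaves (fst p))" "set (leaves (fst p)) = insert n ({..<n} - S)"
    "distinct (leaves (snd p))" "set (leaves (snd p)) = S" "S \<subseteq> {..<n}"
    "decorated X (fst p)" "decorated X (snd p)" "tdeg (fst p) + tdeg (snd p) = e"
    "twt (fst p) + twt (snd p) = twt t"
proof -
  have k: "mset (leaves (fst p)) + mset (leaves (snd p)) = add_mset n (mset (leaves t))"
    "set (leaves (snd p)) = S" "tdeg (fst p) + tdeg (snd p) = tdeg t" "twt (fst p) + twt (snd p) = twt t"
    "decorated X (fst p)" "decorated X (snd p)"
    using keys_ecut[of "fst p" "snd p" S n t X, unfolded prod.collapse, OF p] t by (auto simp: trees_def)
  have t': "distinct (leaves t)" "set (leaves t) = {..<n}" "tdeg t = e" using t by (auto simp: trees_def)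
  have m: "mset (leaves (fst p) @ leaves (snd p)) = mset (n # leaves t)" using k(1) by simp
  have d: "distinct (leaves (fst p) @ leaves (snd p))"
    using mset_eq_imp_distinct_iff[OF m] t' by simp
  have s: "set (leaves (fst p)) \<union> S = insert n {..<n}"
    using mset_eq_setD[OF m] t' k(2) by simp
  show "distinct (leaves (fst p))" "distinct (leaves (snd p))" "set (leaves (snd p)) = S"
    "decorated X (fst p)" "decorated X (snd p)" "tdeg (fst p) + tdeg (snd p) = e"
    "twt (fst p) + twt (snd p) = twt t"
    using d k t' by auto
  show "S \<subseteq> {..<n}" using s S by auto
  show "set (leaves (fst p)) = insert n ({..<n} - S)" using d s S k(2) by auto
qed

lemma relabel_trees:
  assumes "decorated X t" "distinct (leaves t)" "bij_betw f (set (leaves t)) {..<n}"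
  shows "relabel f t \<in> trees X n (tdeg t)"
  using assms by (auto simp: trees_def leaves_relabel distinct_map bij_betw_def)

lemma relabel_permutes_trees:
  assumes "t \<in> trees X n e" "\<sigma> permutes {..<n}"
  shows "relabel \<sigma> t \<in> trees X n e"
  using relabel_trees[of X t \<sigma> n] assms permutes_imp_bij[OF assms(2)] by (auto simp: trees_def)

text \<open>The labels left below a cut, together with the mark \<open>n + m - 1\<close>, are
  numbered without gaps, the mark filling the place \<open>i\<close> of the removed block.\<close>

lemma bij_collapse:
  assumes "i < n"
  shows "bij_betw ((collapse m i)(n + m - 1 := i)) (insert (n + m - 1) ({..<n + m - 1} - {i..<i + m})) {..<n}"
proof -
  let ?N = "n + m - 1"
  let ?f = "(collapse m i)(?N := i)" and ?g = "\<lambda>j. if j = i then ?N else if j < i then j else j + m - 1"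
  let ?A = "insert ?N ({..<?N} - {i..<i + m})"
  have A: "j = ?N \<or> j < i \<or> i + m \<le> j \<and> j < ?N" if "j \<in> ?A" for j
    using that by auto
  have B: "j = i \<or> j < i \<or> i < j \<and> j < n" if "j \<in> {..<n}" for j
    using that by auto
  have f: "?f ?N = i" "\<And>j. j < i \<Longrightarrow> ?f j = j" "\<And>j. i + m \<le> j \<Longrightarrow> j < ?N \<Longrightarrow> ?f j = j + 1 - m"
    using assms by (auto simp: collapse_def)
  have fg: "?f (j + m - 1) = j" if "i < j" "j < n" for j
  proof -
    have "i + m \<le> j + m - 1" "j + m - 1 < ?N" "j + m - 1 + 1 - m = j" using that by auto
    then show ?thesis using f(3) by metis
  qed
  show ?thesis
  proof (rule bij_betw_byWitness[where f' = ?g])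
    show "\<forall>j\<in>?A. ?g (?f j) = j"
    proof
      fix j assume "j \<in> ?A"
      from A[OF this] show "?g (?f j) = j" using f by (elim disjE; simp del: fun_upd_apply; linarith?)
    qed
    show "\<forall>j\<in>{..<n}. ?f (?g j) = j"
    proof
      fix j assume "j \<in> {..<n}"
      from B[OF this] show "?f (?g j) = j" using f(1,2) fg assms
        by (elim disjE; simp del: fun_upd_apply; linarith?)
    qed
    show "?f ` ?A \<subseteq> {..<n}"
    proof
      fix k assume "k \<in> ?f ` ?A"
      then obtain j where j: "j \<in> ?A" "k = ?f j" by blast
      from A[OF j(1)] show "k \<in> {..<n}" using f assms unfolding j(2)
        by (elim disjE; simp del: fun_upd_apply; linarith?)
    qed
    show "?g ` {..<n} \<subseteq> ?A" using assms by auto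
  qed
qed

lemma tree_decomp_trees:
  assumes t: "t \<in> trees X (n + m - 1) e" and i: "i < n"
    and p: "p \<in> Poly_Mapping.keys (tree_decomp m i t :: _ \<Rightarrow>\<^sub>0 'k::field)"
  shows "\<exists>f g. fst p \<in> trees X n f \<and> snd p \<in> trees X m g \<and> f + g = e"
proof -
  let ?N = "n + m - 1" and ?S = "{i..<i + m}"
  have N: "?N \<notin> set (leaves t)" "?N \<notin> ?S"
  proof -
    have "set (leaves t) = {..<?N}" using t by (simp add: trees_def)
    then show "?N \<notin> set (leaves t)" by simp
    show "?N \<notin> ?S" using i unfolding atLeastLessThan_iff by arith
  qed
  obtain q where q: "q \<in> Poly_Mapping.keys (ecut ?S ?N t :: _ \<Rightarrow>\<^sub>0 'k)"
    and pq: "p = (relabel ((collapse m i)(?N := i)) (fst q), relabel (\<lambda>j. j - i) (snd q))"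
    using subsetD[OF keys_lin p[unfolded tree_decomp_ecut[OF N(1)]]] by auto
  note e = ecut_trees[OF t q N(2)]
  have 1: "relabel ((collapse m i)(?N := i)) (fst q) \<in> trees X n (tdeg (fst q))"
    using bij_collapse[OF i, of m] by (intro relabel_trees) (use e in auto)
  have "bij_betw (\<lambda>j. j - i) {i..<i + m} {..<m}"
    by (rule bij_betw_byWitness[where f' = "\<lambda>j. j + i"]) auto
  then have "relabel (\<lambda>j. j - i) (snd q) \<in> trees X m (tdeg (snd q))"
    by (intro relabel_trees) (use e in auto)
  with 1 show ?thesis using e(8) by (intro exI[of _ "tdeg (fst q)"] exI[of _ "tdeg (snd q)"]) (simp add: pq)
qed

lemma cofree_simps [simp]:
  "ksp (cofree_cooperad X) = tree_space X" "knull (cofree_cooperad X) = tree_null X"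
  "kact (cofree_cooperad X) = tree_act" "kdecomp (cofree_cooperad X) n m i = lin (tree_decomp m i)"
  "kcounit (cofree_cooperad X) = (\<lambda>v. Poly_Mapping.lookup v (Leaf 0))"
  by (simp_all add: cofree_cooperad_def)

lemma tensor_null_left: "v \<in> knull C n e \<Longrightarrow> v \<otimes>\<^sub>p w \<in> tensor_null C n m"
  unfolding tensor_null_def by (rule pm.span_base) blast

lemma tensor_null_right: "w \<in> knull C m e \<Longrightarrow> v \<otimes>\<^sub>p w \<in> tensor_null C n m"
  unfolding tensor_null_def by (rule pm.span_base) blast

lemma subspace_tensor_null: "pm.subspace (tensor_null C n m)"
  by (simp add: tensor_null_def)

lemma (in coll) drel_tree_null:
  assumes "r \<in> drel X"
  shows "(\<exists>e. r \<in> tree_null X n e) \<or> (\<forall>t\<in>Poly_Mapping.keys r. mset (leaves t) \<noteq> mset_set {..<n})"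
proof -
  obtain \<tau> where \<tau>: "\<forall>t\<in>Poly_Mapping.keys r. decorated X t \<and> ttype t = \<tau>"
    using drel_keys[OF coll_axioms assms] by blast
  show ?thesis
  proof (cases "fst \<tau> = mset_set {..<n}")
    case True
    have "r \<in> tree_null X n (fst (snd \<tau>))"
      unfolding tree_null_iff
      using \<tau> True assms by (auto simp: trees_iff tree_typ_def case_prod_beta intro: pm.span_base)
    then show ?thesis by blast
  next
    case False
    then show ?thesis using \<tau> by (auto simp: ttype_def)
  qed
qed

text \<open>Filter both factors by their sets of leaves. By homogeneity each generating relator
  either lies in \<open>tree_null\<close> of the right arity or disappears under the filter.\<close>

lemma (in coll) tnull_tensor_null:
  assumes v: "v \<in> tnull X"
    and keys: "\<forall>p\<in>Poly_Mapping.keys v. \<exists>f g. fst p \<in> trees X n f \<and> snd p \<in> trees X m g"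
  shows "v \<in> tensor_null (cofree_cooperad X) n m"
proof -
  let ?T = "\<lambda>n t. mset (leaves t) = mset_set {..<n}"
  let ?f = "\<lambda>p. if ?T n (fst p) \<and> ?T m (snd p) then gen p else 0"
  have "lin ?f v \<in> tensor_null (cofree_cooperad X) n m"
  proof (rule lin_tnull[OF v subspace_tensor_null], goal_cases)
    case (1 r u)
    consider e where "r \<in> tree_null X n e" | "\<forall>t\<in>Poly_Mapping.keys r. \<not> ?T n t"
      using drel_tree_null[OF 1(1)] by blast
    then show ?case
    proof cases
      case 1
      have "lin (\<lambda>l. ?f (l, u)) r = lin (\<lambda>l. if ?T m u then gen l \<otimes>\<^sub>p gen u else 0) r"
        using 1 by (intro lin_ext_cong) (auto simp: tree_null_iff trees_iff tree_typ_def ttype_def tensor_gen)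
      also have "\<dots> = (if ?T m u then r \<otimes>\<^sub>p gen u else 0)"
        by (simp add: tensor_left[of r])
      also have "\<dots> \<in> tensor_null (cofree_cooperad X) n m"
        using 1 by (auto intro!: tensor_null_left pm.subspace_0[OF subspace_tensor_null])
      finally show ?thesis .
    next
      case 2
      then have "lin (\<lambda>l. ?f (l, u)) r = lin (\<lambda>l. 0) r" by (intro lin_ext_cong) auto
      then show ?thesis by (simp add: pm.subspace_0[OF subspace_tensor_null])
    qed
  next
    case (2 r l)
    consider e where "r \<in> tree_null X m e" | "\<forall>t\<in>Poly_Mapping.keys r. \<not> ?T m t"
      using drel_tree_null[OF 2(1)] by blast
    then show ?case
    proof cases
      case 1
      have "lin (\<lambda>u. ?f (l, u)) r = lin (\<lambda>u. if ?T n l then gen l \<otimes>\<^sub>p gen u else 0) r"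
        using 1 by (intro lin_ext_cong) (auto simp: tree_null_iff trees_iff tree_typ_def ttype_def tensor_gen)
      also have "\<dots> = (if ?T n l then gen l \<otimes>\<^sub>p r else 0)"
        by (simp add: tensor_right[of _ r])
      also have "\<dots> \<in> tensor_null (cofree_cooperad X) n m"
        using 1 by (auto intro!: tensor_null_right pm.subspace_0[OF subspace_tensor_null])
      finally show ?thesis .
    next
      case 2
      then have "lin (\<lambda>u. ?f (l, u)) r = lin (\<lambda>u. 0) r" by (intro lin_ext_cong) auto
      then show ?thesis by (simp add: pm.subspace_0[OF subspace_tensor_null])
    qed
  qed
  moreover have "lin ?f v = lin gen v"
    by (rule lin_ext_cong) (use keys in \<open>auto simp: trees_iff tree_typ_def ttype_def\<close>)
  ultimately show ?thesis by simp
qed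

lemma tree_act_rel: "tree_act n \<sigma> = rel (inv \<sigma>)"
  by (simp add: tree_act_def rel_def fun_eq_iff)

lemma rel_tree_space:
  assumes "v \<in> tree_space X n e" "\<sigma> permutes {..<n}"
  shows "rel \<sigma> v \<in> tree_space X n e"
  unfolding rel_def
  by (rule lin_in_subspace[OF subspace_tree_space])
    (use assms in \<open>auto simp: tree_space_iff intro!: relabel_permutes_trees\<close>)

lemma lin_decomp_ecut:
  assumes "v \<in> tree_space X (n + m - 1) e"
  shows "lin (tree_decomp m i) v =
    rel_pair ((collapse m i)(n + m - 1 := i)) (\<lambda>j. j - i) (lin (ecut {i..<i + m} (n + m - 1)) v)"
  unfolding lin_lin
proof (rule lin_ext_cong)
  fix t assume "t \<in> Poly_Mapping.keys v"
  then have "t \<in> trees X (n + m - 1) e" using assms by (auto simp: tree_space_iff)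
  then have "set (leaves t) = {..<n + m - 1}" by (simp add: trees_def)
  then have "n + m - 1 \<notin> set (leaves t)" by simp
  then show "tree_decomp m i t = rel_pair ((collapse m i)(n + m - 1 := i)) (\<lambda>j. j - i) (ecut {i..<i + m} (n + m - 1) t)"
    by (rule tree_decomp_ecut)
qed

lemma (in coll) decomp_tree_null:
  assumes v: "v \<in> tree_null X (n + m - 1) e" and i: "i < n"
  shows "lin (tree_decomp m i) v \<in> tensor_null (cofree_cooperad X) n m"
proof (rule tnull_tensor_null)
  have s: "v \<in> tree_space X (n + m - 1) e" and "v \<in> null X" using v tree_null_subset by blast+
  then show "lin (tree_decomp m i) v \<in> tnull X"
    unfolding lin_decomp_ecut[OF s] by (intro tnull_rel_pair ecut_null[OF coll_axioms])
  show "\<forall>p\<in>Poly_Mapping.keys (lin (tree_decomp m i) v). \<exists>f g. fst p \<in> trees X n f \<and> snd p \<in> trees X m g"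
  proof
    fix p assume p: "p \<in> Poly_Mapping.keys (lin (tree_decomp m i) v)"
    obtain t where t: "t \<in> Poly_Mapping.keys v" "p \<in> Poly_Mapping.keys (tree_decomp m i t :: _ \<Rightarrow>\<^sub>0 'k)"
      using subsetD[OF keys_lin p] by blast
    have "t \<in> trees X (n + m - 1) e" using t s by (auto simp: tree_space_iff)
    from tree_decomp_trees[OF this i t(2)]
    show "\<exists>f g. fst p \<in> trees X n f \<and> snd p \<in> trees X m g" by blast
  qed
qed

lemma (in coll) rel_tree_null:
  assumes "v \<in> tree_null X n e" "\<sigma> permutes {..<n}"
  shows "rel \<sigma> v \<in> tree_null X n e"
  using assms tree_null_subset rel_tree_space[of v X n e \<sigma>] null_rel[of v X \<sigma>]
  by (auto simp: tree_null_iff tree_space_iff)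

lemma subspace_tree_null: "pm.subspace (tree_null X n e)"
  by (simp add: tree_null_def)

text \<open>The zero subcooperad of the quotient. It guarantees that the families whose sum is taken
  below are nonempty.\<close>

lemma (in coll) subcooperad_null: "subcooperad (cofree_cooperad X) (tree_null X)"
proof -
  have "tensor_null C n m \<subseteq> tensor_space C S n m e" for C :: "('p tree, 'k) cooperad" and S n m e
    unfolding tensor_space_def by (auto intro: pm.span_base)
  then have 1: "lin (tree_decomp m i) v \<in> tensor_space (cofree_cooperad X) (tree_null X) n m e"
    if "i < n" "v \<in> tree_null X (n + m - 1) e" for n m i e v
    using decomp_tree_null[OF that(2,1)] by blast
  have 2: "rel (inv \<sigma>) v \<in> tree_null X n e" if "\<sigma> permutes {..<n}" "v \<in> tree_null X n e" for \<sigma> n v e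
    by (rule rel_tree_null[OF that(2) permutes_inv[OF that(1)]])
  show ?thesis
    unfolding subcooperad_def cofree_simps tree_act_rel
    by (intro conjI allI impI image_subsetI subspace_tree_null subset_refl tree_null_subset(1) 1 2)
qed

section \<open>Sums of families of subcooperads\<close>

lemma tensor_space_mono:
  assumes "\<And>n e. S n e \<subseteq> T n e"
  shows "tensor_space C S n m e \<subseteq> tensor_space C T n m e"
  unfolding tensor_space_def by (rule pm.span_mono) (use assms in blast)

lemma tensor_space_subspace: "pm.subspace (tensor_space C S n m e)"
  by (simp add: tensor_space_def)

text \<open>The sum of all members in each arity and degree. Once it is shown to be a member itself,
  it is the object denoted by \<open>GREATEST\<close> in the definitions of both cooperads.\<close>

definition sup_family :: "((nat \<Rightarrow> int \<Rightarrow> ('a \<Rightarrow>\<^sub>0 'k::field) set) \<Rightarrow> bool) \<Rightarrow> nat \<Rightarrow> int \<Rightarrow> ('a \<Rightarrow>\<^sub>0 'k) set" where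
  "sup_family Q n e = pm.span (\<Union>S\<in>{S. Q S}. S n e)"

lemma sup_family_upper: "Q S \<Longrightarrow> S n e \<subseteq> sup_family Q n e"
  unfolding sup_family_def by (auto intro: pm.span_base)

lemma sup_family_lin:
  assumes "pm.subspace W" "\<And>S v. Q S \<Longrightarrow> v \<in> S n e \<Longrightarrow> lin f v \<in> W" "v \<in> sup_family Q n e"
  shows "lin f v \<in> W"
  by (rule lin_span[OF assms(3)[unfolded sup_family_def] assms(1)]) (use assms(2) in blast)

lemma sup_family_least:
  assumes "pm.subspace W" "\<And>S. Q S \<Longrightarrow> S n e \<subseteq> W"
  shows "sup_family Q n e \<subseteq> W"
  unfolding sup_family_def by (rule pm.span_minimal) (use assms in auto)

lemma subcooperad_cofree_iff:
  "subcooperad (cofree_cooperad X) S \<longleftrightarrow>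
    (\<forall>n e. pm.subspace (S n e) \<and> tree_null X n e \<subseteq> S n e \<and> S n e \<subseteq> tree_space X n e) \<and>
    (\<forall>n e \<sigma>. \<sigma> permutes {..<n} \<longrightarrow> (\<forall>v\<in>S n e. rel (inv \<sigma>) v \<in> S n e)) \<and>
    (\<forall>n m i e. i < n \<longrightarrow> (\<forall>v\<in>S (n + m - 1) e. lin (tree_decomp m i) v \<in> tensor_space (cofree_cooperad X) S n m e))"
  unfolding subcooperad_def cofree_simps tree_act_rel image_subset_iff by simp

lemma subcooperad_cofreeD:
  assumes "subcooperad (cofree_cooperad X) S"
  shows "pm.subspace (S n e)" "tree_null X n e \<subseteq> S n e" "S n e \<subseteq> tree_space X n e"
    "\<sigma> permutes {..<n} \<Longrightarrow> v \<in> S n e \<Longrightarrow> rel (inv \<sigma>) v \<in> S n e"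
    "i < n \<Longrightarrow> w \<in> S (n + m - 1) e \<Longrightarrow> lin (tree_decomp m i) w \<in> tensor_space (cofree_cooperad X) S n m e"
  using assms unfolding subcooperad_cofree_iff by simp_all

text \<open>All closure conditions are linear in the element, so they pass to sums. The member
  \<open>S0\<close> provides the null elements that every subcooperad must contain.\<close>

lemma subcooperad_sup:
  assumes "\<And>S. Q S \<Longrightarrow> subcooperad (cofree_cooperad X) S" "Q S0"
  shows "subcooperad (cofree_cooperad X) (sup_family Q)"
proof -
  let ?C = "cofree_cooperad X"
  note Q = subcooperad_cofreeD[OF assms(1)]
  have 1: "pm.subspace (sup_family Q n e)" for n e by (simp add: sup_family_def)
  have 2: "tree_null X n e \<subseteq> sup_family Q n e" for n e
    by (rule subset_trans[OF Q(2)[OF assms(2)] sup_family_upper[of Q, OF assms(2)]])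
  have 3: "sup_family Q n e \<subseteq> tree_space X n e" for n e
    by (rule sup_family_least[OF subspace_tree_space]) (rule Q(3))
  have 4: "rel (inv \<sigma>) v \<in> sup_family Q n e" if "\<sigma> permutes {..<n}" "v \<in> sup_family Q n e" for n e \<sigma> v
    unfolding rel_def
  proof (rule sup_family_lin[OF _ _ that(2)])
    show "pm.subspace (sup_family Q n e)" by (simp add: sup_family_def)
    fix S v assume S: "Q S" "v \<in> S n e"
    have "rel (inv \<sigma>) v \<in> S n e" by (rule Q(4)[OF S(1) that(1) S(2)])
    then show "lin (\<lambda>t. gen (relabel (inv \<sigma>) t)) v \<in> sup_family Q n e"
      using sup_family_upper[of Q S n e, OF S(1)] by (auto simp: rel_def)
  qed
  have 5: "lin (tree_decomp m i) v \<in> tensor_space ?C (sup_family Q) n m e"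
    if "i < n" "v \<in> sup_family Q (n + m - 1) e" for n m i e v
  proof (rule sup_family_lin[OF tensor_space_subspace _ that(2)])
    fix S v assume S: "Q S" "v \<in> S (n + m - 1) e"
    have "lin (tree_decomp m i) v \<in> tensor_space ?C S n m e" by (rule Q(5)[OF S(1) that(1) S(2)])
    then show "lin (tree_decomp m i) v \<in> tensor_space ?C (sup_family Q) n m e"
      using tensor_space_mono[of S "sup_family Q" ?C n m e] sup_family_upper[of Q S, OF S(1)] by blast
  qed
  show ?thesis
    unfolding subcooperad_cofree_iff by (intro conjI allI impI ballI 1 2 3 4 5)
qed

lemma Greatest_sup_family:
  assumes "Q (sup_family Q)"
  shows "(GREATEST S. Q S) = sup_family Q"
  by (rule Greatest_equality[where P = Q, OF assms]) (auto simp: le_fun_def dest: sup_family_upper)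

lemma twt_zero: "twt t = 0 \<Longrightarrow> \<exists>j. t = Leaf j"
  by (cases t) auto

lemma leaves_only:
  assumes "\<forall>t\<in>set ts. twt t = 0"
  shows "ts = map Leaf (concat (map leaves ts))" "length (concat (map leaves ts)) = length ts"
  using assms
proof (induct ts)
  case (Cons t ts)
  { case 1 then show ?case using Cons(1) twt_zero[of t] by auto }
  { case 2 then show ?case using Cons(2) twt_zero[of t] by auto }
qed auto

lemma tdegs_leaves: "\<forall>t\<in>set ts. twt t = 0 \<Longrightarrow> tdegs ts = 0"
proof (induct ts)
  case (Cons t ts)
  then show ?case using twt_zero[of t] by auto
qed simp

section \<open>Projection to the weight d part\<close>

locale wg_operad_weight = connected_wg_operad P for P :: "('k::field_char_0, 'p::ab_group_add) wg_operad" +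
  fixes d :: nat
  assumes d_pos: "d > 0"
begin

abbreviation "E \<equiv> susp (wt_coll P d)"

abbreviation "wspan K n e \<equiv> V.span (\<Union>k\<in>K. wpart P n k e)"

text \<open>The weight \<open>d\<close> component. Choice is used because the weight grading is
  given by independence of the parts and not by projections; \<open>wspan_disjoint\<close> makes the
  choice unique.\<close>

definition wproj :: "nat \<Rightarrow> int \<Rightarrow> 'p \<Rightarrow> 'p" where
  "wproj n e x = (SOME y. y \<in> wpart P n d e \<and> x - y \<in> wspan ({1..} - {d}) n e)"

lemma wspan_sum:
  assumes "z \<in> wspan K n e"
  shows "\<exists>F u. finite F \<and> F \<subseteq> K \<and> (\<forall>k\<in>F. u k \<in> wpart P n k e) \<and> z = (\<Sum>k\<in>F. u k)"
  using assms
proof (induct rule: V.span_induct_alt)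
  case base
  show ?case by (rule exI[of _ "{}"]) auto
next
  case (step c x y)
  then obtain k F u where k: "k \<in> K" "x \<in> wpart P n k e"
    and F: "finite F" "F \<subseteq> K" "\<forall>k\<in>F. u k \<in> wpart P n k e" "y = (\<Sum>k\<in>F. u k)" by blast
  \<comment> \<open>The weight \<open>k\<close> may already occur in \<open>F\<close>, in which case
    its two contributions must be added.\<close>
  let ?w = "\<lambda>j. (if j \<in> F then u j else 0) + (if j = k then scl P c x else 0)"
  have "(\<Sum>j\<in>insert k F. ?w j) = (\<Sum>j\<in>insert k F. if j \<in> F then u j else 0) + scl P c x"
    using F(1) by (simp add: sum.distrib del: sum.insert_remove)
  also have "(\<Sum>j\<in>insert k F. if j \<in> F then u j else 0) = (\<Sum>j\<in>F. u j)"
    by (rule sum.mono_neutral_cong_right) (use F(1) in auto)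
  finally have "scl P c x + y = (\<Sum>j\<in>insert k F. ?w j)" by (simp add: F(4) add.commute)
  moreover have "\<forall>j\<in>insert k F. ?w j \<in> wpart P n j e"
    using F(3) k(2) by (auto intro!: V.subspace_add V.subspace_scale V.subspace_0 wpart_subspace)
  ultimately show ?case using F k by (intro exI[of _ "insert k F"] exI[of _ ?w]) auto
qed

lemma wspan_disjoint:
  assumes "z \<in> wpart P n d e" "z \<in> wspan ({1..} - {d}) n e"
  shows "z = 0"
proof -
  obtain F u where F: "finite F" "F \<subseteq> {1..} - {d}" "\<forall>k\<in>F. u k \<in> wpart P n k e" "z = (\<Sum>k\<in>F. u k)"
    using wspan_sum[OF assms(2)] by blast
  \<comment> \<open>With \<open>- z\<close> as its weight \<open>d\<close> entry the family sums to
    zero, and independence applies to that entry.\<close>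
  let ?w = "u(d := - z)"
  have "?w d = 0"
  proof (rule wpart_direct[of "insert d F" ?w])
    show "(\<Sum>k\<in>insert d F. ?w k) = 0"
    proof -
      have "d \<notin> F" using F(2) by auto
      then have "(\<Sum>k\<in>F. ?w k) = (\<Sum>k\<in>F. u k)" by (intro sum.cong) auto
      then show ?thesis using F(1,4) \<open>d \<notin> F\<close> by simp
    qed
    show "?w k \<in> wpart P n k e" if "k \<in> insert d F" for k
      using that F(3) assms(1) V.subspace_neg[OF wpart_subspace] by auto
  qed (use F(1) in auto)
  then show ?thesis by simp
qed

lemma wproj_exists:
  assumes "x \<in> aug P n e"
  shows "\<exists>y. y \<in> wpart P n d e \<and> x - y \<in> wspan ({1..} - {d}) n e"
  using assms[unfolded aug_def]
proof (induct rule: V.span_induct_alt)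
  case base
  show ?case by (rule exI[of _ 0]) (auto simp: V.span_zero V.subspace_0 wpart_subspace)
next
  case (step c x y)
  then obtain k z where k: "k \<ge> 1" "x \<in> wpart P n k e"
    and z: "z \<in> wpart P n d e" "y - z \<in> wspan ({1..} - {d}) n e" by auto
  show ?case
  proof (cases "k = d")
    case True
    then show ?thesis using k z
      by (intro exI[of _ "scl P c x + z"]) (auto intro!: V.subspace_add V.subspace_scale wpart_subspace)
  next
    case False
    then have "x \<in> wspan ({1..} - {d}) n e" using k by (intro V.span_base) auto
    then have "scl P c x + (y - z) \<in> wspan ({1..} - {d}) n e" using z by (intro V.span_add V.span_scale)
    then show ?thesis using z by (intro exI[of _ z]) (simp add: algebra_simps)
  qed
qed

lemma wproj:
  assumes "x \<in> aug P n e"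
  shows "wproj n e x \<in> wpart P n d e" "x - wproj n e x \<in> wspan ({1..} - {d}) n e"
  using someI_ex[OF wproj_exists[OF assms]] unfolding wproj_def by auto

lemma wproj_eqI:
  assumes "x \<in> aug P n e" "y \<in> wpart P n d e" "x - y \<in> wspan ({1..} - {d}) n e"
  shows "wproj n e x = y"
proof -
  have "wproj n e x - y \<in> wpart P n d e"
    using wproj(1)[OF assms(1)] assms(2) by (intro V.subspace_diff wpart_subspace)
  moreover have "(x - y) - (x - wproj n e x) \<in> wspan ({1..} - {d}) n e"
    using assms(3) wproj(2)[OF assms(1)] by (rule V.span_diff)
  ultimately show ?thesis using wspan_disjoint[of "wproj n e x - y" n e] by simp
qed

lemma wproj_weight: "x \<in> wpart P n d e \<Longrightarrow> wproj n e x = x"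
  using d_pos by (intro wproj_eqI) (auto simp: V.span_zero intro: wpart_aug)

lemma wproj_other_weight: "x \<in> wpart P n k e \<Longrightarrow> k \<ge> 1 \<Longrightarrow> k \<noteq> d \<Longrightarrow> wproj n e x = 0"
  by (intro wproj_eqI) (auto simp: V.subspace_0 wpart_subspace intro: wpart_aug V.span_base)

lemma wproj_linear:
  assumes "x \<in> aug P n e" "y \<in> aug P n e"
  shows "wproj n e (scl P c x + scl P c' y) = scl P c (wproj n e x) + scl P c' (wproj n e y)"
proof (rule wproj_eqI)
  show "scl P c x + scl P c' y \<in> aug P n e" using assms by (simp add: aug_closed)
  show "scl P c (wproj n e x) + scl P c' (wproj n e y) \<in> wpart P n d e"
    using wproj(1) assms by (intro V.subspace_add V.subspace_scale wpart_subspace)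
  have "scl P c (x - wproj n e x) + scl P c' (y - wproj n e y) \<in> wspan ({1..} - {d}) n e"
    using wproj(2) assms by (intro V.span_add V.span_scale)
  then show "scl P c x + scl P c' y - (scl P c (wproj n e x) + scl P c' (wproj n e y)) \<in> wspan ({1..} - {d}) n e"
    by (simp add: algebra_simps)
qed

lemma act_wspan:
  assumes "\<sigma> permutes {..<n}" "x \<in> wspan K n e"
  shows "x \<in> whole P n e" "act P n \<sigma> x \<in> wspan K n e"
proof -
  have "x \<in> {x. x \<in> whole P n e \<and> act P n \<sigma> x \<in> wspan K n e}"
    using assms(2)
  proof (rule V.span_minimal[THEN set_mp, rotated 2])
    have "act P n \<sigma> y \<in> wspan K n e" if "k \<in> K" "y \<in> wpart P n k e" for k y
      using act_wpart[OF assms(1) that(2)] that(1) by (intro V.span_base) auto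
    then show "(\<Union>k\<in>K. wpart P n k e) \<subseteq> {x. x \<in> whole P n e \<and> act P n \<sigma> x \<in> wspan K n e}"
      using wpart_whole by auto
    show "V.subspace {x. x \<in> whole P n e \<and> act P n \<sigma> x \<in> wspan K n e}"
      by (rule V.subspaceI)
        (auto simp: act_add[OF assms(1)] act_scale[OF assms(1)] act_zero[OF assms(1)] whole_closed
          V.span_zero V.span_add V.span_scale)
  qed
  then show "x \<in> whole P n e" "act P n \<sigma> x \<in> wspan K n e" by auto
qed

lemma wproj_act:
  assumes "\<sigma> permutes {..<n}" "x \<in> aug P n e"
  shows "wproj n e (act P n \<sigma> x) = act P n \<sigma> (wproj n e x)"
proof (rule wproj_eqI[OF act_aug[OF assms]])
  note w = wproj[OF assms(2)]
  show "act P n \<sigma> (wproj n e x) \<in> wpart P n d e" using w(1) by (rule act_wpart[OF assms(1)])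
  have "act P n \<sigma> x = act P n \<sigma> ((x - wproj n e x) + wproj n e x)" by simp
  also have "\<dots> = act P n \<sigma> (x - wproj n e x) + act P n \<sigma> (wproj n e x)"
    using act_wspan(1)[OF assms(1) w(2)] wpart_whole[OF w(1)] by (rule act_add[OF assms(1)])
  finally show "act P n \<sigma> x - act P n \<sigma> (wproj n e x) \<in> wspan ({1..} - {d}) n e"
    using act_wspan(2)[OF assms(1) w(2)] by simp
qed

lemma E_D: "x \<in> csp E n e \<Longrightarrow> x \<in> csp D n e"
  using d_pos wpart_aug by auto

lemma decorated_E_D: "decorated E t \<Longrightarrow> decorated D t"
  by (induct t) (use E_D in auto)

lemma trees_E_D: "trees E n e \<subseteq> trees D n e"
  using decorated_E_D by (auto simp: trees_def)

lemma tree_space_E_D: "tree_space E n e \<subseteq> tree_space D n e"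
  using trees_E_D by (fastforce simp: tree_space_iff)

lemma tmap_id: "tmap (\<lambda>n e x. x) t = t"
  by (induct t) (auto intro: map_idI)

lemma null_E_D: "v \<in> null E \<Longrightarrow> v \<in> null D"
  using null_tmap[of E "\<lambda>n e x. x" D v, OF E_D] by (simp add: tmap_id)

lemma tree_null_E_D: "tree_null E n e \<subseteq> tree_null D n e"
  unfolding subset_iff coll.tree_null_iff[OF coll_wt] coll.tree_null_iff[OF coll_D]
  using null_E_D trees_E_D by blast

abbreviation wmap :: "'p tree \<Rightarrow> 'p tree" where
  "wmap \<equiv> tmap (\<lambda>n e. wproj n (e - 1))"

abbreviation wlin :: "('p tree \<Rightarrow>\<^sub>0 'k) \<Rightarrow> ('p tree \<Rightarrow>\<^sub>0 'k)" where
  "wlin \<equiv> lin (\<lambda>t. gen (wmap t))"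

lemma wmap_E: "decorated E t \<Longrightarrow> wmap t = t"
  by (induct t) (auto simp: wproj_weight intro: map_idI)

lemma wlin_E:
  assumes "v \<in> tree_space E n e"
  shows "wlin v = v"
proof -
  have "wlin v = lin gen v"
    by (rule lin_ext_cong) (use assms wmap_E in \<open>auto simp: tree_space_iff trees_def\<close>)
  then show ?thesis by simp
qed

lemma wmap_csp: "x \<in> csp D n e \<Longrightarrow> wproj n (e - 1) x \<in> csp E n e"
  using wproj(1) by simp

lemma wmap_trees: "t \<in> trees D n e \<Longrightarrow> wmap t \<in> trees E n e"
  using decorated_tmap[of D "\<lambda>n e. wproj n (e - 1)" E t, OF wmap_csp] by (auto simp: trees_def)

lemma wlin_null: "v \<in> null D \<Longrightarrow> wlin v \<in> null E"
  by (rule null_tmap) (use wmap_csp wproj_linear wproj_act in auto)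

lemma wlin_tree_space: "v \<in> tree_space D n e \<Longrightarrow> wlin v \<in> tree_space E n e"
  by (rule lin_in_subspace[OF subspace_tree_space]) (use wmap_trees in \<open>auto simp: tree_space_iff\<close>)

lemma wlin_tree_null: "v \<in> tree_null D n e \<Longrightarrow> wlin v \<in> tree_null E n e"
  using wlin_null wlin_tree_space coll.tree_null_iff[OF coll_wt] coll.tree_null_iff[OF coll_D]
  by (simp add: tree_space_iff)

text \<open>A retraction argument: \<open>wlin\<close> sends the relations over \<open>D\<close> to
  relations over \<open>E\<close> and fixes the elements of \<open>tree_space E\<close>.\<close>

lemma tree_null_D_E:
  assumes "v \<in> tree_null D n e" "v \<in> tree_space E n e"
  shows "v \<in> tree_null E n e"
  using wlin_tree_null[OF assms(1)] wlin_E[OF assms(2)] by simp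

lemma null_zero_vertex:
  assumes "coll X" "\<forall>t\<in>set ts. decorated X t"
  shows "gen (Node e 0 ts) \<in> null X"
proof -
  interpret coll X by fact
  \<comment> \<open>With all coefficients zero the linear relation reduces to its first tree, whose
    root is decorated by zero.\<close>
  have "gen (Node e (cscale X 0 0 + cscale X 0 0) ts) - pscale 0 (gen (Node e 0 ts)) - pscale 0 (gen (Node e 0 ts)) \<in> null X"
    by (rule null_linear) (use assms csp_zero in auto)
  then show ?thesis by simp
qed

text \<open>Contracting an edge produces a vertex of weight \<open>2 d\<close>, which the projection annihilates.\<close>

lemma wlin_bar:
  "decorated E t \<Longrightarrow> wlin (bar_tree P t) \<in> null E"
proof (induct t)
  case (Leaf j)
  then show ?case by (simp add: pm.span_zero)
next
  case (Node e x ts)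
  show ?case
    unfolding bar_tree_Node lin_ssum
  proof (rule ssum_in_subspace[OF subspace_null])
    fix a t b assume ts: "ts = a @ t # b"
    have dec: "\<forall>t\<in>set (a @ b). decorated E t" "decorated E t" using Node(2) ts by auto
    have x: "x \<in> wpart P (length a + 1 + length b) d (e - 1)" using Node(2) ts by simp
    have fix_list: "map wmap us = us" if "\<forall>t\<in>set us. decorated E t" for us
      using that by (auto intro: map_idI wmap_E)
    have "wlin (contract P e x a b t) \<in> null E"
    proof (cases t)
      case (Leaf j)
      then show ?thesis by (simp add: pm.span_zero)
    next
      case (Node f y us)
      let ?z = "pcomp P (length a + 1 + length b) (length us) (length a) x y"
      have "?z \<in> wpart P (length a + 1 + length b + length us - 1) (d + d) ((e - 1) + (f - 1))"
        by (rule pcomp_wpart) (use x dec Node in auto)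
      then have "?z \<in> wpart P (length (a @ us @ b)) (d + d) (e + f - 1 - 1)"
        by (simp add: algebra_simps)
      from wproj_other_weight[OF this] have "wproj (length (a @ us @ b)) (e + f - 1 - 1) ?z = 0"
        using d_pos by simp
      then have "wlin (contract P e x a b t) = pscale (ksign (f * tdegs a + (e - 1)))
          (gen (Node (e + f - 1) 0 (map wmap (a @ us @ b))))"
        by (simp add: Node lin_simps)
      also have "map wmap (a @ us @ b) = a @ us @ b"
        by (rule fix_list) (use dec Node in auto)
      finally show ?thesis
        using dec Node by (simp only:) (intro pm.span_scale null_zero_vertex coll_wt, auto)
    qed
    moreover have "wlin (node_ctx e x a b (bar_tree P t)) \<in> null E"
    proof -
      have "wlin (node_ctx e x a b (bar_tree P t)) = node_ctx e x a b (wlin (bar_tree P t))"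
        using wproj_weight[OF x] dec
        by (simp add: lin_node_ctx node_ctx_lin node_ctx_gen fix_list)
      also have "\<dots> \<in> null E"
        by (rule null_node_ctx) (use Node(1) x dec ts in auto)
      finally show ?thesis .
    qed
    ultimately show "wlin (bar_at P e x a b t) \<in> null E"
      unfolding bar_at_def lin_add lin_pscale by (intro pm.span_add pm.span_scale)
  qed
qed

section \<open>Evaluation of trees with two vertices\<close>

text \<open>Coordinates on the weight one part: a corolla is brought to the standard order of its
  leaves and the resulting decoration is read off. The default zero on all other trees makes the
  value defined on every relator, in particular on those in a context.\<close>

definition corolla_value :: "'p tree \<Rightarrow> 'p" where
  "corolla_value t = (case t of Leaf j \<Rightarrow> 0 | Node e x ts \<Rightarrow>
    if twt t = 1 \<and> mset (leaves t) = mset_set {..<length ts}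
    then act P (length ts) (inv (leaf_perm t)) x else 0)"

lemma corolla_value_Node:
  "length ts = n \<Longrightarrow> corolla_value (Node e x ts) =
    (if twt (Node e x ts) = 1 \<and> mset (leaves (Node e x ts)) = mset_set {..<n}
     then act P n (inv (leaf_perm (Node e x ts))) x else 0)"
  by (simp add: corolla_value_def)

lemma leaf_perm_cong: "leaves t = leaves t' \<Longrightarrow> leaf_perm t = leaf_perm t'"
  by (simp add: leaf_perm_def fun_eq_iff)

lemma leaf_perm_permutes:
  assumes "mset (leaves t) = mset_set {..<n}"
  shows "leaf_perm t permutes {..<n}"
proof -
  have l: "distinct (leaves t)" "set (leaves t) = {..<n}"
    using distinct_leaves_iff[of "{..<n}" "leaves t"] assms by auto
  then have n: "length (leaves t) = n" by (metis card_lessThan distinct_card)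
  have "bij_betw (\<lambda>k. leaves t ! k) {..<n} {..<n}"
    using bij_betw_nth[OF l(1), of "{..<n}"] l(2) n by auto
  then have "bij_betw (leaf_perm t) {..<n} {..<n}"
    by (rule bij_betw_cong[THEN iffD1, rotated]) (auto simp: leaf_perm_def n)
  then show ?thesis by (rule bij_imp_permutes) (auto simp: leaf_perm_def n)
qed

lemma lin_ext_null:
  assumes "v \<in> pm.span S" "\<And>r. r \<in> S \<Longrightarrow> lin_ext (scl P) f r = 0"
  shows "lin_ext (scl P) f v = 0"
  using assms(1)
proof (induct rule: pm.span_induct_alt)
  case (step c x y)
  then show ?case using assms(2) by (simp add: lin_ext_add[OF vs] lin_ext_pscale[OF vs])
qed simp

text \<open>At a corolla the siblings are leaves of degree zero, so exchanging them has sign one and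
  the order of the leaves absorbs the transposition. A relator in a context has at least two
  vertices in every term, where the value is zero.\<close>

lemma corolla_value_null:
  assumes "v \<in> null D"
  shows "lin_ext (scl P) corolla_value v = 0"
  using assms
proof (rule lin_ext_null)
  fix r assume "r \<in> drel D"
  then show "lin_ext (scl P) corolla_value r = 0"
  proof cases
    case (linear x ts e y c c')
    let ?t = "\<lambda>x. Node e x ts"
    have lp: "leaf_perm (?t z) = leaf_perm (?t x)" for z by (rule leaf_perm_cong) simp
    have v: "corolla_value (?t z) = (if twt (?t x) = 1 \<and> mset (leaves (?t x)) = mset_set {..<length ts}
      then act P (length ts) (inv (leaf_perm (?t x))) z else 0)" for z
      using lp[of z] by (simp add: corolla_value_def)
    have xy: "x \<in> whole P (length ts) (e - 1)" "y \<in> whole P (length ts) (e - 1)"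
      using linear aug_whole by auto
    show ?thesis
    proof (cases "twt (?t x) = 1 \<and> mset (leaves (?t x)) = mset_set {..<length ts}")
      case True
      then have p: "inv (leaf_perm (?t x)) permutes {..<length ts}"
        by (intro permutes_inv leaf_perm_permutes) auto
      have "act P (length ts) (inv (leaf_perm (?t x))) (scl P c x + scl P c' y)
        = scl P c (act P (length ts) (inv (leaf_perm (?t x))) x) + scl P c' (act P (length ts) (inv (leaf_perm (?t x))) y)"
        using xy by (subst act_add[OF p, of _ "e - 1"]) (simp_all add: act_scale[OF p, of _ "e - 1"] whole_closed)
      moreover have "corolla_value (?t z) = act P (length ts) (inv (leaf_perm (?t x))) z" for z
        by (subst v) (rule if_P[OF True])
      ultimately show ?thesis
        by (simp add: linear(1) lin_ext_diff[OF vs] lin_ext_pscale[OF vs] lin_ext_gen[OF vs])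
    next
      case False
      have "corolla_value (?t z) = 0" for z
        by (subst v) (rule if_not_P[OF False])
      then show ?thesis
        by (simp add: linear(1) lin_ext_diff[OF vs] lin_ext_pscale[OF vs] lin_ext_gen[OF vs])
    qed
  next
    case (swap x A B e t t')
    let ?n = "length A + 2 + length B" and ?s = "adj (length A)"
    let ?t = "Node e (act P ?n ?s x) (A @ t # t' # B)" and ?t' = "Node e x (A @ t' # t # B)"
    have x: "x \<in> whole P ?n (e - 1)" using swap aug_whole by auto
    have len: "length (A @ t # t' # B) = ?n" "length (A @ t' # t # B) = ?n" by auto
    have "corolla_value ?t = scl P (ksign (tdeg t * tdeg t')) (corolla_value ?t')"
    proof (cases "twt ?t = 1 \<and> mset (leaves ?t) = mset_set {..<?n}")
      case True
      then have True': "twt ?t' = 1 \<and> mset (leaves ?t') = mset_set {..<?n}"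
        by (auto simp: ac_simps)
      have "\<forall>u\<in>set (A @ t # t' # B). twt u = 0" using True by auto
      then obtain j j' where j: "t = Leaf j" "t' = Leaf j'" using twt_zero by (metis in_set_conv_decomp list.set_intros set_append UnI2 insert_iff list.set(2))
      have A: "A = map Leaf (concat (map leaves A))" "length (concat (map leaves A)) = length A"
        using leaves_only[of A] True by auto
      \<comment> \<open>Exchanging two single leaves transposes the list of labels; in the value
        this cancels the action on the decoration.\<close>
      have lp: "leaf_perm ?t' = leaf_perm ?t \<circ> ?s"
      proof -
        have l: "leaves ?t = concat (map leaves A) @ j # j' # concat (map leaves B)"
          "leaves ?t' = concat (map leaves A) @ j' # j # concat (map leaves B)" using j by auto
        have "leaves ?t' ! k = leaves ?t ! ?s k" for k
          unfolding l using nth_adj_append_two[of "concat (map leaves A)" j j' "concat (map leaves B)" k] A(2) by simp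
        moreover have "?s k < length (leaves ?t) \<longleftrightarrow> k < length (leaves ?t)" for k
          unfolding l using A(2) by (auto simp: transpose_def)
        moreover have "length (leaves ?t') = length (leaves ?t)" unfolding l by simp
        moreover have "?s k = k" if "\<not> k < length (leaves ?t)" for k
          using that A(2) unfolding l by (auto simp: transpose_def)
        ultimately show ?thesis by (auto simp: fun_eq_iff leaf_perm_def simp del: leaves.simps)
      qed
      have p: "leaf_perm ?t permutes {..<?n}" "leaf_perm ?t' permutes {..<?n}"
        using True True' by (auto intro!: leaf_perm_permutes simp del: leaves.simps)
      have s: "?s permutes {..<?n}" by (rule adj_permutes) simp
      have "inv (leaf_perm ?t') = ?s \<circ> inv (leaf_perm ?t)"
        unfolding lp using permutes_bij[OF p(1)] by (subst o_inv_distrib) auto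
      then have "act P ?n (inv (leaf_perm ?t)) (act P ?n ?s x) = act P ?n (inv (leaf_perm ?t')) x"
        using act_comp[OF s permutes_inv[OF p(1)] x] by simp
      moreover have "corolla_value ?t = act P ?n (inv (leaf_perm ?t)) (act P ?n ?s x)"
        by (rule trans[OF corolla_value_Node[OF len(1)] if_P[OF True]])
      moreover have "corolla_value ?t' = act P ?n (inv (leaf_perm ?t')) x"
        by (rule trans[OF corolla_value_Node[OF len(2)] if_P[OF True']])
      moreover have "ksign (tdeg t * tdeg t') = (1 :: 'k)" by (simp add: j)
      ultimately show ?thesis by (simp only: V.scale_one)
    next
      case False
      have False': "\<not> (twt ?t' = 1 \<and> mset (leaves ?t') = mset_set {..<?n})"
        using False by (auto simp: ac_simps)
      have "corolla_value ?t = 0" by (rule trans[OF corolla_value_Node[OF len(1)] if_not_P[OF False]])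
      moreover have "corolla_value ?t' = 0" by (rule trans[OF corolla_value_Node[OF len(2)] if_not_P[OF False']])
      ultimately show ?thesis by (simp only: V.scale_zero_right)
    qed
    then show ?thesis
      by (simp add: swap(1) lin_ext_diff[OF vs] lin_ext_pscale[OF vs] lin_ext_gen[OF vs])
  next
    case (ctx r' x a b e)
    have "corolla_value t = 0" if t: "t \<in> Poly_Mapping.keys r" for t
    proof -
      obtain t1 where t1: "t = Node e x (a @ t1 # b)" "t1 \<in> Poly_Mapping.keys r'"
        using t unfolding ctx(1) keys_node_ctx by blast
      then have "twt t1 > 0" using drel_keys[OF coll_D ctx(2)] by blast
      then show ?thesis by (simp add: corolla_value_def t1(1))
    qed
    then show ?thesis by (simp add: lin_ext_def)
  qed
qed

text \<open>Equivariance for the permutation of the leaves; no sign arises because leaves have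
  degree zero.\<close>

lemma corolla_normal_form:
  assumes "t \<in> trees D n e" "twt t = 1"
  shows "corolla_value t \<in> aug P n (e - 1)"
    "gen t - gen (Node e (corolla_value t) (map Leaf [0..<n])) \<in> null D"
proof -
  interpret D: coll D by (rule coll_D)
  obtain e' x ts where t: "t = Node e' x ts" using assms(2) by (cases t) auto
  have m: "mset (leaves t) = mset_set {..<n}"
    using assms(1) distinct_leaves_iff[of "{..<n}" "leaves t"] by (auto simp: trees_def)
  have ts: "\<forall>u\<in>set ts. twt u = 0" using assms(2) by (auto simp: t)
  note L = leaves_only[OF ts]
  have len: "length ts = n" "length (leaves t) = n"
    using L(2) m by (auto simp: t) (metis card_lessThan size_mset size_mset_set)+
  have tdeg: "tdegs ts = 0" by (rule tdegs_leaves[OF ts])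
  then have e: "e' = e" using assms(1) by (auto simp: t trees_def)
  have x: "x \<in> aug P n (e - 1)" using assms(1) len by (auto simp: t e trees_def)
  let ?p = "leaf_perm t"
  have p: "?p permutes {..<n}" by (rule leaf_perm_permutes[OF m])
  have v: "corolla_value t = act P n (inv ?p) x"
    using assms(2) m len by (simp add: corolla_value_def t)
  show "corolla_value t \<in> aug P n (e - 1)" unfolding v by (rule act_aug[OF permutes_inv[OF p] x])
  let ?L = "map Leaf [0..<n] :: 'p tree list"
  have "gen (Node e (cact D (length ?L) (inv ?p) x) ?L)
      - pscale (perm_sign (length ?L) (inv ?p) (\<lambda>i. tdeg (?L ! i)))
          (gen (Node e x (permute_list (inv (inv ?p)) ?L))) \<in> null D"
    by (rule D.null_equivariance) (use permutes_inv[OF p] x in auto)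
  moreover have "perm_sign (length ?L) (inv ?p) (\<lambda>i. tdeg (?L ! i)) = (1 :: 'k)"
    unfolding perm_sign_def by (rule prod.neutral) auto
  moreover have "permute_list (inv (inv ?p)) ?L = ts"
  proof -
    have "permute_list ?p ?L = map Leaf (leaves t)"
    proof (rule nth_equalityI)
      fix i assume "i < length (permute_list ?p ?L)"
      then have i: "i < n" by simp
      then have "?p i < n" "?p i = leaves t ! i"
        using permutes_in_image[OF p, of i] by (simp_all add: leaf_perm_def len)
      then show "permute_list ?p ?L ! i = map Leaf (leaves t) ! i"
        using i permute_list_nth[of ?p ?L i] p by (simp add: len)
    qed (simp add: len)
    also have "\<dots> = ts" using L(1) by (simp add: t)
    finally show ?thesis by (simp add: inv_inv_eq permutes_bij[OF p])
  qed
  ultimately have "gen (Node e (act P n (inv ?p) x) ?L) - gen t \<in> null D"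
    by (simp add: t e)
  from pm.span_neg[OF this] show "gen t - gen (Node e (corolla_value t) ?L) \<in> null D"
    by (simp add: v)
qed

text \<open>The weight one part of the cofree cooperad is the suspended augmentation ideal:
  \<open>v\<close> is congruent to the single standard corolla decorated by its value. This turns
  vanishing of the differential in weight two into an equation in \<open>P\<close>.\<close>

lemma corolla_null_iff:
  assumes v: "v \<in> tree_space D n e" and w: "\<forall>t\<in>Poly_Mapping.keys v. twt t = 1"
  shows "v \<in> null D \<longleftrightarrow> lin_ext (scl P) corolla_value v = 0"
proof
  assume 0: "lin_ext (scl P) corolla_value v = 0"
  interpret D: coll D by (rule coll_D)
  let ?c = "\<lambda>y. gen (Node e y (map Leaf [0..<n])) :: 'p tree \<Rightarrow>\<^sub>0 'k"
  have "v \<in> pm.span (gen ` {t \<in> trees D n e. twt t = 1})"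
    using v w by (auto simp: tree_space_iff span_gen_iff)
  \<comment> \<open>Both statements are proved together, since the linear relation for standard
    corollas needs the values to lie in the augmentation ideal.\<close>
  then have "lin_ext (scl P) corolla_value v \<in> aug P n (e - 1) \<and>
      v - ?c (lin_ext (scl P) corolla_value v) \<in> null D"
  proof (induct rule: pm.span_induct_alt)
    case base
    then show ?case using null_zero_vertex[OF coll_D, of "map Leaf [0..<n]" e] pm.span_neg
      by (auto simp: aug_closed)
  next
    case (step c u w)
    then obtain t where t: "u = gen t" "t \<in> trees D n e" "twt t = 1" by auto
    let ?w = "lin_ext (scl P) corolla_value w"
    have n: "corolla_value t \<in> aug P n (e - 1)" "gen t - ?c (corolla_value t) \<in> null D"
      using corolla_normal_form[OF t(2,3)] by auto
    have "?c (scl P c (corolla_value t) + scl P 1 ?w) - pscale c (?c (corolla_value t)) - pscale 1 (?c ?w) \<in> null D"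
      using null_linear[of "corolla_value t" D "map Leaf [0..<n]" e ?w c 1] n(1) step(2) by simp
    moreover have "pscale c (gen t - ?c (corolla_value t)) + (w - ?c ?w) \<in> null D"
      using n(2) step(2) by (intro pm.span_add pm.span_scale) auto
    ultimately have "(pscale c (gen t - ?c (corolla_value t)) + (w - ?c ?w))
      - (?c (scl P c (corolla_value t) + scl P 1 ?w) - pscale c (?c (corolla_value t)) - pscale 1 (?c ?w)) \<in> null D"
      by (rule pm.span_diff[rotated])
    then have "pscale c (gen t) + w - ?c (scl P c (corolla_value t) + ?w) \<in> null D"
      by (simp add: pm.scale_right_diff_distrib algebra_simps)
    then show ?case using n(1) step(2)
      by (simp add: t(1) lin_ext_add[OF vs] lin_ext_pscale[OF vs] lin_ext_gen[OF vs] aug_closed)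
  qed
  then have "v - ?c 0 \<in> null D" by (simp add: 0)
  from pm.span_add[OF this null_zero_vertex[OF coll_D, of "map Leaf [0..<n]" e]]
  show "v \<in> null D" by simp
qed (rule corolla_value_null)

end

section \<open>Suspension and trees with few vertices\<close>

lemma leaves_susp_tree [simp]: "leaves (susp_tree t) = leaves t"
  by (induct t) (auto simp: comp_def cong: map_cong)

lemma twt_susp_tree [simp]: "twt (susp_tree t) = twt t"
  by (induct t) (auto simp: comp_def cong: map_cong)

text \<open>In weight two this is the shift between the degrees \<open>e - 2\<close> and
  \<open>e\<close> of the relations and the corelations.\<close>

lemma tdeg_susp_tree: "tdeg (susp_tree t) = tdeg t + int (twt t)"
proof (induct t)
  case (Node e x ts)
  have "tdegs (map susp_tree us) = tdegs us + int (sum_list (map twt us))" if "set us \<subseteq> set ts" for us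
    using that Node by (induct us) auto
  then show ?case by simp
qed simp

lemma decorated_susp_tree: "decorated (susp X) (susp_tree t) \<longleftrightarrow> decorated X t"
  by (induct t) auto

lemma susp_tree_trees: "t \<in> trees X n e \<Longrightarrow> susp_tree t \<in> trees (susp X) n (e + int (twt t))"
  by (auto simp: trees_def decorated_susp_tree tdeg_susp_tree)

primrec desusp_tree :: "'p tree \<Rightarrow> 'p tree" where
  "desusp_tree (Leaf l) = Leaf l"
| "desusp_tree (Node e x ts) = Node (e - 1) x (map desusp_tree ts)"

lemma susp_desusp: "susp_tree (desusp_tree t) = t"
  by (induct t) (auto intro: map_idI)

lemma susp_tree_leaves: "\<forall>t\<in>set ts. twt t = 0 \<Longrightarrow> map susp_tree ts = ts"
  by (rule map_idI) (metis susp_tree.simps(1) twt_zero)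

lemma desusp_tree_trees:
  assumes "t \<in> trees (susp X) n e"
  shows "desusp_tree t \<in> trees X n (e - int (twt t))"
proof -
  let ?u = "desusp_tree t"
  have "decorated X ?u" "leaves ?u = leaves t" "twt ?u = twt t" "tdeg ?u + int (twt ?u) = tdeg t"
    using assms decorated_susp_tree[of X ?u] leaves_susp_tree[of ?u] twt_susp_tree[of ?u] tdeg_susp_tree[of ?u]
    by (auto simp: susp_desusp trees_def)
  then show ?thesis using assms by (auto simp: trees_def)
qed

lemma keys_bar_pos: "t' \<in> Poly_Mapping.keys (bar_tree P t) \<Longrightarrow> twt t' > 0"
proof (cases t)
  case (Node e x ts)
  assume "t' \<in> Poly_Mapping.keys (bar_tree P t)"
  then obtain a t b where "t' \<in> Poly_Mapping.keys (bar_at P e x a b t)"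
    using subsetD[OF keys_ssum] unfolding Node bar_tree_Node by fastforce
  from keys_bar_at[OF this] show ?thesis by (auto dest!: keys_contract)
qed simp

lemma bar_small:
  assumes "twt t \<le> 1"
  shows "bar_tree P t = 0"
proof -
  have "t' \<notin> Poly_Mapping.keys (bar_tree P t)" for t'
    using keys_bar_tree[of t' P t] keys_bar_pos[of t' P t] assms by auto
  then show ?thesis by (metis all_not_in_conv keys_eq_empty)
qed

lemma bar_at_leaf: "twt t = 0 \<Longrightarrow> bar_at P e x a b t = 0"
  by (drule twt_zero) (auto simp: bar_at_def node_ctx_simps)

lemma ssum_bar_at_leaves:
  assumes "\<forall>t\<in>set ts. twt t = 0"
  shows "ssum ts (\<lambda>a t b. bar_at P e x (f a) (g b) t) = 0"
proof -
  have "ssum ts (\<lambda>a t b. bar_at P e x (f a) (g b) t) = ssum ts (\<lambda>a t b. 0)"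
    by (rule ssum_cong[OF refl]) (use assms bar_at_leaf in auto)
  then show ?thesis by simp
qed

lemma two_vertices:
  assumes "twt t = 2"
  obtains e x a f y us b where "t = Node e x (a @ Node f y us # b)"
    "\<forall>t\<in>set (a @ us @ b). twt t = 0"
proof -
  obtain e x ts where t: "t = Node e x ts" using assms by (cases t) auto
  have s: "sum_list (map twt ts) = 1" using assms t by simp
  have "\<exists>u\<in>set ts. twt u \<noteq> 0"
  proof (rule ccontr)
    assume "\<not> ?thesis"
    then have "sum_list (map twt ts) = 0" by simp
    then show False using s by simp
  qed
  then obtain u where u: "u \<in> set ts" "twt u \<noteq> 0" by blast
  obtain a b where ts: "ts = a @ u # b" using u(1) by (meson split_list)
  obtain f y us where uN: "u = Node f y us" using u(2) by (cases u) auto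
  have "sum_list (map twt a) + sum_list (map twt us) + sum_list (map twt b) = 0" using s ts uN by simp
  then have "\<forall>t\<in>set (a @ us @ b). twt t = 0" by auto
  then show thesis using that t ts uN by blast
qed

context connected_wg_operad
begin

lemma fill_units:
  assumes "x \<in> whole P n e" "i + k \<le> n"
  shows "fill P n i x (replicate k (1, ounit P) @ zs) = fill P n (i + k) x zs"
  using assms
proof (induct k arbitrary: i)
  case (Suc k)
  then show ?case using Suc(1)[of "Suc i"] pcomp_unit_right[of i n x e] by simp
qed simp

lemma planar_eval_leaves:
  assumes "\<forall>t\<in>set ts. twt t = 0"
  shows "zip (map (\<lambda>t. length (leaves t)) ts) (map (planar_eval P) ts) = replicate (length ts) (1, ounit P)"
  using assms
proof (induct ts)
  case (Cons t ts)
  then show ?case using twt_zero[of t] by auto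
qed simp

text \<open>Leaves evaluate to the unit, so \<open>fill\<close> performs a single nontrivial
  composition: the one that the bar differential performs when it contracts the only inner
  edge.\<close>

lemma planar_eval_two:
  assumes t: "t = Node e x (a @ Node f y us # b)" and leaves: "\<forall>t\<in>set (a @ us @ b). twt t = 0"
    and x: "x \<in> wpart P (length a + 1 + length b) k e'" and y: "y \<in> wpart P (length us) l f'"
  shows "planar_eval P t = pcomp P (length a + 1 + length b) (length us) (length a) x y"
proof -
  let ?n = "length a + 1 + length b" and ?m = "length us"
  have la: "zip (map (\<lambda>t. length (leaves t)) a) (map (planar_eval P) a) = replicate (length a) (1, ounit P)"
    "zip (map (\<lambda>t. length (leaves t)) b) (map (planar_eval P) b) = replicate (length b) (1, ounit P)"
    "zip (map (\<lambda>t. length (leaves t)) us) (map (planar_eval P) us) = replicate ?m (1, ounit P)"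
    using leaves planar_eval_leaves[of a] planar_eval_leaves[of b] planar_eval_leaves[of us] by auto
  have u: "planar_eval P (Node f y us) = y"
    using fill_units[OF wpart_whole[OF y], of 0 ?m "[]"] by (simp add: la)
  have ll: "length (leaves (Node f y us)) = ?m"
    using leaves_only(2)[of us] leaves by simp
  let ?z = "pcomp P ?n ?m (length a) x y"
  have z: "?z \<in> whole P (?n + ?m - 1) (e' + f')"
    using pcomp_wpart[OF _ x y, of "length a"] by (intro wpart_whole) auto
  have "planar_eval P t = fill P ?n 0 x (replicate (length a) (1, ounit P) @ (?m, y) # replicate (length b) (1, ounit P) @ [])"
    using ll la u by (simp add: t)
  also have "\<dots> = fill P ?n (length a) x ((?m, y) # replicate (length b) (1, ounit P) @ [])"
    using fill_units[OF wpart_whole[OF x], of 0 "length a"] by simp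
  also have "\<dots> = fill P (?n + ?m - 1) (length a + ?m) ?z (replicate (length b) (1, ounit P) @ [])"
    by simp
  also have "\<dots> = ?z"
    using fill_units[OF z, of "length a + ?m" "length b" "[]"] by simp
  finally show ?thesis .
qed

lemma bar_tree_space:
  assumes "v \<in> tree_space D n e"
  shows "bar_diff P v \<in> tree_space D n (e - 1)"
  unfolding bar_diff_def
proof (rule lin_in_subspace[OF subspace_tree_space])
  fix t assume "t \<in> Poly_Mapping.keys v"
  then have t: "t \<in> trees D n e" using assms by (auto simp: tree_space_iff)
  have "Poly_Mapping.keys (bar_tree P t) \<subseteq> trees D n (e - 1)"
    using t keys_bar_tree[of _ P t] bar_decorated[of t] by (auto simp: trees_def)
  then show "bar_tree P t \<in> tree_space D n (e - 1)" by (simp add: tree_space_iff)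
qed

end

section \<open>Weight components\<close>

lemma keys_wt_proj: "Poly_Mapping.keys (wt_proj w v) \<subseteq> {t \<in> Poly_Mapping.keys v. twt t = w}"
  unfolding wt_proj_def
  using keys_lin[of "\<lambda>t. if twt t = w then gen t else 0" v] by (fastforce split: if_splits)

lemma wt_proj_tree_space: "v \<in> tree_space X n e \<Longrightarrow> wt_proj w v \<in> tree_space X n e"
  using keys_wt_proj[of w v] by (auto simp: tree_space_iff)

lemma wt_proj_null: "coll X \<Longrightarrow> v \<in> null X \<Longrightarrow> wt_proj w v \<in> null X"
  unfolding wt_proj_def
  using null_filter[of X v "\<lambda>\<tau>. snd (snd \<tau>) = w"] pm.span_mono[of "{r \<in> drel X. \<forall>t\<in>Poly_Mapping.keys r. snd (snd (ttype t)) = w}" "drel X"]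
  by (auto simp: ttype_def)

lemma wt_proj_rel: "wt_proj w (rel f v) = rel f (wt_proj w v)"
  unfolding wt_proj_def rel_def lin_lin by (rule lin_ext_cong) (simp add: lin_simps)

lemma wt_proj_sum:
  assumes "finite W" "twt ` Poly_Mapping.keys v \<subseteq> W"
  shows "(\<Sum>w\<in>W. wt_proj w v) = v"
proof -
  have "(\<Sum>w\<in>W. wt_proj w v) = lin (\<lambda>t. \<Sum>w\<in>W. if twt t = w then gen t else 0) v"
    by (simp add: wt_proj_def lin_fun_sum)
  also have "\<dots> = lin gen v"
    by (rule lin_ext_cong) (use assms in auto)
  finally show ?thesis by simp
qed

text \<open>Every term of the differential contracts one edge and so loses exactly one
  vertex.\<close>

lemma bar_wt_proj: "bar_diff P (wt_proj (Suc w) v) = wt_proj w (bar_diff P v)"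
  unfolding wt_proj_def bar_diff_def lin_lin
proof (rule lin_ext_cong)
  fix t
  have "lin (\<lambda>t'. if twt t' = w then gen t' else 0) (bar_tree P t)
      = lin (\<lambda>t'. if twt t = Suc w then gen t' else 0) (bar_tree P t)"
    by (rule lin_ext_cong) (use keys_bar_tree[of _ P t] in fastforce)
  then show "lin (bar_tree P) (if twt t = Suc w then gen t else 0) =
      lin (\<lambda>t'. if twt t' = w then gen t' else 0) (bar_tree P t)"
    by (simp add: lin_simps)
qed

lemma bar_wt_proj_small: "w \<le> 1 \<Longrightarrow> bar_diff P (wt_proj w v) = 0"
proof -
  assume "w \<le> 1"
  then have "bar_diff P (wt_proj w v) = lin (\<lambda>t. 0) (wt_proj w v)"
    unfolding bar_diff_def
    by (intro lin_ext_cong bar_small) (use keys_wt_proj[of w v] in fastforce)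
  then show ?thesis by simp
qed

context wg_operad_weight
begin

lemma lin_ext_lin: "lin_ext (scl P) f (lin g v) = lin_ext (scl P) (\<lambda>a. lin_ext (scl P) f (g a)) v"
  by (subst (2) lin_ext_def, subst lin_ext_def)
    (simp add: lin_ext_sum[OF vs] lin_ext_pscale[OF vs])

text \<open>The sign of the double suspension cancels the contraction sign: the root has suspended
  degree \<open>e' + 1\<close>, contraction gives the sign of \<open>e'\<close>, and the leaves to
  the left of the inner edge have degree zero.\<close>

lemma bar_susp_two:
  assumes t: "t \<in> trees (wt_coll P d) n e" and w: "twt t = 2"
  shows "lin_ext (scl P) corolla_value (pscale (ksign (root_deg t)) (bar_tree P (susp_tree t)))
    = act P (length (leaves t)) (inv (leaf_perm t)) (planar_eval P t)"
proof -
  obtain e' x a f y us b where N: "t = Node e' x (a @ Node f y us # b)"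
    and l: "\<forall>t\<in>set (a @ us @ b). twt t = 0"
    using two_vertices[OF w] .
  let ?n = "length a + 1 + length b"
  let ?z = "pcomp P ?n (length us) (length a) x y"
  have x: "x \<in> wpart P ?n d e'" and y: "y \<in> wpart P (length us) d f"
    using t by (auto simp: trees_def N)
  have s: "map susp_tree a = a" "map susp_tree us = us" "map susp_tree b = b"
    using l by (auto intro!: susp_tree_leaves)
  let ?c = "Node (e' + 1 + (f + 1) - 1) ?z (a @ us @ b)"
  have a0: "tdegs a = 0" by (rule tdegs_leaves) (use l in auto)
  have "bar_tree P (susp_tree t) = bar_at P (e' + 1) x a b (Node (f + 1) y us)"
    using ssum_bar_at_leaves[of a P "e' + 1" x id "\<lambda>b'. b' @ Node (f + 1) y us # b"]
      ssum_bar_at_leaves[of b P "e' + 1" x "\<lambda>a'. a @ Node (f + 1) y us # a'" id] l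
    by (simp add: N s ssum_append)
  also have "\<dots> = pscale (ksign e') (gen ?c)"
    using ssum_bar_at_leaves[of us P "f + 1" y id id] l
    by (simp add: bar_at_def a0 node_ctx_simps)
  finally have "pscale (ksign (root_deg t)) (bar_tree P (susp_tree t)) = gen ?c"
    by (simp add: N)
  moreover have "corolla_value ?c = act P (length (leaves t)) (inv (leaf_perm t)) ?z"
  proof -
    have lt: "leaves t = leaves ?c" by (simp add: N)
    have len: "length (a @ us @ b) = length (leaves t)"
      using leaves_only(2)[of "a @ us @ b"] l unfolding lt by simp
    have "set (leaves t) = {..<n}" "distinct (leaves t)" using t by (auto simp: trees_def)
    then have "length (leaves t) = n" "mset (leaves t) = mset_set {..<n}"
      using distinct_card[of "leaves t"] distinct_leaves_iff[of "{..<n}" "leaves t"] by auto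
    then have "twt ?c = 1 \<and> mset (leaves ?c) = mset_set {..<length (leaves t)}"
      using l unfolding lt by auto
    from trans[OF corolla_value_Node[OF len] if_P[OF this]] show ?thesis
      using leaf_perm_cong[OF lt] by simp
  qed
  ultimately show ?thesis
    unfolding planar_eval_two[OF N l x y] by (simp only: lin_ext_gen[OF vs])
qed

lemma tree_space_wt_iff: "v \<in> tree_space_wt X w n e \<longleftrightarrow> Poly_Mapping.keys v \<subseteq> {t \<in> trees X n e. twt t = w}"
  unfolding tree_space_wt_def by (rule span_gen_iff)

lemma susp2_tree_space:
  assumes "y \<in> tree_space_wt (wt_coll P d) 2 n (e - 2)"
  shows "susp2 y \<in> tree_space E n e" "\<forall>t\<in>Poly_Mapping.keys (susp2 y). twt t = 2"
proof -
  have "susp2 y \<in> pm.span (gen ` {t \<in> trees E n e. twt t = 2})"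
    unfolding susp2_def
  proof (rule lin_in_span)
    fix t assume "t \<in> Poly_Mapping.keys y"
    then have "t \<in> trees (wt_coll P d) n (e - 2)" "twt t = 2" using assms by (auto simp: tree_space_wt_iff)
    then have "susp_tree t \<in> trees E n e" "twt (susp_tree t) = 2" using susp_tree_trees[of t "wt_coll P d" n "e - 2"] by auto
    then show "pscale (ksign (root_deg t)) (gen (susp_tree t)) \<in> pm.span (gen ` {t \<in> trees E n e. twt t = 2})"
      by (intro pm.span_scale pm.span_base) auto
  qed
  then show "susp2 y \<in> tree_space E n e" "\<forall>t\<in>Poly_Mapping.keys (susp2 y). twt t = 2"
    by (auto simp: span_gen_iff tree_space_iff)
qed

text \<open>The differential of a two-vertex element is a combination of corollas, and
  \<open>bar_susp_two\<close> identifies its coordinate in weight one with the evaluation.\<close>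

lemma bar_susp2_null_iff:
  assumes y: "y \<in> tree_space_wt (wt_coll P d) 2 n (e - 2)"
  shows "bar_diff P (susp2 y) \<in> null D \<longleftrightarrow> evaluation P y = 0"
proof -
  note s = susp2_tree_space[OF y]
  have "bar_diff P (susp2 y) \<in> tree_space D n (e - 1)"
    using s(1) tree_space_E_D by (intro bar_tree_space) auto
  moreover have "\<forall>t\<in>Poly_Mapping.keys (bar_diff P (susp2 y)). twt t = 1"
  proof
    fix t assume t: "t \<in> Poly_Mapping.keys (bar_diff P (susp2 y))"
    obtain u where "u \<in> Poly_Mapping.keys (susp2 y)" "t \<in> Poly_Mapping.keys (bar_tree P u)"
      using subsetD[OF keys_lin t[unfolded bar_diff_def]] by blast
    then show "twt t = 1" using s(2) keys_bar_tree[of t P u] by auto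
  qed
  ultimately have "bar_diff P (susp2 y) \<in> null D \<longleftrightarrow> lin_ext (scl P) corolla_value (bar_diff P (susp2 y)) = 0"
    by (rule corolla_null_iff)
  moreover have "lin_ext (scl P) corolla_value (bar_diff P (susp2 y)) = evaluation P y"
    unfolding bar_diff_def susp2_def evaluation_def lin_lin
  proof (subst lin_ext_lin, rule lin_ext_cong)
    fix t assume "t \<in> Poly_Mapping.keys y"
    then have "t \<in> trees (wt_coll P d) n (e - 2)" "twt t = 2" using y by (auto simp: tree_space_wt_iff)
    from bar_susp_two[OF this]
    show "lin_ext (scl P) corolla_value (lin (bar_tree P) (pscale (ksign (root_deg t)) (gen (susp_tree t))))
      = act P (length (leaves t)) (inv (leaf_perm t)) (planar_eval P t)"
      by (simp add: lin_simps)
  qed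
  ultimately show ?thesis by simp
qed

lemma susp2_surj:
  assumes x: "x \<in> tree_space E n e" and w: "\<forall>t\<in>Poly_Mapping.keys x. twt t = 2"
  obtains y where "y \<in> tree_space_wt (wt_coll P d) 2 n (e - 2)" "susp2 y = x"
proof -
  \<comment> \<open>The sign of \<open>susp2\<close> is repeated because it is its own
    inverse.\<close>
  let ?y = "lin (\<lambda>t. pscale (ksign (root_deg (desusp_tree t))) (gen (desusp_tree t))) x"
  have "?y \<in> tree_space_wt (wt_coll P d) 2 n (e - 2)"
    unfolding tree_space_wt_def
  proof (rule lin_in_span)
    fix t assume "t \<in> Poly_Mapping.keys x"
    then have "t \<in> trees E n e" "twt t = 2" using x w by (auto simp: tree_space_iff)
    then have "desusp_tree t \<in> trees (wt_coll P d) n (e - 2)" "twt (desusp_tree t) = 2"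
      using desusp_tree_trees[of t "wt_coll P d" n e] twt_susp_tree[of "desusp_tree t"] by (auto simp: susp_desusp)
    then show "pscale (ksign (root_deg (desusp_tree t))) (gen (desusp_tree t))
        \<in> pm.span (gen ` {t \<in> trees (wt_coll P d) n (e - 2). twt t = 2})"
      by (intro pm.span_scale pm.span_base) auto
  qed
  moreover have "susp2 ?y = lin gen x"
    unfolding susp2_def lin_lin by (rule lin_ext_cong) (simp add: lin_simps susp_desusp)
  ultimately show ?thesis using that by simp
qed

end

section \<open>Decompositions over arbitrary sets of leaves\<close>

lemma ecut_relabel:
  fixes t :: "'p tree"
  assumes "inj \<sigma>"
  shows "ecut (\<sigma> ` S) (\<sigma> s) (relabel \<sigma> t) = (rel_pair \<sigma> \<sigma> (ecut S s t) :: _ \<Rightarrow>\<^sub>0 'k::field)"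
proof (induct t)
  case (Leaf j)
  have "\<sigma> ` S = {\<sigma> j} \<longleftrightarrow> S = {j}"
    using inj_image_eq_iff[OF assms, of S "{j}"] by simp
  then show ?case by (simp add: ecut_eq lin_simps)
next
  case (Node e x ts)
  let ?T = "Node e x ts"
  have "ecut_above (\<sigma> ` S) (\<sigma> s) (relabel \<sigma> ?T)
      = ssum ts (\<lambda>a t b. dec_ctx e x (map (relabel \<sigma>) a) (map (relabel \<sigma>) b) (rel_pair \<sigma> \<sigma> (ecut S s t)) :: _ \<Rightarrow>\<^sub>0 'k)"
    using Node by (auto simp: ssum_map intro!: ssum_cong)
  also have "\<dots> = rel_pair \<sigma> \<sigma> (ecut_above S s ?T)"
    by (simp add: lin_ssum dec_ctx_def lin_lin lin_simps comp_def)
  finally have "ecut_above (\<sigma> ` S) (\<sigma> s) (relabel \<sigma> ?T) = (rel_pair \<sigma> \<sigma> (ecut_above S s ?T) :: _ \<Rightarrow>\<^sub>0 'k)" .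
  moreover have "\<sigma> ` S = set (leaves (relabel \<sigma> ?T)) \<longleftrightarrow> S = set (leaves ?T)"
    using inj_image_eq_iff[OF assms, of S "set (leaves ?T)"] by (simp only: leaves_relabel set_map)
  moreover have "rel_pair \<sigma> \<sigma> (if c then gen (Leaf s, ?T) else 0)
      = (if c then gen (Leaf (\<sigma> s), relabel \<sigma> ?T) else 0 :: _ \<Rightarrow>\<^sub>0 'k)" for c
    by (simp add: lin_simps)
  ultimately show ?case
    unfolding ecut_eq[of _ _ "relabel \<sigma> ?T"] ecut_eq[of S s ?T] lin_add by (simp only:)
qed

text \<open>The cooperad structure only cuts over consecutive leaves; equivariance under such a
  permutation gives access to all other sets.\<close>

lemma permutes_to_initial_segment:
  assumes "S \<subseteq> {..<n}"
  shows "\<exists>\<sigma>. \<sigma> permutes {..<n} \<and> \<sigma> ` S = {..<card S}"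
proof -
  have fin: "finite S" using assms finite_subset by blast
  have le: "card S \<le> n" using card_mono[OF _ assms] by simp
  obtain f where f: "bij_betw f S {..<card S}"
    using finite_same_card_bij[OF fin, of "{..<card S}"] by auto
  have "card ({..<n} - S) = card ({..<n} - {..<card S})"
    using le by (simp add: card_Diff_subset[OF fin assms] card_Diff_subset)
  then obtain g where g: "bij_betw g ({..<n} - S) ({..<n} - {..<card S})"
    using finite_same_card_bij[of "{..<n} - S" "{..<n} - {..<card S}"] by auto
  let ?h = "\<lambda>j. if j \<in> S then f j else if j < n then g j else j"
  have 1: "bij_betw ?h S {..<card S}"
    by (rule bij_betw_cong[THEN iffD1, OF _ f]) simp
  have 2: "bij_betw ?h ({..<n} - S) ({..<n} - {..<card S})"
    by (rule bij_betw_cong[THEN iffD1, OF _ g]) auto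
  have "bij_betw ?h (S \<union> ({..<n} - S)) ({..<card S} \<union> ({..<n} - {..<card S}))"
    by (rule bij_betw_combine[OF 1 2]) auto
  moreover have "S \<union> ({..<n} - S) = {..<n}" "{..<card S} \<union> ({..<n} - {..<card S}) = {..<n}"
    using assms le by auto
  ultimately have "bij_betw ?h {..<n} {..<n}" by simp
  then have "?h permutes {..<n}"
    using assms by (intro bij_imp_permutes) auto
  then show ?thesis using bij_betw_imp_surj_on[OF 1] by blast
qed

lemma contract_relabel:
  "contract P e x (map (relabel f) a) (map (relabel f) b) (relabel f t) = rel f (contract P e x a b t)"
  by (cases t) (simp_all add: rel_def lin_simps comp_def)

lemma bar_relabel: "bar_tree P (relabel f t) = rel f (bar_tree P t)"
proof (induct t)
  case (Leaf j)
  then show ?case by (simp add: rel_def)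
next
  case (Node e x ts)
  have "bar_at P e x (map (relabel f) a) (map (relabel f) b) (relabel f t) = rel f (bar_at P e x a b t)"
    if "t \<in> set ts" for a t b
    unfolding bar_at_def contract_relabel Node[OF that]
    by (simp add: rel_def lin_simps node_ctx_def lin_lin comp_def)
  then show ?case by (simp add: ssum_map rel_def lin_ssum cong: ssum_cong)
qed

lemma bar_rel: "bar_diff P (rel f v) = rel f (bar_diff P v)"
  unfolding bar_diff_def rel_def lin_lin
  by (rule lin_ext_cong) (simp add: lin_simps bar_relabel rel_def)

lemma tnull_wt_filter:
  assumes "coll X" "v \<in> tnull X"
  shows "lin (\<lambda>p. if Q (twt (fst p)) (twt (snd p)) then gen p else 0) v \<in> tnull X"
proof (rule lin_tnull[OF assms(2) subspace_tnull], goal_cases)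
  case (1 r u)
  obtain \<tau> where \<tau>: "\<forall>t\<in>Poly_Mapping.keys r. ttype t = \<tau>" using drel_keys[OF assms(1) 1(1)] by blast
  have "lin (\<lambda>l. if Q (twt (fst (l, u))) (twt (snd (l, u))) then gen (l, u) else 0) r
    = lin (\<lambda>l. if Q (snd (snd \<tau>)) (twt u) then gen l \<otimes>\<^sub>p gen u else 0) r"
    by (rule lin_ext_cong) (use \<tau> in \<open>auto simp: ttype_def tensor_gen\<close>)
  also have "\<dots> = (if Q (snd (snd \<tau>)) (twt u) then r \<otimes>\<^sub>p gen u else 0)"
    by (simp add: tensor_left[of r])
  also have "\<dots> \<in> tnull X"
    using 1 by (auto intro: tnull_left pm.span_base pm.subspace_0[OF subspace_tnull])
  finally show ?case .
next
  case (2 r l)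
  obtain \<tau> where \<tau>: "\<forall>t\<in>Poly_Mapping.keys r. ttype t = \<tau>" using drel_keys[OF assms(1) 2(1)] by blast
  have "lin (\<lambda>u. if Q (twt (fst (l, u))) (twt (snd (l, u))) then gen (l, u) else 0) r
    = lin (\<lambda>u. if Q (twt l) (snd (snd \<tau>)) then gen l \<otimes>\<^sub>p gen u else 0) r"
    by (rule lin_ext_cong) (use \<tau> in \<open>auto simp: ttype_def tensor_gen\<close>)
  also have "\<dots> = (if Q (twt l) (snd (snd \<tau>)) then gen l \<otimes>\<^sub>p r else 0)"
    by (simp add: tensor_right[of _ r])
  also have "\<dots> \<in> tnull X"
    using 2 by (auto intro: tnull_right pm.span_base pm.subspace_0[OF subspace_tnull])
  finally show ?case .
qed

lemma tnull_tensor_left: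
  assumes "v \<in> null X" "\<forall>u\<in>Poly_Mapping.keys y. decorated X u"
  shows "v \<otimes>\<^sub>p y \<in> tnull X"
  by (subst tensor_right, rule lin_in_subspace[OF subspace_tnull]) (use assms tnull_left in auto)

lemma tnull_tensor_right:
  assumes "v \<in> null X" "\<forall>u\<in>Poly_Mapping.keys y. decorated X u"
  shows "y \<otimes>\<^sub>p v \<in> tnull X"
  by (subst tensor_left, rule lin_in_subspace[OF subspace_tnull]) (use assms tnull_right in auto)

lemma tensor_lin_lin: "lin f x \<otimes>\<^sub>p lin g y = lin (\<lambda>a. lin (\<lambda>b. f a \<otimes>\<^sub>p g b) y) x"
  unfolding tensor_lin_left by (intro lin_ext_cong tensor_lin_right)

text \<open>The terms of total weight \<open>w\<close> are sorted by the weight of the upper factor,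
  so that the induction hypothesis can be applied to each pair of homogeneous components.\<close>

lemma wt_filter_tensor:
  fixes a b :: "'p tree \<Rightarrow>\<^sub>0 'k::field"
  shows "lin (\<lambda>p. if twt (fst p) + twt (snd p) = w then gen p else 0) (a \<otimes>\<^sub>p b)
    = (\<Sum>k\<le>w. wt_proj (w - k) a \<otimes>\<^sub>p wt_proj k b)"
proof -
  have "(\<Sum>k\<le>w. wt_proj (w - k) a \<otimes>\<^sub>p wt_proj k b)
    = lin (\<lambda>l. lin (\<lambda>u. \<Sum>k\<le>w. if twt l = w - k \<and> twt u = k then gen (l, u) else 0) b) a"
  proof -
    have "wt_proj i a \<otimes>\<^sub>p wt_proj k b = lin (\<lambda>l. lin (\<lambda>u. if twt l = i \<and> twt u = k then gen (l, u) else 0) b) a" for i k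
      unfolding wt_proj_def tensor_lin_lin
      by (intro lin_ext_cong) (auto simp: tensor_simps tensor_gen)
    then show ?thesis by (simp add: lin_fun_sum)
  qed
  also have "\<dots> = lin (\<lambda>l. lin (\<lambda>u. if twt l + twt u = w then gen (l, u) else 0) b) a"
  proof (intro lin_ext_cong)
    fix l u :: "'p tree"
    have "(\<Sum>k\<le>w. if twt l = w - k \<and> twt u = k then gen (l, u) else 0)
      = (\<Sum>k\<le>w. if k = twt u then (if twt l + twt u = w then gen (l, u) else 0) else (0 :: _ \<Rightarrow>\<^sub>0 'k))"
      by (rule sum.cong) auto
    also have "\<dots> = (if twt l + twt u = w then gen (l, u) else 0)" by auto
    finally show "(\<Sum>k\<le>w. if twt l = w - k \<and> twt u = k then gen (l, u) else 0)
      = (if twt l + twt u = w then gen (l, u) else (0 :: _ \<Rightarrow>\<^sub>0 'k))" .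
  qed
  finally show ?thesis by (simp add: lin_tensor)
qed

text \<open>In \<open>tensor_null\<close> the factor next to a null element is arbitrary, possibly
  undecorated, whereas \<open>tnull\<close> needs it decorated. Filtering both factors by decoration
  repairs this without changing \<open>v\<close>.\<close>

lemma tensor_space_decorated:
  assumes S: "\<And>n e. S n e \<subseteq> tree_space X n e" and X: "coll X"
    and v: "v \<in> tensor_space (cofree_cooperad X) S n m e"
    and keys: "\<forall>p\<in>Poly_Mapping.keys v. decorated X (fst p) \<and> decorated X (snd p)"
  shows "v \<in> pm.span ({a \<otimes>\<^sub>p b | a b f g. a \<in> S n f \<and> b \<in> S m g} \<union> tnull X)"
proof -
  let ?f = "\<lambda>p. if decorated X (fst p) \<and> decorated X (snd p) then gen p else 0"
  let ?g = "\<lambda>t. if decorated X t then gen t else 0"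
  let ?W = "pm.span ({a \<otimes>\<^sub>p b | a b f g. a \<in> S n f \<and> b \<in> S m g} \<union> tnull X)"
  have T: "lin ?f (a \<otimes>\<^sub>p b) = lin ?g a \<otimes>\<^sub>p lin ?g b" for a b
    unfolding lin_tensor tensor_lin_lin
    by (intro lin_ext_cong) (auto simp: tensor_simps tensor_gen)
  have g: "lin ?g a = a" if "\<forall>t\<in>Poly_Mapping.keys a. decorated X t" for a
  proof -
    have "lin ?g a = lin gen a" by (rule lin_ext_cong) (use that in auto)
    then show ?thesis by simp
  qed
  have gd: "\<forall>t\<in>Poly_Mapping.keys (lin ?g a). decorated X t" for a
    using keys_lin[of ?g a] by (fastforce split: if_splits)
  have dS: "\<forall>t\<in>Poly_Mapping.keys a. decorated X t" if "a \<in> tree_space X n e" for a n e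
    using that by (auto simp: tree_space_iff trees_def)
  have dN: "a \<in> null X \<and> (\<forall>t\<in>Poly_Mapping.keys a. decorated X t)" if "a \<in> tree_null X n e" for a n e
    using that coll.tree_null_iff[OF X] by (auto simp: trees_def)
  have "lin ?f v \<in> ?W"
  proof (rule lin_span[OF v[unfolded tensor_space_def tensor_null_def cofree_simps]], simp)
    fix r assume "r \<in> {x \<otimes>\<^sub>p y |x y f g. x \<in> S n f \<and> y \<in> S m g \<and> f + g = e} \<union>
      pm.span ({x \<otimes>\<^sub>p y |x y e. x \<in> tree_null X n e} \<union> {x \<otimes>\<^sub>p y |x y e. y \<in> tree_null X m e})"
    then show "lin ?f r \<in> ?W"
    proof
      assume "r \<in> {x \<otimes>\<^sub>p y |x y f g. x \<in> S n f \<and> y \<in> S m g \<and> f + g = e}"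
      then obtain a b f g' where r: "r = a \<otimes>\<^sub>p b" "a \<in> S n f" "b \<in> S m g'" by blast
      have "lin ?g a = a" "lin ?g b = b"
        by (rule g[OF dS[OF subsetD[OF S r(2)]]], rule g[OF dS[OF subsetD[OF S r(3)]]])
      then have "lin ?f r = r" unfolding r(1) T by (simp only:)
      then show ?thesis using r by (auto intro!: pm.span_base)
    next
      assume "r \<in> pm.span ({x \<otimes>\<^sub>p y |x y e. x \<in> tree_null X n e} \<union> {x \<otimes>\<^sub>p y |x y e. y \<in> tree_null X m e})"
      then have "lin ?f r \<in> tnull X"
      proof (rule lin_span[OF _ subspace_tnull])
        fix r assume "r \<in> {x \<otimes>\<^sub>p y |x y e. x \<in> tree_null X n e} \<union> {x \<otimes>\<^sub>p y |x y e. y \<in> tree_null X m e}"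
        then consider x y e where "r = x \<otimes>\<^sub>p y" "x \<in> tree_null X n e" | x y e where "r = x \<otimes>\<^sub>p y" "y \<in> tree_null X m e"
          by blast
        then show "lin ?f r \<in> tnull X"
        proof cases
          case 1
          note d = dN[OF 1(2)]
          show ?thesis unfolding 1(1) T g[OF conjunct2[OF d]]
            by (rule tnull_tensor_left[OF conjunct1[OF d] gd])
        next
          case 2
          note d = dN[OF 2(2)]
          show ?thesis unfolding 2(1) T g[OF conjunct2[OF d]]
            by (rule tnull_tensor_right[OF conjunct1[OF d] gd])
        qed
      qed
      then show ?thesis by (intro pm.span_base) simp
    qed
  qed
  moreover have "lin ?f v = lin gen v"
    by (rule lin_ext_cong) (use keys in auto)
  ultimately show ?thesis by simp
qed

text \<open>Move \<open>U\<close> to an initial segment, decompose over the first inputs, and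
  relabel back. The factors stay relabelled elements of \<open>A\<close>: after the way back their
  labels are in general no initial segment.\<close>

lemma ecut_subcooperad:
  assumes X: "coll X" and S: "subcooperad (cofree_cooperad X) A"
    and x: "x \<in> A n e" and U: "U \<subseteq> {..<n}"
  shows "\<exists>\<rho> \<tau> k m. lin (ecut U n) x \<in>
    pm.span ({rel \<rho> a \<otimes>\<^sub>p rel \<tau> b | a b f g. a \<in> A k f \<and> b \<in> A m g} \<union> tnull X)"
proof -
  note sub = subcooperad_cofreeD[OF S]
  obtain \<sigma> where \<sigma>: "\<sigma> permutes {..<n}" "\<sigma> ` U = {..<card U}"
    using permutes_to_initial_segment[OF U] by blast
  \<comment> \<open>Chosen so that \<open>?k + ?m - 1 = n\<close>, also for empty \<open>U\<close>,
    where the upper factor has arity zero.\<close>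
  let ?m = "card U" and ?k = "n + 1 - card U"
  have m: "?m \<le> n" using card_mono[OF _ U] by simp
  then have k: "0 < ?k" "?k + ?m - 1 = n" by auto
  have x': "rel \<sigma> x \<in> A n e"
    using sub(4)[OF permutes_inv[OF \<sigma>(1)] x] by (simp add: inv_inv_eq permutes_bij[OF \<sigma>(1)])
  have xs: "x \<in> tree_space X n e" "rel \<sigma> x \<in> tree_space X n e" using x x' sub(3) by blast+
  let ?c = "(collapse ?m 0)(n := 0)"
  let ?v = "lin (tree_decomp ?m 0) (rel \<sigma> x)"
  have \<sigma>n: "\<sigma> n = n" using \<sigma>(1) by (simp add: permutes_def)
  have "?v = rel_pair ?c (\<lambda>j. j - 0) (lin (ecut {0..<0 + ?m} n) (rel \<sigma> x))"
    using lin_decomp_ecut[of "rel \<sigma> x" X ?k ?m e 0] xs(2) unfolding k(2) by blast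
  also have "lin (ecut {0..<0 + ?m} n) (rel \<sigma> x) = lin (\<lambda>t. ecut (\<sigma> ` U) (\<sigma> n) (relabel \<sigma> t)) x"
    by (simp add: rel_def lin_lin lin_simps \<sigma>(2) \<sigma>n atLeast0LessThan)
  also have "\<dots> = rel_pair \<sigma> \<sigma> (lin (ecut U n) x)"
    unfolding lin_lin by (rule lin_ext_cong) (rule ecut_relabel[OF permutes_inj[OF \<sigma>(1)]])
  finally have v: "?v = rel_pair (?c \<circ> \<sigma>) \<sigma> (lin (ecut U n) x)"
    by (simp add: lin_lin lin_simps relabel_relabel comp_def)
  have bij: "inj_on ?c (insert n ({..<n} - {0..<0 + ?m}))"
    using bij_collapse[OF k(1), of ?m] unfolding k(2) by (simp add: bij_betw_def)
  \<comment> \<open>Undoes the renumbering on the labels that occur below the cut, the mark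
    included, and then the permutation.\<close>
  define \<rho> where "\<rho> = inv \<sigma> \<circ> inv_into (insert n ({..<n} - {0..<0 + ?m})) ?c"
  have nU: "n \<notin> U" using U by auto
  have keys: "\<exists>t. t \<in> trees X n e \<and> p \<in> Poly_Mapping.keys (ecut U n t :: _ \<Rightarrow>\<^sub>0 'a)"
    if "p \<in> Poly_Mapping.keys (lin (ecut U n) x)" for p
    using subsetD[OF keys_lin that] xs(1) by (auto simp: tree_space_iff)
  have "rel_pair \<rho> (inv \<sigma>) ?v = lin (\<lambda>p. gen (relabel (\<rho> \<circ> (?c \<circ> \<sigma>)) (fst p), relabel (inv \<sigma> \<circ> \<sigma>) (snd p))) (lin (ecut U n) x)"
    unfolding v by (simp add: lin_lin lin_simps relabel_relabel)
  also have "\<dots> = lin gen (lin (ecut U n) x)"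
  proof (rule lin_ext_cong)
    fix p assume "p \<in> Poly_Mapping.keys (lin (ecut U n) x)"
    then obtain t where t: "t \<in> trees X n e" "p \<in> Poly_Mapping.keys (ecut U n t :: _ \<Rightarrow>\<^sub>0 'a)" using keys by blast
    have l: "set (leaves (fst p)) = insert n ({..<n} - U)" by (rule ecut_trees(2)[OF t nU])
    have "relabel (\<rho> \<circ> (?c \<circ> \<sigma>)) (fst p) = fst p"
    proof (rule relabel_id)
      fix j assume "j \<in> set (leaves (fst p))"
      then have j: "j = n \<or> j < n \<and> j \<notin> U" unfolding l by auto
      have "\<sigma> j \<in> insert n ({..<n} - {0..<0 + ?m})"
      proof (cases "j = n")
        case False
        then have "\<sigma> j \<in> {..<n}" using j permutes_in_image[OF \<sigma>(1), of j] by auto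
        moreover have "\<sigma> j \<notin> \<sigma> ` U" using False j permutes_inj[OF \<sigma>(1)] by (auto dest: injD)
        ultimately show ?thesis unfolding \<sigma>(2) by auto
      qed (simp add: \<sigma>n)
      then have "inv_into (insert n ({..<n} - {0..<0 + ?m})) ?c (?c (\<sigma> j)) = \<sigma> j"
        by (rule inv_into_f_f[OF bij])
      then show "(\<rho> \<circ> (?c \<circ> \<sigma>)) j = j"
        unfolding \<rho>_def comp_def using permutes_inverses(2)[OF \<sigma>(1)] by simp
    qed
    moreover have "relabel (inv \<sigma> \<circ> \<sigma>) (snd p) = snd p"
      using permutes_inv_o(2)[OF \<sigma>(1)] by (simp add: relabel_id)
    ultimately show "gen (relabel (\<rho> \<circ> (?c \<circ> \<sigma>)) (fst p), relabel (inv \<sigma> \<circ> \<sigma>) (snd p)) = gen p" by simp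
  qed
  finally have eq: "lin (ecut U n) x = rel_pair \<rho> (inv \<sigma>) ?v" by simp
  have "?v \<in> tensor_space (cofree_cooperad X) A ?k ?m e"
    using sub(5)[OF k(1), of "rel \<sigma> x" ?m e] x' unfolding k(2) by blast
  moreover have "\<forall>p\<in>Poly_Mapping.keys ?v. decorated X (fst p) \<and> decorated X (snd p)"
  proof
    fix p assume p: "p \<in> Poly_Mapping.keys ?v"
    obtain q where "q \<in> Poly_Mapping.keys (lin (ecut U n) x)"
      "p = (relabel (?c \<circ> \<sigma>) (fst q), relabel \<sigma> (snd q))"
      using subsetD[OF keys_lin p[unfolded v]] by auto
    then show "decorated X (fst p) \<and> decorated X (snd p)"
      using keys[of q] ecut_trees(6,7)[OF _ _ nU, of _ X e q] by auto
  qed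
  ultimately have "?v \<in> pm.span ({a \<otimes>\<^sub>p b | a b f g. a \<in> A ?k f \<and> b \<in> A ?m g} \<union> tnull X)"
    using sub(3) by (intro tensor_space_decorated[OF _ X]) auto
  then have "lin (ecut U n) x \<in> pm.span ({rel \<rho> a \<otimes>\<^sub>p rel (inv \<sigma>) b | a b f g. a \<in> A ?k f \<and> b \<in> A ?m g} \<union> tnull X)"
    unfolding eq
  proof (rule lin_span, simp)
    fix r assume "r \<in> {a \<otimes>\<^sub>p b | a b f g. a \<in> A ?k f \<and> b \<in> A ?m g} \<union> tnull X"
    then show "rel_pair \<rho> (inv \<sigma>) r \<in> pm.span ({rel \<rho> a \<otimes>\<^sub>p rel (inv \<sigma>) b | a b f g. a \<in> A ?k f \<and> b \<in> A ?m g} \<union> tnull X)"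
    proof
      assume "r \<in> {a \<otimes>\<^sub>p b | a b f g. a \<in> A ?k f \<and> b \<in> A ?m g}"
      then obtain a b f g where r: "r = a \<otimes>\<^sub>p b" "a \<in> A ?k f" "b \<in> A ?m g" by blast
      have "rel_pair \<rho> (inv \<sigma>) r = rel \<rho> a \<otimes>\<^sub>p rel (inv \<sigma>) b"
        unfolding r(1) rel_def lin_tensor tensor_lin_lin by (simp add: tensor_gen)
      then show ?thesis using r(2,3) by (auto intro!: pm.span_base)
    next
      assume "r \<in> tnull X"
      then show ?thesis using tnull_rel_pair by (intro pm.span_base) blast
    qed
  qed
  then show ?thesis by blast
qed

section \<open>The differential on decomposed elements\<close>

context wg_operad_weight
begin

lemma bar_pair_tnull:
  assumes "v \<in> tnull D"
  shows "lin (bar_pair P) v \<in> tnull D"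
proof (rule lin_tnull[OF assms subspace_tnull], goal_cases)
  case (1 r u)
  obtain i where i: "\<forall>t\<in>Poly_Mapping.keys r. tdeg t = i" using drel_tdeg[OF coll_D 1(1)] .
  have r: "r \<in> null D" using 1 by (intro pm.span_base)
  have "lin (\<lambda>l. bar_pair P (l, u)) r = lin (bar_tree P) r \<otimes>\<^sub>p gen u + pscale (ksign i) (r \<otimes>\<^sub>p bar_tree P u)"
    using lin_const_deg[OF i, of id "\<lambda>l. gen l \<otimes>\<^sub>p bar_tree P u"]
    by (simp add: lin_fun_add tensor_lin_left tensor_left[of r "bar_tree P u"])
  also have "\<dots> \<in> tnull D"
    using 1 r bar_null keys_bar_decorated
    by (intro pm.subspace_add[OF subspace_tnull] pm.subspace_scale[OF subspace_tnull] tnull_left tnull_tensor_left) auto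
  finally show ?case .
next
  case (2 r l)
  have r: "r \<in> null D" using 2 by (intro pm.span_base)
  have "lin (\<lambda>u. bar_pair P (l, u)) r = bar_tree P l \<otimes>\<^sub>p r + pscale (ksign (tdeg l)) (gen l \<otimes>\<^sub>p lin (bar_tree P) r)"
    by (simp add: lin_fun_add lin_fun_pscale tensor_lin_right tensor_right[of "bar_tree P l" r])
  also have "\<dots> \<in> tnull D"
    using 2 r bar_null keys_bar_decorated
    by (intro pm.subspace_add[OF subspace_tnull] pm.subspace_scale[OF subspace_tnull] tnull_right tnull_tensor_right) auto
  finally show ?case .
qed

abbreviation "inner_part \<equiv> lin (\<lambda>p :: 'p tree \<times> 'p tree. if twt (fst p) > 0 \<and> twt (snd p) > 0 then gen p else 0 :: _ \<Rightarrow>\<^sub>0 'k)"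

text \<open>The induction hypothesis of the weight argument, imposed on components because the
  elements of a subcooperad may mix weights. The decoration is required over \<open>D\<close>, where
  the differential takes its values.\<close>

definition bar_closed_below :: "nat \<Rightarrow> ('p tree \<Rightarrow>\<^sub>0 'k) set" where
  "bar_closed_below w = {a. (\<forall>t\<in>Poly_Mapping.keys a. decorated D t) \<and> (\<forall>k<w. bar_diff P (wt_proj k a) \<in> null D)}"

lemma inner_part_tensor:
  "inner_part (x \<otimes>\<^sub>p y) = lin (\<lambda>l. lin (\<lambda>u. if twt l > 0 \<and> twt u > 0 then gen (l, u) else 0) y) x"
  by (simp add: lin_tensor)

lemma inner_part_zero:
  "\<forall>t\<in>Poly_Mapping.keys y. twt t = 0 \<Longrightarrow> inner_part (x \<otimes>\<^sub>p y) = 0"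
  "\<forall>t\<in>Poly_Mapping.keys x. twt t = 0 \<Longrightarrow> inner_part (x \<otimes>\<^sub>p y) = 0"
proof -
  assume "\<forall>t\<in>Poly_Mapping.keys y. twt t = 0"
  then have "inner_part (x \<otimes>\<^sub>p y) = lin (\<lambda>l. lin (\<lambda>u. 0) y) x"
    unfolding inner_part_tensor by (intro lin_ext_cong) auto
  then show "inner_part (x \<otimes>\<^sub>p y) = 0" by simp
next
  assume "\<forall>t\<in>Poly_Mapping.keys x. twt t = 0"
  then have "inner_part (x \<otimes>\<^sub>p y) = lin (\<lambda>l. lin (\<lambda>u. 0) y) x"
    unfolding inner_part_tensor by (intro lin_ext_cong) auto
  then show "inner_part (x \<otimes>\<^sub>p y) = 0" by simp
qed

text \<open>The induction hypothesis does not cover a factor of full weight \<open>w\<close>. But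
  then the other factor has no vertex: its own differential vanishes, and the remaining term is
  removed by the restriction to pairs with vertices on both sides.\<close>

lemma inner_bar_tensor:
  assumes a: "a \<in> bar_closed_below w" and b: "b \<in> bar_closed_below w" and k: "k \<le> w"
  shows "inner_part (lin (bar_pair P) (wt_proj (w - k) a \<otimes>\<^sub>p wt_proj k b)) \<in> tnull D"
proof -
  let ?a = "wt_proj (w - k) a" and ?b = "wt_proj k b"
  let ?s = "lin (\<lambda>l. pscale (ksign (tdeg l)) (gen l)) ?a"
  have da: "\<forall>t\<in>Poly_Mapping.keys ?a. decorated D t \<and> twt t = w - k"
    using a keys_wt_proj[of "w - k" a] by (auto simp: bar_closed_below_def)
  have db: "\<forall>t\<in>Poly_Mapping.keys ?b. decorated D t \<and> twt t = k"
    using b keys_wt_proj[of k b] by (auto simp: bar_closed_below_def)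
  have ds: "\<forall>t\<in>Poly_Mapping.keys ?s. decorated D t \<and> twt t = w - k"
    using da by (auto dest!: subsetD[OF keys_lin] subsetD[OF keys_pscale])
  have eq: "lin (bar_pair P) (?a \<otimes>\<^sub>p ?b) = bar_diff P ?a \<otimes>\<^sub>p ?b + ?s \<otimes>\<^sub>p bar_diff P ?b"
  proof -
    have "lin (\<lambda>p. bar_tree P (fst p) \<otimes>\<^sub>p gen (snd p)) (?a \<otimes>\<^sub>p ?b) = bar_diff P ?a \<otimes>\<^sub>p ?b"
      unfolding lin_tensor bar_diff_def tensor_lin_left fst_conv snd_conv
      by (intro lin_ext_cong tensor_right[symmetric])
    moreover have "lin (\<lambda>p. pscale (ksign (tdeg (fst p))) (gen (fst p) \<otimes>\<^sub>p bar_tree P (snd p))) (?a \<otimes>\<^sub>p ?b)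
        = ?s \<otimes>\<^sub>p bar_diff P ?b"
      unfolding lin_tensor bar_diff_def tensor_lin_lin fst_conv snd_conv
      by (intro lin_ext_cong) (simp add: tensor_lin_right tensor_simps lin_fun_pscale)
    ultimately show ?thesis by (simp add: lin_fun_add)
  qed
  consider "k = 0" | "k = w" | "0 < k" "k < w" using k by linarith
  then show ?thesis
  proof cases
    case 1
    have "bar_diff P ?b = 0" by (rule bar_wt_proj_small) (simp add: 1)
    then have "lin (bar_pair P) (?a \<otimes>\<^sub>p ?b) = bar_diff P ?a \<otimes>\<^sub>p ?b" by (simp add: eq tensor_simps)
    moreover have "inner_part (bar_diff P ?a \<otimes>\<^sub>p ?b) = 0"
      by (rule inner_part_zero(1)) (use db 1 in auto)
    ultimately show ?thesis by (simp add: pm.subspace_0[OF subspace_tnull])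
  next
    case 2
    have "bar_diff P ?a = 0" by (rule bar_wt_proj_small) (simp add: 2)
    then have "lin (bar_pair P) (?a \<otimes>\<^sub>p ?b) = ?s \<otimes>\<^sub>p bar_diff P ?b" by (simp add: eq tensor_simps)
    moreover have "inner_part (?s \<otimes>\<^sub>p bar_diff P ?b) = 0"
      by (rule inner_part_zero(2)) (use ds 2 in auto)
    ultimately show ?thesis by (simp add: pm.subspace_0[OF subspace_tnull])
  next
    case 3
    have "bar_diff P ?a \<in> null D" "bar_diff P ?b \<in> null D"
      using a b 3 by (auto simp: bar_closed_below_def)
    then have "lin (bar_pair P) (?a \<otimes>\<^sub>p ?b) \<in> tnull D"
      unfolding eq using db ds
      by (intro pm.subspace_add[OF subspace_tnull] tnull_tensor_left tnull_tensor_right) auto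
    then show ?thesis by (rule tnull_wt_filter[OF coll_D, where Q = "\<lambda>i j. i > 0 \<and> j > 0"])
  qed
qed

text \<open>The filter on total weight stands for \<open>wt_proj w\<close> applied before the cut;
  it allows the tensor factors to be inhomogeneous.\<close>

lemma inner_bar_span:
  assumes "v \<in> pm.span ({a \<otimes>\<^sub>p b | a b. a \<in> bar_closed_below w \<and> b \<in> bar_closed_below w} \<union> tnull D)"
  shows "inner_part (lin (bar_pair P) (lin (\<lambda>p. if twt (fst p) + twt (snd p) = w then gen p else 0) v)) \<in> tnull D"
  unfolding lin_lin
proof (rule lin_span[OF assms subspace_tnull], unfold lin_lin[symmetric])
  fix r assume "r \<in> {a \<otimes>\<^sub>p b | a b. a \<in> bar_closed_below w \<and> b \<in> bar_closed_below w} \<union> tnull D"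
  then show "inner_part (lin (bar_pair P) (lin (\<lambda>p. if twt (fst p) + twt (snd p) = w then gen p else 0) r)) \<in> tnull D"
  proof
    assume "r \<in> {a \<otimes>\<^sub>p b | a b. a \<in> bar_closed_below w \<and> b \<in> bar_closed_below w}"
    then obtain a b where r: "r = a \<otimes>\<^sub>p b" "a \<in> bar_closed_below w" "b \<in> bar_closed_below w" by blast
    show ?thesis
      unfolding r(1) wt_filter_tensor lin_sum
      by (intro pm.subspace_sum[OF subspace_tnull] inner_bar_tensor r) simp
  next
    assume "r \<in> tnull D"
    then show ?thesis
      using tnull_wt_filter[OF coll_D, of _ "\<lambda>i j. i + j = w"] tnull_wt_filter[OF coll_D, of _ "\<lambda>i j. i > 0 \<and> j > 0"]
        bar_pair_tnull by blast
  qed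
qed

end

section \<open>Comparison of the two cooperads\<close>

text \<open>Brings an element into the list form in which \<open>cooperad_iso\<close> asks for a
  decomposition; scalars are absorbed by the left factor.\<close>

lemma tensor_space_sum:
  assumes S: "\<And>n e. pm.subspace (S n e)" and v: "v \<in> tensor_space C S n m e"
  shows "\<exists>zs. (\<forall>(f, a, b)\<in>set zs. a \<in> S n f \<and> b \<in> S m (e - f)) \<and>
    v - (\<Sum>(f, a, b)\<leftarrow>zs. a \<otimes>\<^sub>p b) \<in> tensor_null C n m"
  using v[unfolded tensor_space_def]
proof (induct rule: pm.span_induct_alt)
  case base
  show ?case by (rule exI[of _ "[]"]) (simp add: pm.subspace_0[OF subspace_tensor_null])
next
  case (step c x y)
  then obtain zs where zs: "\<forall>(f, a, b)\<in>set zs. a \<in> S n f \<and> b \<in> S m (e - f)"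
    "y - (\<Sum>(f, a, b)\<leftarrow>zs. a \<otimes>\<^sub>p b) \<in> tensor_null C n m" by blast
  from step(1) show ?case
  proof
    assume "x \<in> {x \<otimes>\<^sub>p y |x y f g. x \<in> S n f \<and> y \<in> S m g \<and> f + g = e}"
    then obtain a b f g where ab: "x = a \<otimes>\<^sub>p b" "a \<in> S n f" "b \<in> S m g" "f + g = e" by blast
    then have "b \<in> S m (e - f)" by auto
    then show ?thesis
      using ab zs pm.subspace_scale[OF S ab(2)]
      by (intro exI[of _ "(f, pscale c a, b) # zs"]) (simp add: tensor_simps)
  next
    assume x: "x \<in> tensor_null C n m"
    have "pscale c x + (y - (\<Sum>(f, a, b)\<leftarrow>zs. a \<otimes>\<^sub>p b)) \<in> tensor_null C n m"
      by (intro pm.subspace_add[OF subspace_tensor_null] pm.subspace_scale[OF subspace_tensor_null] x zs)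
    then show ?thesis using zs(1) by (intro exI[of _ zs]) (simp add: algebra_simps)
  qed
qed

context wg_operad_weight
begin

abbreviation "C\<^sub>E \<equiv> cofree_cooperad E"
abbreviation "C\<^sub>D \<equiv> cofree_cooperad D"

definition quadratic_corelations :: "nat \<Rightarrow> int \<Rightarrow> ('p tree \<Rightarrow>\<^sub>0 'k) set" where
  "quadratic_corelations n e = pm.span (susp2 ` (eval_kernel P (wt_coll P d) n (e - 2)
     \<inter> tree_space_wt (wt_coll P d) 2 n (e - 2)) \<union> tree_null E n e)"

lemma tnull_E_D: "tnull E \<subseteq> tnull D"
  unfolding tnull_def[of E]
proof (rule pm.span_minimal[OF _ subspace_tnull])
  have "r \<in> null D" if "r \<in> drel E" for r using that by (intro null_E_D pm.span_base)
  then show "{r \<otimes>\<^sub>p gen u |r u. r \<in> drel E \<and> decorated E u} \<union> {gen l \<otimes>\<^sub>p r |l r. decorated E l \<and> r \<in> drel E} \<subseteq> tnull D"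
    using decorated_E_D tnull_left tnull_right by blast
qed

text \<open>Induction on the weight: by the coderivation property, the reduced decompositions of
  \<open>bar_diff P x\<close> only involve the differential of elements of smaller weight.\<close>

lemma bar_wt_proj_null:
  assumes S: "subcooperad C\<^sub>E A" and wt2: "\<And>n e. wt_proj 2 ` A n e \<subseteq> quadratic_corelations n e"
    and x: "x \<in> A n e"
  shows "bar_diff P (wt_proj w x) \<in> null D"
  using x
proof (induct w arbitrary: n e x rule: less_induct)
  case (less w)
  note sub = subcooperad_cofreeD[OF S]
  have xE: "x \<in> tree_space E n e" using less(2) sub(3) by blast
  \<comment> \<open>With at most one vertex there is nothing to contract, and weight two is the
    hypothesis on the corelations. From weight three on, an inner edge remains after one
    contraction.\<close>
  consider "w \<le> 1" | "w = 2" | "w \<ge> 3" by linarith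
  then show ?case
  proof cases
    case 1
    then show ?thesis by (simp add: bar_wt_proj_small pm.span_zero)
  next
    case 2
    have "wt_proj 2 x \<in> quadratic_corelations n e" using wt2 less(2) by blast
    then have "lin (bar_tree P) (wt_proj 2 x) \<in> null D"
      unfolding quadratic_corelations_def
    proof (rule lin_span[OF _ subspace_null])
      fix r assume "r \<in> susp2 ` (eval_kernel P (wt_coll P d) n (e - 2)
          \<inter> tree_space_wt (wt_coll P d) 2 n (e - 2)) \<union> tree_null E n e"
      then show "lin (bar_tree P) r \<in> null D"
      proof
        assume "r \<in> susp2 ` (eval_kernel P (wt_coll P d) n (e - 2) \<inter> tree_space_wt (wt_coll P d) 2 n (e - 2))"
        then show ?thesis
          using bar_susp2_null_iff[of _ n e] by (auto simp: eval_kernel_def bar_diff_def)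
      next
        assume "r \<in> tree_null E n e"
        then show ?thesis using coll.tree_null_subset(2)[OF coll_wt] null_E_D bar_null by blast
      qed
    qed
    then show ?thesis by (simp add: 2 bar_diff_def)
  next
    case 3
    let ?x = "wt_proj w x"
    let ?z = "bar_diff P ?x"
    \<comment> \<open>Here \<open>\<rho>\<close> is any relabelling, so \<open>rel \<rho> a\<close>
      may lie outside \<open>A\<close>; the hypothesis for \<open>a\<close> carries over because the
      differential and the weight components commute with relabelling.\<close>
    have A_below: "rel \<rho> a \<in> bar_closed_below w" if a: "a \<in> A k f" for \<rho> a k f
    proof -
      have "a \<in> tree_space E k f" using a sub(3) by blast
      then have "\<forall>t\<in>Poly_Mapping.keys a. decorated D t"
        using decorated_E_D by (auto simp: tree_space_iff trees_def)
      then have "\<forall>t\<in>Poly_Mapping.keys (rel \<rho> a). decorated D t"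
        unfolding rel_def by (auto dest!: subsetD[OF keys_lin])
      then show ?thesis
        using less(1)[OF _ a] by (auto simp: bar_closed_below_def wt_proj_rel bar_rel null_rel)
    qed
    have inner: "inner_part (lin (ecut U n) ?z) \<in> tnull D" if U: "U \<subseteq> {..<n}" for U
    proof -
      obtain \<rho> \<tau> k m where "lin (ecut U n) x \<in>
          pm.span ({rel \<rho> a \<otimes>\<^sub>p rel \<tau> b | a b f g. a \<in> A k f \<and> b \<in> A m g} \<union> tnull E)"
        using ecut_subcooperad[OF coll_wt S less(2) U] by blast
      also have "\<dots> \<subseteq> pm.span ({a \<otimes>\<^sub>p b | a b. a \<in> bar_closed_below w \<and> b \<in> bar_closed_below w} \<union> tnull D)"
        by (rule pm.span_mono) (use A_below tnull_E_D in blast)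
      finally have "inner_part (lin (bar_pair P) (lin (\<lambda>p. if twt (fst p) + twt (snd p) = w then gen p else 0)
          (lin (ecut U n) x))) \<in> tnull D"
        by (rule inner_bar_span)
      \<comment> \<open>A cut distributes the vertices over the two parts, so total weight is
        preserved.\<close>
      moreover have "lin (\<lambda>p. if twt (fst p) + twt (snd p) = w then gen p else 0) (lin (ecut U n) x) = lin (ecut U n) ?x"
        unfolding wt_proj_def lin_lin
      proof (rule lin_ext_cong)
        fix t
        have "lin (\<lambda>p. if twt (fst p) + twt (snd p) = w then gen p else 0) (ecut U n t)
          = lin (\<lambda>p. if twt t = w then gen p else 0) (ecut U n t :: _ \<Rightarrow>\<^sub>0 'k)"
          by (rule lin_ext_cong) (use keys_ecut[of _ _ U n t] in fastforce)
        then show "lin (\<lambda>p. if twt (fst p) + twt (snd p) = w then gen p else 0) (ecut U n t)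
          = (lin (ecut U n) (if twt t = w then gen t else 0) :: _ \<Rightarrow>\<^sub>0 'k)"
          by (simp add: lin_simps)
      qed
      moreover have "lin (bar_pair P) (lin (ecut U n) ?x) = lin (ecut U n) ?z"
        unfolding bar_diff_def lin_lin bar_leibniz ..
      ultimately show ?thesis by simp
    qed
    have zs: "?z \<in> tree_space D n (e - 1)"
      using wt_proj_tree_space[OF xE] tree_space_E_D by (intro bar_tree_space) blast
    have zw: "twt t = w - 1" if t: "t \<in> Poly_Mapping.keys ?z" for t
    proof -
      obtain u where "u \<in> Poly_Mapping.keys ?x" "t \<in> Poly_Mapping.keys (bar_tree P u)"
        using subsetD[OF keys_lin t[unfolded bar_diff_def]] by blast
      then show ?thesis using keys_wt_proj[of w x] keys_bar_tree[of t P u] by auto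
    qed
    let ?p = "\<lambda>p. if twt (fst p) > 0 \<and> twt (snd p) > 0 then plug n (snd p) (fst p) else 0 :: 'p tree \<Rightarrow>\<^sub>0 'k"
    have plug: "lin ?p (lin (ecut U n) ?z) \<in> null D" if U: "U \<subseteq> {..<n}" for U
    proof -
      have "lin ?p (lin (ecut U n) ?z) = lin (\<lambda>p. plug n (snd p) (fst p)) (inner_part (lin (ecut U n) ?z))"
        unfolding lin_lin[of "\<lambda>p. plug n (snd p) (fst p)"]
        by (rule lin_ext_cong) (simp add: lin_simps)
      then show ?thesis using plug_tnull[OF coll_D inner[OF U]] by simp
    qed
    have "(\<Sum>U\<in>Pow {..<n}. lin ?p (lin (ecut U n) ?z)) \<in> null D"
      by (rule pm.span_sum) (use plug in blast)
    also have "(\<Sum>U\<in>Pow {..<n}. lin ?p (lin (ecut U n) ?z)) = lin (\<lambda>t. \<Sum>U\<in>Pow {..<n}. lin ?p (ecut U n t)) ?z"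
      by (simp add: lin_lin lin_fun_sum)
    \<comment> \<open>The trees of \<open>?z\<close> have \<open>w - 1\<close> vertices, hence
      \<open>w - 2\<close> inner edges to cut and reglue.\<close>
    also have "\<dots> = lin (\<lambda>t. pscale (of_nat (w - 2)) (gen t)) ?z"
    proof (rule lin_ext_cong)
      fix t assume t: "t \<in> Poly_Mapping.keys ?z"
      have "set (leaves t) = {..<n}" using t zs by (auto simp: tree_space_iff trees_def)
      then have "(\<Sum>U\<in>Pow {..<n}. lin ?p (ecut U n t)) = pscale (of_nat (twt t - 1)) (gen t)"
        by (intro sum_plug_ecut) auto
      then show "(\<Sum>U\<in>Pow {..<n}. lin ?p (ecut U n t)) = pscale (of_nat (w - 2)) (gen t)"
        using zw[OF t] 3 by (simp add: numeral_2_eq_2)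
    qed
    finally have "pscale (of_nat (w - 2)) ?z \<in> null D"
      by (simp add: lin_fun_pscale)
    then have "pscale (inverse (of_nat (w - 2))) (pscale (of_nat (w - 2)) ?z) \<in> null D"
      by (rule pm.span_scale)
    \<comment> \<open>Characteristic zero together with \<open>w \<ge> 3\<close>. For
      \<open>w = 2\<close> the factor is zero and regluing gives no information, which is why that
      weight is a base case.\<close>
    moreover have "(of_nat (w - 2) :: 'k) \<noteq> 0" by (subst of_nat_eq_0_iff) (use 3 in simp)
    ultimately show ?thesis by (simp only: pm.scale_scale left_inverse pm.scale_one not_False_eq_True)
  qed
qed

lemma bar_null_of_quadratic:
  assumes "subcooperad C\<^sub>E A" "\<And>n e. wt_proj 2 ` A n e \<subseteq> quadratic_corelations n e" "x \<in> A n e"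
  shows "bar_diff P x \<in> tree_null D n (e - 1)"
proof -
  have x: "x \<in> tree_space D n e"
    using assms(3) subcooperad_cofreeD(3)[OF assms(1)] tree_space_E_D by blast
  let ?W = "twt ` Poly_Mapping.keys x"
  have "bar_diff P x = lin (bar_tree P) (\<Sum>w\<in>?W. wt_proj w x)"
    by (subst wt_proj_sum) (auto simp: bar_diff_def)
  also have "\<dots> = (\<Sum>w\<in>?W. bar_diff P (wt_proj w x))" by (simp add: lin_sum bar_diff_def)
  also have "\<dots> \<in> null D" by (intro pm.span_sum bar_wt_proj_null[OF assms])
  finally show ?thesis
    using bar_tree_space[OF x] coll.tree_null_iff[OF coll_D] by (simp add: tree_space_iff)
qed

definition quadratic_sub :: "(nat \<Rightarrow> int \<Rightarrow> ('p tree \<Rightarrow>\<^sub>0 'k) set) \<Rightarrow> bool" where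
  "quadratic_sub S \<longleftrightarrow> subcooperad C\<^sub>E S \<and> (\<forall>n e. wt_proj 2 ` S n e \<subseteq> quadratic_corelations n e)"

definition koszul_sub :: "(nat \<Rightarrow> int \<Rightarrow> ('p tree \<Rightarrow>\<^sub>0 'k) set) \<Rightarrow> bool" where
  "koszul_sub S \<longleftrightarrow> dg_subcooperad P S \<and>
    (\<forall>n e. S n e \<subseteq> pm.span (tree_space E n e \<union> tree_null D n e))"

lemma quadratic_sub_null: "quadratic_sub (tree_null E)"
proof -
  interpret E: coll E by (rule coll_wt)
  have "wt_proj 2 v \<in> quadratic_corelations n e" if "v \<in> tree_null E n e" for v n e
  proof -
    have "wt_proj 2 v \<in> tree_null E n e"
      using that wt_proj_null[OF coll_wt[of d], of v 2] wt_proj_tree_space[of v E n e 2]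
      unfolding E.tree_null_iff tree_space_iff by blast
    then show ?thesis unfolding quadratic_corelations_def by (intro pm.span_base) blast
  qed
  then show ?thesis using E.subcooperad_null by (auto simp: quadratic_sub_def)
qed

text \<open>Taking the weight two component is linear and the corelations form a subspace, so the
  sum of all candidates is again a candidate.\<close>

lemma quadratic_sub_sup: "quadratic_sub (sup_family quadratic_sub)"
proof -
  have "wt_proj 2 v \<in> quadratic_corelations n e" if v: "v \<in> sup_family quadratic_sub n e" for v n e
    unfolding wt_proj_def
  proof (rule sup_family_lin[OF _ _ v])
    show "pm.subspace (quadratic_corelations n e)" by (simp add: quadratic_corelations_def)
    fix S v assume "quadratic_sub S" "v \<in> S n e"
    then show "lin (\<lambda>t. if twt t = 2 then gen t else 0) v \<in> quadratic_corelations n e"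
      unfolding quadratic_sub_def wt_proj_def by blast
  qed
  moreover have "subcooperad C\<^sub>E (sup_family quadratic_sub)"
    by (rule subcooperad_sup[where Q = quadratic_sub, OF _ quadratic_sub_null]) (simp add: quadratic_sub_def)
  ultimately show ?thesis unfolding quadratic_sub_def by blast
qed

lemma bar_tree_null: "v \<in> tree_null D n e \<Longrightarrow> bar_diff P v \<in> tree_null D n (e - 1)"
  using bar_null[of v] bar_tree_space[of v n e] coll.tree_null_iff[OF coll_D] unfolding bar_diff_def
  by (simp add: tree_space_iff)

lemma dg_subcooperad_iff:
  "dg_subcooperad P S \<longleftrightarrow> subcooperad C\<^sub>D S \<and> (\<forall>n e. \<forall>v\<in>S n e. bar_diff P v \<in> S n (e - 1))"
  unfolding dg_subcooperad_def bar_cooperad_def by blast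

lemma koszul_sub_null: "koszul_sub (tree_null D)"
  unfolding koszul_sub_def dg_subcooperad_iff
  using coll.subcooperad_null[OF coll_D] bar_tree_null by (auto intro: pm.span_base)

lemma koszul_sub_sup: "koszul_sub (sup_family koszul_sub)"
proof -
  have "bar_diff P v \<in> sup_family koszul_sub n (e - 1)" if v: "v \<in> sup_family koszul_sub n e" for v n e
    unfolding bar_diff_def
  proof (rule sup_family_lin[OF _ _ v])
    show "pm.subspace (sup_family koszul_sub n (e - 1))" by (simp add: sup_family_def)
    fix S v assume S: "koszul_sub S" "v \<in> S n e"
    then have "bar_diff P v \<in> S n (e - 1)" unfolding koszul_sub_def dg_subcooperad_iff by blast
    then show "lin (bar_tree P) v \<in> sup_family koszul_sub n (e - 1)"
      using sup_family_upper[of koszul_sub S, OF S(1)] unfolding bar_diff_def by blast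
  qed
  moreover have "subcooperad C\<^sub>D (sup_family koszul_sub)"
    by (rule subcooperad_sup[where Q = koszul_sub, OF _ koszul_sub_null]) (simp add: koszul_sub_def dg_subcooperad_iff)
  moreover have "sup_family koszul_sub n e \<subseteq> pm.span (tree_space E n e \<union> tree_null D n e)" for n e
    by (rule sup_family_least) (auto simp: koszul_sub_def)
  ultimately show ?thesis unfolding koszul_sub_def dg_subcooperad_iff by blast
qed

lemma tensor_null_E_D: "tensor_null C\<^sub>E n m \<subseteq> tensor_null C\<^sub>D n m"
  unfolding tensor_null_def cofree_simps by (rule pm.span_mono) (use tree_null_E_D in blast)

text \<open>Subspaces of the quotient are given by their full preimages, so passing to the larger
  ambient collection means adding its null elements.\<close>

lemma koszul_sub_of_quadratic:
  assumes A: "quadratic_sub A"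
  shows "koszul_sub (\<lambda>n e. pm.span (A n e \<union> tree_null D n e))"
proof -
  let ?S = "\<lambda>n e. pm.span (A n e \<union> tree_null D n e)"
  interpret D: coll D by (rule coll_D)
  have S: "subcooperad C\<^sub>E A" and wt2: "\<And>n e. wt_proj 2 ` A n e \<subseteq> quadratic_corelations n e"
    using A by (auto simp: quadratic_sub_def)
  note sub = subcooperad_cofreeD[OF S]
  have sub_S: "A n e \<subseteq> ?S n e" "tree_null D n e \<subseteq> ?S n e" for n e by (auto intro: pm.span_base)
  have 1: "?S n e \<subseteq> tree_space D n e" for n e
    by (rule pm.span_minimal[OF _ subspace_tree_space]) (use sub(3) tree_space_E_D D.tree_null_subset(1) in blast)
  have 2: "rel (inv \<sigma>) v \<in> ?S n e" if "\<sigma> permutes {..<n}" "v \<in> ?S n e" for n e \<sigma> v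
    unfolding rel_def
  proof (rule lin_span[OF that(2)], simp, unfold rel_def[symmetric])
    fix v assume "v \<in> A n e \<union> tree_null D n e"
    then show "rel (inv \<sigma>) v \<in> ?S n e"
      using sub(4)[OF that(1)] D.rel_tree_null[OF _ permutes_inv[OF that(1)]] sub_S by blast
  qed
  have 3: "lin (tree_decomp m i) v \<in> tensor_space C\<^sub>D ?S n m e" if "i < n" "v \<in> ?S (n + m - 1) e" for n m i e v
  proof (rule lin_span[OF that(2) tensor_space_subspace])
    fix v assume "v \<in> A (n + m - 1) e \<union> tree_null D (n + m - 1) e"
    then show "lin (tree_decomp m i) v \<in> tensor_space C\<^sub>D ?S n m e"
    proof
      assume "v \<in> A (n + m - 1) e"
      then have "lin (tree_decomp m i) v \<in> tensor_space C\<^sub>E A n m e" using sub(5)[OF that(1)] by blast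
      also have "\<dots> \<subseteq> tensor_space C\<^sub>D ?S n m e"
        unfolding tensor_space_def
      proof (rule pm.span_mono, rule Un_mono)
        show "{x \<otimes>\<^sub>p y |x y f g. x \<in> A n f \<and> y \<in> A m g \<and> f + g = e}
            \<subseteq> {x \<otimes>\<^sub>p y |x y f g. x \<in> ?S n f \<and> y \<in> ?S m g \<and> f + g = e}"
          using sub_S(1) by blast
      qed (rule tensor_null_E_D)
      finally show ?thesis .
    next
      assume "v \<in> tree_null D (n + m - 1) e"
      then have "lin (tree_decomp m i) v \<in> tensor_null C\<^sub>D n m" by (rule D.decomp_tree_null[OF _ that(1)])
      then show ?thesis unfolding tensor_space_def by (intro pm.span_base) blast
    qed
  qed
  \<comment> \<open>Closure under the differential holds because the differential is zero in the
    quotient, that is, takes values in \<open>tree_null D\<close>.\<close>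
  have 4: "bar_diff P v \<in> ?S n (e - 1)" if "v \<in> ?S n e" for n e v
    unfolding bar_diff_def
  proof (rule lin_span[OF that], simp, unfold bar_diff_def[symmetric])
    fix v assume "v \<in> A n e \<union> tree_null D n e"
    then have "bar_diff P v \<in> tree_null D n (e - 1)"
      using bar_null_of_quadratic[OF S wt2] bar_tree_null by blast
    then show "bar_diff P v \<in> ?S n (e - 1)" using sub_S(2) by blast
  qed
  have 5: "?S n e \<subseteq> pm.span (tree_space E n e \<union> tree_null D n e)" for n e
    by (rule pm.span_mono) (use sub(3) in blast)
  have "subcooperad C\<^sub>D ?S"
    unfolding subcooperad_cofree_iff by (intro conjI allI impI ballI 1 2 3 sub_S(2) pm.subspace_span)
  then show ?thesis
    unfolding koszul_sub_def dg_subcooperad_iff by (intro conjI allI ballI 4 5)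
qed

text \<open>The elements contained in the cofree cooperad on weight \<open>d\<close> are those
  congruent to an element of \<open>tree_space E\<close>; \<open>wlin\<close> finds such a
  representative without leaving the class.\<close>

lemma wlin_span:
  assumes "v \<in> pm.span (tree_space E n e \<union> tree_null D n e)"
  shows "wlin v \<in> tree_space E n e" "wlin v - v \<in> tree_null D n e"
proof -
  show "wlin v \<in> tree_space E n e"
    by (rule lin_span[OF assms subspace_tree_space])
      (use wlin_E wlin_tree_null coll.tree_null_subset(1)[OF coll_wt] in fastforce)
  have "lin (\<lambda>t. gen (wmap t) - gen t) v \<in> tree_null D n e"
  proof (rule lin_span[OF assms subspace_tree_null])
    fix r assume "r \<in> tree_space E n e \<union> tree_null D n e"
    then show "lin (\<lambda>t. gen (wmap t) - gen t) r \<in> tree_null D n e"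
    proof
      assume "r \<in> tree_space E n e"
      then show ?thesis by (simp add: lin_fun_diff wlin_E pm.subspace_0[OF subspace_tree_null])
    next
      assume "r \<in> tree_null D n e"
      then have "wlin r - r \<in> tree_null D n e"
        using wlin_tree_null[of r n e] tree_null_E_D[of n e]
        by (intro pm.subspace_diff[OF subspace_tree_null]) auto
      then show ?thesis by (simp add: lin_fun_diff)
    qed
  qed
  then show "wlin v - v \<in> tree_null D n e" by (simp add: lin_fun_diff)
qed

text \<open>Intersecting selects the representatives decorated by weight \<open>d\<close>. The
  delicate point is the decomposition, which is only known through tensors of elements of
  \<open>B\<close>; the projection replaces these by tensors of the intersection.\<close>

lemma quadratic_sub_of_koszul:
  assumes B: "koszul_sub B"
  shows "quadratic_sub (\<lambda>n e. B n e \<inter> tree_space E n e)"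
proof -
  let ?S = "\<lambda>n e. B n e \<inter> tree_space E n e"
  interpret D: coll D by (rule coll_D)
  interpret E: coll E by (rule coll_wt)
  have S: "subcooperad C\<^sub>D B" and dB: "\<And>n e v. v \<in> B n e \<Longrightarrow> bar_diff P v \<in> B n (e - 1)"
    and BE: "\<And>n e. B n e \<subseteq> pm.span (tree_space E n e \<union> tree_null D n e)"
    using B by (auto simp: koszul_sub_def dg_subcooperad_iff)
  note sub = subcooperad_cofreeD[OF S]
  have wB: "wlin b \<in> ?S n e" if "b \<in> B n e" for b n e
  proof -
    have w: "wlin b \<in> tree_space E n e" "wlin b - b \<in> tree_null D n e"
      using wlin_span[of b n e] that BE by blast+
    then have "(wlin b - b) + b \<in> B n e"
      using that sub(2) by (intro pm.subspace_add[OF sub(1)]) auto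
    then show ?thesis using w(1) by simp
  qed
  have 1: "pm.subspace (?S n e)" for n e
    by (rule pm.subspace_inter[OF sub(1) subspace_tree_space])
  have 2: "tree_null E n e \<subseteq> ?S n e" for n e
    using tree_null_E_D E.tree_null_subset(1) sub(2) by blast
  have 3: "rel (inv \<sigma>) v \<in> ?S n e" if "\<sigma> permutes {..<n}" "v \<in> ?S n e" for n e \<sigma> v
    using sub(4)[OF that(1)] rel_tree_space[OF _ permutes_inv[OF that(1)], of v E e] that(2) by blast
  have 4: "lin (tree_decomp m i) v \<in> tensor_space C\<^sub>E ?S n m e" if i: "i < n" and v: "v \<in> ?S (n + m - 1) e" for n m i e v
  proof -
    \<comment> \<open>Projects both factors. The decomposition of \<open>v\<close> is fixed by
      \<open>?W\<close>, since cutting a tree decorated by \<open>E\<close> gives trees decorated by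
      \<open>E\<close>, while the tensors expressing it are moved into the intersection.\<close>
    let ?W = "lin (\<lambda>p. gen (wmap (fst p), wmap (snd p)))"
    have W: "?W (a \<otimes>\<^sub>p b) = wlin a \<otimes>\<^sub>p wlin b" for a b
      unfolding lin_tensor tensor_lin_lin by (simp add: tensor_gen)
    have mem: "lin (tree_decomp m i) v \<in> pm.span ({x \<otimes>\<^sub>p y |x y f g. x \<in> B n f \<and> y \<in> B m g \<and> f + g = e}
        \<union> tensor_null C\<^sub>D n m)"
      using sub(5)[OF i, of v m e] v unfolding tensor_space_def by blast
    have "?W (lin (tree_decomp m i) v) \<in> tensor_space C\<^sub>E ?S n m e"
    proof (rule lin_span[OF mem tensor_space_subspace])
      fix r assume "r \<in> {x \<otimes>\<^sub>p y |x y f g. x \<in> B n f \<and> y \<in> B m g \<and> f + g = e} \<union> tensor_null C\<^sub>D n m"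
      then show "?W r \<in> tensor_space C\<^sub>E ?S n m e"
      proof
        assume "r \<in> {x \<otimes>\<^sub>p y |x y f g. x \<in> B n f \<and> y \<in> B m g \<and> f + g = e}"
        then obtain x y f g where r: "r = x \<otimes>\<^sub>p y" "x \<in> B n f" "y \<in> B m g" "f + g = e" by blast
        then have "?W r \<in> {x \<otimes>\<^sub>p y |x y f g. x \<in> ?S n f \<and> y \<in> ?S m g \<and> f + g = e}"
          using wB[OF r(2)] wB[OF r(3)] unfolding r(1) W by blast
        then show ?thesis unfolding tensor_space_def by (intro pm.span_base) blast
      next
        assume "r \<in> tensor_null C\<^sub>D n m"
        then have "?W r \<in> tensor_null C\<^sub>E n m"
          unfolding tensor_null_def[of C\<^sub>D] cofree_simps
        proof (rule lin_span[OF _ subspace_tensor_null])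
          fix r assume "r \<in> {x \<otimes>\<^sub>p y |x y e. x \<in> tree_null D n e} \<union> {x \<otimes>\<^sub>p y |x y e. y \<in> tree_null D m e}"
          then consider x y e where "r = x \<otimes>\<^sub>p y" "x \<in> tree_null D n e" | x y e where "r = x \<otimes>\<^sub>p y" "y \<in> tree_null D m e"
            by blast
          then show "?W r \<in> tensor_null C\<^sub>E n m"
          proof cases
            case 1
            then show ?thesis unfolding 1(1) W using wlin_tree_null by (intro tensor_null_left) simp
          next
            case 2
            then show ?thesis unfolding 2(1) W using wlin_tree_null by (intro tensor_null_right) simp
          qed
        qed
        then show ?thesis unfolding tensor_space_def by (intro pm.span_base) blast
      qed
    qed
    moreover have "?W (lin (tree_decomp m i) v) = lin gen (lin (tree_decomp m i) v)"
    proof (rule lin_ext_cong)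
      fix p assume p: "p \<in> Poly_Mapping.keys (lin (tree_decomp m i) v)"
      obtain t where t: "t \<in> Poly_Mapping.keys v" "p \<in> Poly_Mapping.keys (tree_decomp m i t :: _ \<Rightarrow>\<^sub>0 'k)"
        using subsetD[OF keys_lin p] by blast
      have "t \<in> trees E (n + m - 1) e" using t v by (auto simp: tree_space_iff)
      from tree_decomp_trees[OF this i t(2)]
      have "decorated E (fst p)" "decorated E (snd p)" by (auto simp: trees_def)
      then show "gen (wmap (fst p), wmap (snd p)) = gen p" by (simp add: wmap_E)
    qed
    ultimately show ?thesis by simp
  qed
  have 5: "wt_proj 2 x \<in> quadratic_corelations n e" if x: "x \<in> ?S n e" for x n e
  proof -
    have xE: "x \<in> tree_space E n e" using x by blast
    have "wlin (bar_diff P x) \<in> null E"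
      unfolding bar_diff_def lin_lin
      by (rule lin_in_subspace[OF subspace_null])
        (use xE wlin_bar in \<open>auto simp: tree_space_iff trees_def\<close>)
    then have "wlin (bar_diff P x) \<in> null D" by (rule null_E_D)
    \<comment> \<open>The differential of \<open>x\<close> lies in \<open>B\<close> again, hence is
      congruent to its projection; and the projection is null by \<open>wlin_bar\<close>. So the
      differential itself is null.\<close>
    moreover have "wlin (bar_diff P x) - bar_diff P x \<in> null D"
      using wlin_span(2)[of "bar_diff P x" n "e - 1"] BE dB[of x n e] x D.tree_null_subset(2) by blast
    ultimately have "wlin (bar_diff P x) - (wlin (bar_diff P x) - bar_diff P x) \<in> null D"
      by (rule pm.span_diff)
    \<comment> \<open>As \<open>x\<close> may mix weights, the component is taken only now: weight
      one of the differential is the differential of weight two.\<close>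
    then have "wt_proj 1 (bar_diff P x) \<in> null D" using wt_proj_null[OF coll_D, of _ 1] by simp
    then have null: "bar_diff P (wt_proj 2 x) \<in> null D"
      using bar_wt_proj[of P 1 x] by (simp add: numeral_2_eq_2)
    have "wt_proj 2 x \<in> tree_space E n e" "\<forall>t\<in>Poly_Mapping.keys (wt_proj 2 x). twt t = 2"
      using wt_proj_tree_space[OF xE] keys_wt_proj[of 2 x] by auto
    from susp2_surj[OF this] obtain y where y: "y \<in> tree_space_wt (wt_coll P d) 2 n (e - 2)" "susp2 y = wt_proj 2 x" .
    have "evaluation P y = 0" using bar_susp2_null_iff[OF y(1)] null y(2) by simp
    moreover have "y \<in> tree_space (wt_coll P d) n (e - 2)"
      using y(1) by (auto simp: tree_space_wt_iff tree_space_iff)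
    ultimately have "y \<in> eval_kernel P (wt_coll P d) n (e - 2) \<inter> tree_space_wt (wt_coll P d) 2 n (e - 2)"
      using y(1) by (simp add: eval_kernel_def)
    then have "wt_proj 2 x \<in> susp2 ` (eval_kernel P (wt_coll P d) n (e - 2) \<inter> tree_space_wt (wt_coll P d) 2 n (e - 2))"
      using y(2) by (metis imageI)
    then show ?thesis unfolding quadratic_corelations_def by (intro pm.span_base) blast
  qed
  have "subcooperad C\<^sub>E ?S"
    unfolding subcooperad_cofree_iff by (intro conjI allI impI ballI 1 2 3 4 Int_lower2)
  then show ?thesis unfolding quadratic_sub_def by (intro conjI allI image_subsetI 5)
qed

lemma quadratic_dual_eq:
  "quadratic_dual (qveronese P d) = C\<^sub>E\<lparr>ksp := sup_family quadratic_sub\<rparr>"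
proof -
  have "(GREATEST S. quadratic_sub S) = sup_family quadratic_sub"
    by (rule Greatest_sup_family[where Q = quadratic_sub, OF quadratic_sub_sup])
  then show ?thesis
    by (simp add: quadratic_dual_def qveronese_def quadratic_operad_def Let_def
        quadratic_sub_def[abs_def] quadratic_corelations_def)
qed

lemma koszul_dual_wt_eq:
  "koszul_dual_wt P d = C\<^sub>D\<lparr>ksp := sup_family koszul_sub\<rparr>"
proof -
  have "(GREATEST S. koszul_sub S) = sup_family koszul_sub"
    by (rule Greatest_sup_family[where Q = koszul_sub, OF koszul_sub_sup])
  then show ?thesis
    by (simp add: koszul_dual_wt_def bar_cooperad_def koszul_sub_def[abs_def])
qed

text \<open>The quotients are formed by different null spaces, so injectivity is
  \<open>tree_null_D_E\<close>, and surjectivity holds only up to changing a representative by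
  \<open>wlin\<close>.\<close>

lemma quadratic_dual_iso_koszul_dual:
  "cooperad_iso (quadratic_dual (qveronese P d)) (koszul_dual_wt P d) (\<lambda>n e x. x)"
proof -
  let ?A = "sup_family quadratic_sub" and ?B = "sup_family koszul_sub"
  interpret D: coll D by (rule coll_D)
  have A: "subcooperad C\<^sub>E ?A" using quadratic_sub_sup by (simp add: quadratic_sub_def)
  have B: "subcooperad C\<^sub>D ?B" "\<And>n e. ?B n e \<subseteq> pm.span (tree_space E n e \<union> tree_null D n e)"
    using koszul_sub_sup by (auto simp: koszul_sub_def dg_subcooperad_iff)
  note subA = subcooperad_cofreeD[OF A] and subB = subcooperad_cofreeD[OF B(1)]
  have AB: "?A n e \<subseteq> ?B n e" for n e
  proof -
    have "pm.span (?A n e \<union> tree_null D n e) \<subseteq> ?B n e"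
      using sup_family_upper[of koszul_sub "\<lambda>n e. pm.span (?A n e \<union> tree_null D n e)" n e,
          OF koszul_sub_of_quadratic[OF quadratic_sub_sup]] .
    then show ?thesis using pm.span_base by blast
  qed
  have BA: "?B n e \<inter> tree_space E n e \<subseteq> ?A n e" for n e
    using sup_family_upper[of quadratic_sub "\<lambda>n e. ?B n e \<inter> tree_space E n e" n e,
        OF quadratic_sub_of_koszul[OF koszul_sub_sup]] .
  have null: "x \<in> tree_null D n e \<longleftrightarrow> x \<in> tree_null E n e" if "x \<in> ?A n e" for x n e
    using tree_null_D_E[of x n e] tree_null_E_D subA(3) that by blast
  \<comment> \<open>The projected representative stays in \<open>?B\<close>, since it differs from
    \<open>y\<close> by a null element, and it lies in \<open>tree_space E\<close>; hence it lies in
    \<open>?A\<close>.\<close>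
  have surj: "\<exists>x\<in>?A n e. y - x \<in> tree_null D n e" if y: "y \<in> ?B n e" for y n e
  proof -
    have w: "wlin y \<in> tree_space E n e" "wlin y - y \<in> tree_null D n e"
      using wlin_span[of y n e] y B(2) by blast+
    then have "(wlin y - y) + y \<in> ?B n e"
      using y subB(2) by (intro pm.subspace_add[OF subB(1)]) auto
    then have "wlin y \<in> ?A n e" using w(1) BA by auto
    moreover have "- (wlin y - y) \<in> tree_null D n e" by (rule pm.subspace_neg[OF subspace_tree_null w(2)])
    ultimately show ?thesis by (intro bexI[of _ "wlin y"]) auto
  qed
  \<comment> \<open>One list of tensors serves both cooperads: an error term that is null over
    \<open>E\<close> is null over \<open>D\<close>.\<close>
  have decomp: "\<exists>zs. (\<forall>(f, a, b)\<in>set zs. a \<in> ?A n f \<and> b \<in> ?A m (e - f)) \<and>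
      lin (tree_decomp m i) x - (\<Sum>(f, a, b)\<leftarrow>zs. a \<otimes>\<^sub>p b) \<in> tensor_null C\<^sub>E n m \<and>
      lin (tree_decomp m i) x - (\<Sum>(f, a, b)\<leftarrow>zs. a \<otimes>\<^sub>p b) \<in> tensor_null C\<^sub>D n m"
    if "i < n" "x \<in> ?A (n + m - 1) e" for n m i e x
    using tensor_space_sum[OF subA(1) subA(5)[OF that]] tensor_null_E_D by blast
  have tn: "tensor_null (C\<lparr>ksp := S\<rparr>) = tensor_null C" for C :: "('p tree, 'k) cooperad" and S
    by (simp add: tensor_null_def fun_eq_iff)
  show ?thesis
    unfolding quadratic_dual_eq koszul_dual_wt_eq cooperad_iso_def tn
    using AB null surj decomp by (simp add: subset_iff pm.subspace_0[OF subspace_tree_null])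
qed

end

theorem theorem32:
  fixes P :: "('k::field_char_0, 'p::ab_group_add) wg_operad" and d :: nat
  assumes "connected_wg_operad P" and "d > 0"
  shows "cooperad_isomorphic (quadratic_dual (qveronese P d)) (koszul_dual_wt P d)"
proof -
  interpret wg_operad_weight P d
    using assms by (simp add: wg_operad_weight_def wg_operad_weight_axioms_def)
  show ?thesis
    unfolding cooperad_isomorphic_def using quadratic_dual_iso_koszul_dual by blast
qed

end
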